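(* Let $\delta:\mathbb{R}^n\to(0,n)$, let $p(\cdot),q(\cdot),r(\cdot)\in\mathcal{P}^{\log}(\mathbb{R}^n)$ and let $\beta\in(1,p_-)$ satisfy: (i) $\delta_->0$, $(r\delta)_+<n$ and $r_\infty\,\delta_+<n$; (ii) $p(x)\ge p_\infty$ for a.e. $x\in\mathbb{R}^n$; (iii) $\frac1\beta-\frac{1}{p(x)}=\frac{\delta(x)}{n}=\frac{1}{r(x)}-\frac{1}{q(x)}$ for $x\in\mathbb{R}^n$. Let $b$ be a locally integrable function on $\mathbb{R}^n$. Then $b\in\mathbb{L}(\delta(\cdot))$ if and only if the maximal commutator $\mathcal{M}_b$ is bounded from $L^{r(\cdot)}(\mathbb{R}^n)$ to $L^{q(\cdot)}(\mathbb{R}^n)$.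
   Context: For a real function $g$ on $\mathbb{R}^n$ put $g_-:=\inf_{x\in\mathbb{R}^n}g(x)$ and $g_+:=\sup_{x\in\mathbb{R}^n}g(x)$; e.g. $(r\delta)_+=\sup_x r(x)\delta(x)$. $\mathcal{P}(\mathbb{R}^n)$ is the set of measurable $p(\cdot):\mathbb{R}^n\to(1,\infty)$ with $1<p_-\le p_+<\infty$. $\mathcal{P}^{\log}(\mathbb{R}^n)$ is the set of $p(\cdot)\in\mathcal{P}(\mathbb{R}^n)$ for which there exist $C_{\log}(p),C_\infty\in(0,\infty)$ and $p_\infty\in\mathbb{R}$ with $|p(x)-p(y)|\le \frac{C_{\log}(p)}{\ln(e+1/|x-y|)}$ and $|p(x)-p_\infty|\le\frac{C_\infty}{\ln(e+|x|)}$ for all $x,y\in\mathbb{R}^n$. Thus $p_\infty=\lim_{|x|\to\infty}p(x)$, and similarly for $r_\infty$. For $p(\cdot)\in\mathcal{P}(\mathbb{R}^n)$, $L^{p(\cdot)}(\mathbb{R}^n)$ is the space of measurable $f$ with $\int_{\mathbb{R}^n}(|f(x)|/\lambda)^{p(x)}dx<\infty$ for some $\lambda>0$, with norm $\|f\|_{L^{p(\cdot)}(\mathbb{R}^n)}=\inf\{\lambda>0:\int_{\mathbb{R}^n}(|f(x)|/\lambda)^{p(x)}dx\le1\}$. Variable Lipschitz space: $b\in\mathbb{L}(\delta(\cdot))$ if there is a constant $C$ with $|b(x)-b(y)|\le C|x-y|^{\delta(x)}$ for all $x,y\in\mathbb{R}^n$. Functions equal almost everywhere are identified (so $b\in\mathbb{L}(\delta(\cdot))$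 is understood after possibly changing $b$ on a null set). Cubes $Q\subset\mathbb{R}^n$ have sides parallel to the coordinate axes and $|Q|$ is Lebesgue measure. The maximal commutator is $\mathcal{M}_b(f)(x):=\sup_{Q\ni x}\frac{1}{|Q|}\int_Q|b(x)-b(y)||f(y)|\,dy$, the supremum being over all cubes containing $x$. An operator $T$ (possibly nonlinear) is bounded from $L^{r(\cdot)}(\mathbb{R}^n)$ to $L^{q(\cdot)}(\mathbb{R}^n)$ if there is a constant $C$ such that $\|Tf\|_{L^{q(\cdot)}(\mathbb{R}^n)}\le C\|f\|_{L^{r(\cdot)}(\mathbb{R}^n)}$ for all $f\in L^{r(\cdot)}(\mathbb{R}^n)$. *)

theory Defs
  imports "HOL-Analysis.Analysis"
begin

text \<open>Throughout, \<open>n = CARD('n)\<close>, and \<open>g\<^sub>-\<close>, \<open>g\<^sub>+\<close> are \<open>INF x. g x\<close>, \<open>SUP x. g x\<close> (true pointwise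
  bounds, not essential ones). These are used below only for functions that are bounded.\<close>

definition var_exponent :: "(real ^ 'n \<Rightarrow> real) \<Rightarrow> bool" where
  "var_exponent p \<longleftrightarrow>
     p \<in> borel_measurable lebesgue \<and> (\<forall>x. 1 < p x) \<and>
     1 < (INF x. p x) \<and> bdd_above (range p)"

text \<open>On the diagonal \<open>x = y\<close> the first inequality reads \<open>0 \<le> C\<close> (with \<open>1 / 0 = 0\<close>), so the point
  is harmless.\<close>

definition log_var_exponent :: "(real ^ 'n \<Rightarrow> real) \<Rightarrow> bool" where
  "log_var_exponent p \<longleftrightarrow> var_exponent p \<and>
     (\<exists>C_log>0. \<exists>C_inf>0. \<exists>p_inf. \<forall>x y.
        \<bar>p x - p y\<bar> \<le> C_log / ln (exp 1 + 1 / norm (x - y)) \<and>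
        \<bar>p x - p_inf\<bar> \<le> C_inf / ln (exp 1 + norm x))"

definition exponent_at_infinity :: "(real ^ 'n \<Rightarrow> real) \<Rightarrow> real" where
  "exponent_at_infinity p = Lim at_infinity p"

text \<open>The maximal commutator may take the value \<open>\<infinity>\<close>, so variable Lebesgue spaces are set up for
  \<open>[0,\<infinity>]\<close>-valued functions; a real-valued \<open>f\<close> is treated through \<open>\<bar>f\<bar>\<close>. The powers occurring
  have positive exponent, hence \<open>\<infinity>\<close> to such a power is \<open>\<infinity>\<close>.\<close>

definition ennpowr :: "ennreal \<Rightarrow> real \<Rightarrow> ennreal" where
  "ennpowr a s = (if a = \<infinity> then \<infinity> else ennreal (enn2real a powr s))"

definition var_modular :: "(real ^ 'n \<Rightarrow> real) \<Rightarrow> (real ^ 'n \<Rightarrow> ennreal) \<Rightarrow> ennreal" where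
  "var_modular p F = (\<integral>\<^sup>+x. ennpowr (F x) (p x) \<partial>lebesgue)"

definition var_Lebesgue_enn :: "(real ^ 'n \<Rightarrow> real) \<Rightarrow> (real ^ 'n \<Rightarrow> ennreal) set" where
  "var_Lebesgue_enn p =
     {F \<in> borel_measurable lebesgue. \<exists>l>0. var_modular p (\<lambda>x. F x / ennreal l) < \<infinity>}"

text \<open>For bounded exponents the set below is nonempty for every member of the space.\<close>

definition var_norm_enn :: "(real ^ 'n \<Rightarrow> real) \<Rightarrow> (real ^ 'n \<Rightarrow> ennreal) \<Rightarrow> real" where
  "var_norm_enn p F = Inf {l. 0 < l \<and> var_modular p (\<lambda>x. F x / ennreal l) \<le> 1}"

definition var_Lebesgue :: "(real ^ 'n \<Rightarrow> real) \<Rightarrow> (real ^ 'n \<Rightarrow> real) set" where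
  "var_Lebesgue p =
     {f \<in> borel_measurable lebesgue. (\<lambda>x. ennreal \<bar>f x\<bar>) \<in> var_Lebesgue_enn p}"

definition var_norm :: "(real ^ 'n \<Rightarrow> real) \<Rightarrow> (real ^ 'n \<Rightarrow> real) \<Rightarrow> real" where
  "var_norm p f = var_norm_enn p (\<lambda>x. ennreal \<bar>f x\<bar>)"

definition bounded_between ::
  "(real ^ 'n \<Rightarrow> real) \<Rightarrow> (real ^ 'n \<Rightarrow> real) \<Rightarrow>
   ((real ^ 'n \<Rightarrow> real) \<Rightarrow> real ^ 'n \<Rightarrow> ennreal) \<Rightarrow> bool" where
  "bounded_between r q T \<longleftrightarrow>
     (\<exists>C. \<forall>f \<in> var_Lebesgue r.
        T f \<in> var_Lebesgue_enn q \<and> var_norm_enn q (T f) \<le> C * var_norm r f)"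

text \<open>Functions equal almost everywhere are identified, hence the representative \<open>b'\<close>.\<close>

definition var_Lipschitz :: "(real ^ 'n \<Rightarrow> real) \<Rightarrow> (real ^ 'n \<Rightarrow> real) set" where
  "var_Lipschitz \<delta> =
     {b. \<exists>b' C. (AE x in lebesgue. b x = b' x) \<and>
          (\<forall>x y. \<bar>b' x - b' y\<bar> \<le> C * norm (x - y) powr \<delta> x)}"

definition locally_integrable :: "(real ^ 'n \<Rightarrow> real) \<Rightarrow> bool" where
  "locally_integrable b \<longleftrightarrow> (\<forall>K. compact K \<longrightarrow> set_integrable lebesgue K b)"

definition cubes :: "(real ^ 'n) set set" where
  "cubes = {cbox a (\<chi> i. a $ i + l) | a l. 0 < l}"

definition max_commutator ::
  "(real ^ 'n \<Rightarrow> real) \<Rightarrow> (real ^ 'n \<Rightarrow> real) \<Rightarrow> real ^ 'n \<Rightarrow> ennreal" where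
  "max_commutator b f x =
     (SUP Q \<in> {Q \<in> cubes. x \<in> Q}.
        (\<integral>\<^sup>+y\<in>Q. ennreal (\<bar>b x - b y\<bar> * \<bar>f y\<bar>) \<partial>lebesgue) / emeasure lebesgue Q)"

end

(* Forward direction: a Lipschitz estimate bounds M_b by the fractional maximal operator of variable
   order sup l^delta(x) avg_Q f over cubes Q of side l containing x. If l is at most a power of
   e + |x|, then avg_Q f <= C l^(-n/r(x)), and Hedberg's trick turns l^delta(x) avg_Q f into
   (avg_Q f)^(r(x)/q(x)), so that a variable Jensen inequality reduces matters to the
   Hardy-Littlewood maximal theorem in L^s with s = inf r > 1. Otherwise Q contains a point of norm
   at least l/2, where r is close to its limit, and r_inf delta_+ < n makes l^delta(x) avg_Q f
   integrably small in x.

   Backward direction: testing on indicators of cubes, avg_Q avg_Q |b(z) - b(y)| is O(l^delta(x)) for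
   l <= 1 and O(l^delta_inf) for l > 1. Summing over dyadic cubes shrinking to Lebesgue points x, y
   yields the Lipschitz estimate almost everywhere; p >= p_inf enters as delta >= delta_inf, and the
   estimate extends to all points by uniform continuity. *)

theory Submission
  imports Defs
begin

section \<open>Cubes\<close>

text \<open>Every comparison of a power with exponent \<open>u x\<close> and one with exponent
  \<open>u y\<close> is paid for by log-Hoelder continuity, and each of its two conditions pays only
  for part of the bases. The local condition controls bases between 1 and a power of
  \<open>1 / l\<close>, for points of a cube of side \<open>l\<close>. The decay condition controls
  bases between a power of \<open>1 / (exp 1 + norm x)\<close> and 1. Smaller bases are out of
  reach, so they are raised to the integrable weight \<open>wt m\<close>, which then survives as an
  additive error and is carried through the estimates. The constant-exponent maximal theorem needs a
  power \<open>s > 1\<close> outside the average: Jensen's inequality is therefore applied with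
  \<open>r x / s\<close>, and the remaining power \<open>s\<close> is left to the maximal theorem.
  For a large cube near the origin the exponent at a point of the cube need not be the one that
  governs the norm of the indicator; hence the recurring alternative \<open>l \<le> 1\<close> or
  \<open>l / 2 \<le> norm x\<close>.\<close>

definition cube :: "real ^ 'n \<Rightarrow> real \<Rightarrow> (real ^ 'n) set" where
  "cube a l = cbox a (\<chi> i. a $ i + l)"

lemma mem_cube: "x \<in> cube a l \<longleftrightarrow> (\<forall>i. a $ i \<le> x $ i \<and> x $ i \<le> a $ i + l)"
  by (simp add: cube_def mem_box_cart)

lemma cubes_eq: "cubes = {cube a l | a l. 0 < l}"
  by (simp add: cubes_def cube_def)

lemma sets_cube [measurable, simp]: "cube a l \<in> sets lebesgue"
  by (simp add: cube_def)

text \<open>Writing the measure with \<open>powr\<close> lets it combine with fractional powers of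
  \<open>l\<close> such as \<open>l powr (real CARD('n) / r x)\<close>.\<close>

lemma emeasure_cube:
  fixes a :: "real ^ 'n"
  assumes "0 < l"
  shows "emeasure lebesgue (cube a l) = ennreal (l powr real CARD('n))"
proof -
  have ne: "cube a l \<noteq> {}"
    using assms by (auto simp: cube_def interval_ne_empty_cart intro: less_imp_le)
  have "emeasure lebesgue (cube a l) = ennreal (measure lebesgue (cube a l))"
    unfolding cube_def
    using emeasure_eq_ennreal_measure[of lborel "cbox a (\<chi> i. a $ i + l)"]
      emeasure_lborel_cbox_finite[of a "\<chi> i. a $ i + l"] by simp
  also have "measure lebesgue (cube a l) = l ^ CARD('n)"
    using ne content_cbox_cart[of a "\<chi> i. a $ i + l"] unfolding cube_def by simp
  finally show ?thesis
    using assms by (simp add: powr_realpow)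
qed

lemma corner_in_cube: "0 \<le> l \<Longrightarrow> a \<in> cube a l"
  by (simp add: mem_cube)

lemma dist_cube:
  fixes x y :: "real ^ 'n"
  assumes "x \<in> cube a l" "y \<in> cube a l"
  shows "norm (x - y) \<le> real CARD('n) * l"
proof -
  have "norm (x - y) \<le> (\<Sum>i\<in>UNIV. \<bar>(x - y) $ i\<bar>)"
    by (rule norm_le_l1_cart)
  also have "\<dots> \<le> (\<Sum>i\<in>(UNIV::'n set). l)"
  proof (rule sum_mono)
    fix i :: 'n
    have "a $ i \<le> x $ i" "x $ i \<le> a $ i + l" "a $ i \<le> y $ i" "y $ i \<le> a $ i + l"
      using assms by (auto simp: mem_cube)
    then show "\<bar>(x - y) $ i\<bar> \<le> l" by auto
  qed
  finally show ?thesis by simp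
qed

text \<open>An interval of length \<open>l\<close> has an endpoint of absolute value at least
  \<open>l / 2\<close>. Any one coordinate therefore shows that the lower corner or the opposite
  corner is far enough out.\<close>

lemma far_point_in_cube:
  fixes a :: "real ^ 'n"
  assumes "0 < l"
  obtains x where "x \<in> cube a l" "l / 2 \<le> norm x"
proof -
  fix i :: 'n
  consider "l / 2 \<le> \<bar>a $ i\<bar>" | "l / 2 \<le> \<bar>a $ i + l\<bar>"
    by linarith
  then show thesis
  proof cases
    case 1
    then have "l / 2 \<le> norm a" using component_le_norm_cart[of a i] by linarith
    then show thesis using that[of a] assms by (simp add: corner_in_cube)
  next
    case 2
    then have "l / 2 \<le> norm (\<chi> i. a $ i + l)"
      using component_le_norm_cart[of "\<chi> i. a $ i + l" i] by simp
    then show thesis using that[of "\<chi> i. a $ i + l"] assms by (simp add: mem_cube)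
  qed
qed

section \<open>Powers of extended nonnegative reals\<close>

lemma ennpowr_ennreal: "0 \<le> t \<Longrightarrow> ennpowr (ennreal t) s = ennreal (t powr s)"
  by (simp add: ennpowr_def)

lemma ennpowr_mono: "a \<le> b \<Longrightarrow> 0 \<le> s \<Longrightarrow> ennpowr a s \<le> ennpowr b s"
  by (auto simp: ennpowr_def top_unique less_top intro!: ennreal_leI powr_mono2 enn2real_mono)

lemma ennpowr_ennpowr: "ennpowr (ennpowr a s) t = ennpowr a (s * t)"
  by (auto simp: ennpowr_def powr_powr)

lemma ennpowr_one [simp]: "ennpowr a 1 = a"
  by (cases a) (auto simp: ennpowr_def)

lemma ennpowr_mult:
  assumes "0 \<le> t"
  shows "ennpowr (ennreal t * a) s \<le> ennreal (t powr s) * ennpowr a s"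
proof (cases "t = 0")
  case True then show ?thesis by (simp add: ennpowr_def)
next
  case False
  with assms have "0 < t" by simp
  then show ?thesis
    by (cases a) (auto simp: ennpowr_def ennreal_mult_top ennreal_mult[symmetric] powr_mult)
qed

text \<open>The sum is at most twice the larger summand.\<close>

lemma ennpowr_add:
  assumes "0 < s"
  shows "ennpowr (a + b) s \<le> ennreal (2 powr s) * (ennpowr a s + ennpowr b s)"
proof -
  have *: "ennpowr (a + b) s \<le> ennreal (2 powr s) * (ennpowr a s + ennpowr b s)" if "a \<le> b" for a b
  proof -
    have "ennpowr (a + b) s \<le> ennpowr (ennreal 2 * b) s"
      using that assms by (intro ennpowr_mono) (auto simp: mult_2 intro: add_right_mono)
    also have "\<dots> \<le> ennreal (2 powr s) * ennpowr b s"
      by (rule ennpowr_mult) simp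
    also have "\<dots> \<le> ennreal (2 powr s) * (ennpowr a s + ennpowr b s)"
      by (intro mult_left_mono) auto
    finally show ?thesis .
  qed
  show ?thesis
    using *[of a b] *[of b a] by (cases "a \<le> b") (auto simp: add.commute)
qed

text \<open>Raising to a positive power is an order automorphism of \<open>[0, \<infinity>]\<close>
  with the power \<open>1 / s\<close> as inverse. Bounds on powers therefore pass to suprema over
  cubes with no continuity argument.\<close>

lemma ennpowr_le_iff_le_root:
  assumes "0 < s"
  shows "ennpowr a s \<le> b \<longleftrightarrow> a \<le> ennpowr b (1 / s)"
proof
  assume "ennpowr a s \<le> b"
  then have "ennpowr (ennpowr a s) (1 / s) \<le> ennpowr b (1 / s)"
    using assms by (intro ennpowr_mono) auto
  then show "a \<le> ennpowr b (1 / s)"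
    using assms by (simp add: ennpowr_ennpowr)
next
  assume "a \<le> ennpowr b (1 / s)"
  then have "ennpowr a s \<le> ennpowr (ennpowr b (1 / s)) s"
    using assms by (intro ennpowr_mono) auto
  then show "ennpowr a s \<le> b"
    using assms by (simp add: ennpowr_ennpowr)
qed

lemma ennpowr_SUP_le:
  assumes "0 < s" "\<And>i. i \<in> I \<Longrightarrow> ennpowr (F i) s \<le> b"
  shows "ennpowr (SUP i\<in>I. F i) s \<le> b"
  using assms by (simp add: ennpowr_le_iff_le_root SUP_le_iff)

lemma borel_measurable_ennpowr [measurable]:
  assumes [measurable]: "F \<in> borel_measurable M" "p \<in> borel_measurable M"
  shows "(\<lambda>x. ennpowr (F x) (p x)) \<in> borel_measurable M"
  unfolding ennpowr_def infinity_ennreal_def by measurable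

lemma nn_integral_cube_le:
  fixes a :: "real ^ 'n"
  assumes "0 < l" "0 \<le> c" "\<And>y. y \<in> cube a l \<Longrightarrow> F y \<le> ennreal c"
  shows "(\<integral>\<^sup>+y\<in>cube a l. F y \<partial>lebesgue) \<le> ennreal (c * l powr real CARD('n))"
proof -
  have "(\<integral>\<^sup>+y\<in>cube a l. F y \<partial>lebesgue) \<le> (\<integral>\<^sup>+y\<in>cube a l. ennreal c \<partial>lebesgue)"
    using assms by (intro nn_integral_mono) (auto simp: indicator_def)
  also have "\<dots> = ennreal (c * l powr real CARD('n))"
    using assms by (subst nn_integral_cmult_indicator) (auto simp only: sets_cube emeasure_cube ennreal_mult powr_ge_zero)
  finally show ?thesis .
qed

section \<open>The weight \<open>(e + |x|) powr - m\<close>\<close>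

text \<open>Large \<open>m\<close> makes the weight integrable, while its powers with exponent
  \<open>- |u x - uinf|\<close> stay bounded for log-Hoelder \<open>u\<close>. The summand
  \<open>exp 1\<close> keeps the logarithm of the base at least 1.\<close>

definition wt :: "real \<Rightarrow> real ^ 'n \<Rightarrow> real" where
  "wt m x = (exp 1 + norm x) powr (- m)"

lemma exp1_ge_2: "2 \<le> exp (1::real)"
  using exp_ge_add_one_self[of 1] by simp

lemma exp1_norm: "1 \<le> exp 1 + norm x" "0 < exp 1 + norm x" "1 \<le> ln (exp 1 + norm x)"
proof -
  show "1 \<le> exp 1 + norm x" "0 < exp 1 + norm x"
    using exp1_ge_2 norm_ge_zero[of x] by linarith+
  then show "1 \<le> ln (exp 1 + norm x)"
    by (subst ln_ge_iff) auto
qed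

lemma wt_pos [simp]: "0 < wt m x" "0 \<le> wt m x"
  using exp1_norm[of x] unfolding wt_def by (simp_all add: powr_gt_zero)

lemma wt_antimono: "m \<le> m' \<Longrightarrow> wt m' x \<le> wt m x"
  using exp1_norm[of x] unfolding wt_def by (intro powr_mono) auto

lemma wt_le_1: "0 \<le> m \<Longrightarrow> wt m x \<le> 1"
  using wt_antimono[of 0 m x] exp1_norm[of x] by (simp add: wt_def)

lemma borel_measurable_wt [measurable]: "wt m \<in> borel_measurable lebesgue"
proof -
  have "continuous_on UNIV (wt m :: real ^ 'n \<Rightarrow> real)"
    unfolding wt_def
    by (intro continuous_intros ballI) (metis exp1_norm(2) less_irrefl)
  then show ?thesis
    using borel_measurable_continuous_onI by (intro measurable_completion) fastforce
qed

text \<open>The antiderivative \<open>arctan\<close> treats a half-line, reflection the other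
  one.\<close>

lemma nn_integral_inverse_one_plus_square: "(\<integral>\<^sup>+x. ennreal (1 / (1 + x\<^sup>2)) \<partial>lborel) < \<infinity>"
proof -
  have 1: "(\<integral>\<^sup>+x. ennreal (1 / (1 + x\<^sup>2)) * indicator {0..} x \<partial>lborel) = ennreal (pi / 2 - arctan 0)"
  proof (rule nn_integral_FTC_atLeast)
    fix x :: real
    show "DERIV arctan x :> 1 / (1 + x\<^sup>2)"
      using DERIV_arctan[of x] by (simp add: field_simps)
  qed (auto intro: tendsto_arctan_at_top)
  have "(\<integral>\<^sup>+x. ennreal (1 / (1 + x\<^sup>2)) \<partial>lborel) \<le>
        (\<integral>\<^sup>+x. ennreal (1 / (1 + x\<^sup>2)) * indicator {0..} x + ennreal (1 / (1 + (- x)\<^sup>2)) * indicator {0..} (- x) \<partial>lborel)"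
    by (intro nn_integral_mono) (auto simp: indicator_def)
  also have "\<dots> = (\<integral>\<^sup>+x. ennreal (1 / (1 + x\<^sup>2)) * indicator {0..} x \<partial>lborel)
       + (\<integral>\<^sup>+x. ennreal (1 / (1 + (- x)\<^sup>2)) * indicator {0..} (- x) \<partial>lborel)"
    by (rule nn_integral_add) auto
  also have "(\<integral>\<^sup>+x. ennreal (1 / (1 + (- x)\<^sup>2)) * indicator {0..} (- x) \<partial>lborel)
     = (\<integral>\<^sup>+x. ennreal (1 / (1 + x\<^sup>2)) * indicator {0..} x \<partial>lborel)"
    using nn_integral_real_affine[of "\<lambda>x. ennreal (1 / (1 + x\<^sup>2)) * indicator {0..} x" "-1" 0] by simp
  finally show ?thesis using 1 by (auto simp: less_top[symmetric] top_unique)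
qed

text \<open>\<open>(exp 1 + norm x)\<^sup>2\<close> dominates
  \<open>1 + (x \<bullet> b)\<^sup>2\<close> for each basis vector \<open>b\<close> separately.
  Spending an exponent 2 on each coordinate bounds the weight by a product of one-dimensional
  integrable functions, whence the threshold \<open>2 * real CARD('n)\<close>.\<close>

lemma wt_integrable:
  fixes m :: real
  assumes "2 * real CARD('n) \<le> m"
  shows "(\<integral>\<^sup>+x. ennreal (wt m (x :: real ^ 'n)) \<partial>lebesgue) < \<infinity>"
proof -
  let ?g = "\<lambda>t::real. 1 / (1 + t\<^sup>2)"
  have "(\<integral>\<^sup>+x. ennreal (wt m (x :: real ^ 'n)) \<partial>lebesgue) \<le> (\<integral>\<^sup>+x. (\<Prod>b\<in>(Basis::(real^'n) set). ennreal (?g (x \<bullet> b))) \<partial>lebesgue)"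
  proof (rule nn_integral_mono)
    fix x :: "real ^ 'n"
    have "wt m x \<le> wt (2 * real CARD('n)) x" by (rule wt_antimono[OF assms])
    also have "\<dots> = (\<Prod>b\<in>(Basis::(real^'n) set). (exp 1 + norm x) powr - 2)"
    proof -
      have "(\<Prod>b\<in>(Basis::(real^'n) set). (exp 1 + norm x) powr - 2) = ((exp 1 + norm x) powr - 2) powr real CARD('n)"
        using exp1_norm(2)[of x] by (simp add: powr_realpow)
      then show ?thesis by (simp add: wt_def powr_powr)
    qed
    also have "\<dots> \<le> (\<Prod>b\<in>(Basis::(real^'n) set). ?g (x \<bullet> b))"
    proof (intro prod_mono conjI)
      fix b :: "real ^ 'n" assume "b \<in> Basis"
      then have "\<bar>x \<bullet> b\<bar> \<le> norm x" by (rule Basis_le_norm)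
      then have "(x \<bullet> b)\<^sup>2 \<le> (norm x)\<^sup>2" by (metis abs_le_square_iff abs_norm_cancel)
      moreover have "(exp 1 + norm x)\<^sup>2 \<ge> 1 + (norm x)\<^sup>2"
      proof -
        have "1 \<le> (exp (1::real))\<^sup>2" "0 \<le> 2 * exp 1 * norm x"
          using exp1_ge_2 by (auto intro!: one_le_power)
        then show ?thesis unfolding power2_sum by linarith
      qed
      ultimately have "1 + (x \<bullet> b)\<^sup>2 \<le> (exp 1 + norm x)\<^sup>2" by linarith
      then have "1 / (exp 1 + norm x)\<^sup>2 \<le> ?g (x \<bullet> b)"
        using exp1_norm(2)[of x]
        by (intro divide_left_mono mult_pos_pos zero_less_power) (auto simp: add_pos_nonneg)
      moreover have "(exp 1 + norm x) powr - 2 = 1 / (exp 1 + norm x)\<^sup>2"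
        using exp1_norm(2)[of x] by (simp add: powr_minus powr_numeral field_simps)
      ultimately show "(exp 1 + norm x) powr - 2 \<le> ?g (x \<bullet> b)" by simp
    qed auto
    finally show "ennreal (wt m x) \<le> (\<Prod>b\<in>Basis. ennreal (?g (x \<bullet> b)))"
      by (subst prod_ennreal) (auto intro!: ennreal_leI)
  qed
  also have "\<dots> = (\<integral>\<^sup>+x. (\<Prod>b\<in>(Basis::(real^'n) set). ennreal (?g (x \<bullet> b))) \<partial>lborel)"
    by (intro nn_integral_completion)
  also have "\<dots> = (\<Prod>b\<in>(Basis::(real^'n) set). (\<integral>\<^sup>+x. ennreal (?g x) \<partial>lborel))"
    by (rule nn_integral_lborel_prod) auto
  also have "\<dots> < \<infinity>"
    using nn_integral_inverse_one_plus_square by (simp add: prod_constant power_less_top_ennreal)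
  finally show ?thesis .
qed

section \<open>Log-Hoelder continuity\<close>

text \<open>One constant serves both conditions, the limit is an argument, and the values of
  \<open>u\<close> are not restricted. The notion thus also covers \<open>r x / s\<close> and
  \<open>\<delta>\<close>, which need not satisfy \<open>var_exponent\<close>.\<close>

definition log_hoelder :: "real \<Rightarrow> real \<Rightarrow> (real ^ 'n \<Rightarrow> real) \<Rightarrow> bool" where
  "log_hoelder c uinf u \<longleftrightarrow> (\<forall>x y.
     \<bar>u x - u y\<bar> \<le> c / ln (exp 1 + 1 / norm (x - y)) \<and>
     \<bar>u x - uinf\<bar> \<le> c / ln (exp 1 + norm x))"

lemma log_hoelder_nonneg:
  fixes u :: "real ^ 'n \<Rightarrow> real"
  assumes "log_hoelder c uinf u"
  shows "0 \<le> c"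
proof -
  have "0 \<le> c / ln (exp 1 + norm (0::real^'n))"
    using assms unfolding log_hoelder_def by (meson abs_ge_zero order_trans)
  then show ?thesis by simp
qed

lemma log_hoelder_dist_inf:
  assumes "log_hoelder c uinf u"
  shows "\<bar>u x - uinf\<bar> * ln (exp 1 + norm x) \<le> c"
proof -
  have 1: "\<bar>u x - uinf\<bar> \<le> c / ln (exp 1 + norm x)"
    using assms unfolding log_hoelder_def by blast
  have 2: "1 \<le> ln (exp 1 + norm x)" by (rule exp1_norm)
  show "\<bar>u x - uinf\<bar> * ln (exp 1 + norm x) \<le> c"
    using 1 2 by (simp add: field_simps)
qed

lemma log_hoelder_dist:
  assumes "log_hoelder c uinf u"
  shows "\<bar>u x - u y\<bar> \<le> c" "x \<noteq> y \<Longrightarrow> \<bar>u x - u y\<bar> * ln (exp 1 + 1 / norm (x - y)) \<le> c"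
proof -
  have 1: "\<bar>u x - u y\<bar> \<le> c / ln (exp 1 + 1 / norm (x - y))"
    using assms unfolding log_hoelder_def by blast
  have "exp 1 \<le> exp 1 + 1 / norm (x - y)" by simp
  moreover have "0 < exp 1 + 1 / norm (x - y)" by (simp add: add_pos_nonneg)
  ultimately have 2: "1 \<le> ln (exp 1 + 1 / norm (x - y))"
    by (simp add: ln_ge_iff)
  show "\<bar>u x - u y\<bar> * ln (exp 1 + 1 / norm (x - y)) \<le> c"
    using 1 2 by (simp add: field_simps)
  show "\<bar>u x - u y\<bar> \<le> c"
    using 1 2 log_hoelder_nonneg[OF assms] by (smt (verit) div_by_1 frac_le)
qed

lemma powr_le_exp_bound:
  fixes t :: real
  assumes "0 < t" "e * ln t \<le> k"
  shows "t powr e \<le> exp k"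
  using assms by (simp add: powr_def)

text \<open>\<open>ln (wt m x)\<close> is \<open>- m\<close> times the logarithm in the decay
  condition, so the two logarithms cancel up to \<open>c * m\<close>.\<close>

lemma log_hoelder_wt:
  assumes "log_hoelder c uinf u" "0 \<le> m"
  shows "wt m x powr (- \<bar>u x - uinf\<bar>) \<le> exp (c * m)"
proof (rule powr_le_exp_bound)
  have "ln (wt m x) = - m * ln (exp 1 + norm x)"
    unfolding wt_def using exp1_norm(2)[of x] by (simp add: ln_powr)
  then show "- \<bar>u x - uinf\<bar> * ln (wt m x) \<le> c * m"
    using mult_right_mono[OF log_hoelder_dist_inf[OF assms(1), of x] assms(2)]
    by (simp add: algebra_simps)
qed simp

text \<open>At distances comparable with \<open>l \<le> 1\<close>, the powers
  \<open>l powr u x\<close> and \<open>l powr u y\<close> are comparable, because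
  \<open>- ln l\<close> is at most a multiple of the logarithm in the local condition.\<close>

lemma log_hoelder_small_scale:
  assumes u: "log_hoelder c uinf u" and l: "0 < l" "l \<le> 1" and d: "norm (x - y) \<le> k * l" and k: "1 \<le> k"
  shows "l powr (- \<bar>u x - u y\<bar>) \<le> exp (c * (1 + ln k))"
proof (cases "x = y")
  case True
  then show ?thesis
    using l k log_hoelder_nonneg[OF u] by simp
next
  case False
  define L where "L = ln (exp 1 + 1 / norm (x - y))"
  have d0: "0 < norm (x - y)" using False by simp
  have "1 / (k * l) \<le> 1 / norm (x - y)"
    using d d0 l k by (intro divide_left_mono) auto
  then have "1 / (k * l) \<le> exp 1 + 1 / norm (x - y)"
    by (smt (verit) exp_gt_zero)
  then have "ln (1 / (k * l)) \<le> L"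
    unfolding L_def using l k by (intro ln_mono) auto
  then have 1: "- ln l \<le> ln k + L"
    using l k by (simp add: ln_div ln_mult)
  have 2: "1 \<le> L"
    unfolding L_def using d0 by (subst ln_ge_iff) (auto simp: add_pos_nonneg)
  \<comment> \<open>\<open>1 \<le> L\<close> turns the additive \<open>ln k\<close> into a
    factor.\<close>
  have "ln k \<le> ln k * L" using 2 k by (simp add: mult_le_cancel_left1)
  with 1 have "- ln l \<le> L * (1 + ln k)" by (simp add: algebra_simps)
  then have "\<bar>u x - u y\<bar> * - ln l \<le> \<bar>u x - u y\<bar> * (L * (1 + ln k))"
    by (intro mult_left_mono) auto
  also have "\<dots> \<le> c * (1 + ln k)"
    using mult_right_mono[OF log_hoelder_dist(2)[OF u False], of "1 + ln k"] k
    by (simp add: L_def mult.assoc)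
  finally show ?thesis
    using l by (intro powr_le_exp_bound) auto
qed

text \<open>A point of norm at least \<open>l / 2\<close> satisfies
  \<open>ln l \<le> 2 * ln (exp 1 + norm x)\<close>, so the decay condition at \<open>x\<close>
  controls powers of the scale \<open>l\<close>.\<close>

lemma log_hoelder_large_scale:
  assumes u: "log_hoelder c uinf u" and l: "1 \<le> l" and x: "l / 2 \<le> norm x"
  shows "l powr \<bar>u x - uinf\<bar> \<le> exp (2 * c)"
proof (rule powr_le_exp_bound)
  have "ln (l / 2) \<le> ln (exp 1 + norm x)"
    using l x by (intro ln_mono) (auto simp: add_pos_nonneg intro: order_trans)
  moreover have "ln (l / 2) = ln l - ln 2" using l by (simp add: ln_div)
  moreover have "ln (2::real) \<le> 1" using ln_le_minus_one[of 2] by simp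
  ultimately have "ln l \<le> 2 * ln (exp 1 + norm x)"
    using exp1_norm(3)[of x] by linarith
  then have "\<bar>u x - uinf\<bar> * ln l \<le> \<bar>u x - uinf\<bar> * (2 * ln (exp 1 + norm x))"
    by (intro mult_left_mono) auto
  then show "\<bar>u x - uinf\<bar> * ln l \<le> 2 * c"
    using log_hoelder_dist_inf[OF u, of x] by linarith
qed (use l in auto)

lemma log_hoelder_continuous_on:
  assumes u: "log_hoelder c uinf u"
  shows "continuous_on UNIV (u :: real ^ 'n \<Rightarrow> real)"
  unfolding continuous_on_iff
proof (intro ballI allI impI)
  fix x :: "real ^ 'n" and e :: real
  assume e: "0 < e"
  have c: "0 \<le> c" by (rule log_hoelder_nonneg[OF u])
  \<comment> \<open>This makes \<open>ln (1 / d)\<close> equal to \<open>c / e + 1\<close>, and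
    \<open>c < e * (c / e + 1)\<close>. The added 1 gives the strict inequality.\<close>
  define d where "d = exp (- (c / e + 1))"
  have "d > 0" by (simp add: d_def)
  moreover have "dist (u y) (u x) < e" if "dist y x < d" for y
  proof (cases "y = x")
    case False
    then have "0 < norm (y - x)" "norm (y - x) < d" using that by (auto simp: dist_norm)
    then have "1 / d < exp 1 + 1 / norm (y - x)"
      by (smt (verit) exp_gt_zero frac_less2)
    then have "ln (1 / d) < ln (exp 1 + 1 / norm (y - x))"
      using \<open>d > 0\<close> by (subst ln_less_cancel_iff) (auto intro: add_pos_nonneg)
    then have L: "c / e + 1 < ln (exp 1 + 1 / norm (y - x))"
      by (simp add: d_def ln_div)
    have "\<bar>u y - u x\<bar> * (c / e + 1) \<le> \<bar>u y - u x\<bar> * ln (exp 1 + 1 / norm (y - x))"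
      using L by (intro mult_left_mono) auto
    also have "\<dots> \<le> c" using log_hoelder_dist(2)[OF u False] .
    finally have "\<bar>u y - u x\<bar> * (c / e + 1) \<le> c" .
    moreover have "0 < c / e + 1" using c e by (simp add: add_nonneg_pos)
    moreover have "e * (c / e + 1) = c + e" using e by (simp add: field_simps)
    ultimately have "\<bar>u y - u x\<bar> < e"
      using e by (smt (verit) mult_right_mono)
    then show ?thesis by (simp add: dist_norm)
  qed (use e in auto)
  ultimately show "\<exists>d>0. \<forall>y\<in>UNIV. dist y x < d \<longrightarrow> dist (u y) (u x) < e" by blast
qed

lemma log_hoelder_tendsto:
  assumes u: "log_hoelder c uinf u"
  shows "((u :: real ^ 'n \<Rightarrow> real) \<longlongrightarrow> uinf) at_infinity"
proof (rule LIM_zero_cancel, rule Lim_null_comparison)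
  show "((\<lambda>x::real ^ 'n. c / ln (exp 1 + norm x)) \<longlongrightarrow> 0) at_infinity"
  proof (intro tendsto_divide_0[OF tendsto_const] filterlim_at_top_imp_at_infinity)
    have "filterlim (\<lambda>x::real ^ 'n. exp 1 + norm x) at_top at_infinity"
      by (intro filterlim_tendsto_add_at_top[OF tendsto_const] filterlim_norm_at_top)
    then show "filterlim (\<lambda>x::real ^ 'n. ln (exp 1 + norm x)) at_top at_infinity"
      by (rule filterlim_compose[OF ln_at_top])
  qed
qed (use u in \<open>auto simp: log_hoelder_def\<close>)

text \<open>The decay condition forces convergence at infinity, so the constant \<open>p_inf\<close>
  hidden in the existential is \<open>exponent_at_infinity p\<close>. Two constants merge into their
  maximum.\<close>

lemma log_var_exponentE:
  assumes "log_var_exponent (p :: real ^ 'n \<Rightarrow> real)"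
  obtains c where "log_hoelder c (exponent_at_infinity p) p"
proof -
  obtain c1 c2 pinf where c: "0 < c1" "0 < c2"
    "\<And>x y. \<bar>p x - p y\<bar> \<le> c1 / ln (exp 1 + 1 / norm (x - y)) \<and> \<bar>p x - pinf\<bar> \<le> c2 / ln (exp 1 + norm x)"
    using assms unfolding log_var_exponent_def by blast
  have "log_hoelder (max c1 c2) pinf p"
    unfolding log_hoelder_def
  proof (intro allI conjI)
    fix x y :: "real ^ 'n"
    have "0 \<le> ln (exp 1 + 1 / norm (x - y))" by (intro ln_ge_zero) (use exp1_ge_2 in \<open>auto intro!: add_increasing2\<close>)
    then show "\<bar>p x - p y\<bar> \<le> max c1 c2 / ln (exp 1 + 1 / norm (x - y))"
      using c(3)[of x y] by (meson divide_right_mono max.cobounded1 order_trans)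
    have "0 \<le> ln (exp 1 + norm x)" using exp1_norm(3)[of x] by linarith
    then show "\<bar>p x - pinf\<bar> \<le> max c1 c2 / ln (exp 1 + norm x)"
      using c(3)[of x y] by (meson divide_right_mono max.cobounded2 order_trans)
  qed
  moreover have "exponent_at_infinity p = pinf"
    unfolding exponent_at_infinity_def
    by (rule tendsto_Lim[OF trivial_limit_at_infinity log_hoelder_tendsto[OF calculation]])
  ultimately show thesis using that by simp
qed

section \<open>A Jensen inequality for variable exponents\<close>

text \<open>Beyond \<open>k\<close> the ratio \<open>t / k\<close> is at least 1 and hence at most
  its own \<open>e\<close>-th power.\<close>

lemma young_split:
  fixes t k e :: real
  assumes "0 \<le> t" "0 < k" "1 \<le> e"
  shows "t \<le> k + k powr (1 - e) * t powr e"
proof (cases "t \<le> k")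
  case True
  then show ?thesis by (smt (verit) mult_nonneg_nonneg powr_ge_zero)
next
  case False
  then have "1 \<le> t / k" using assms by simp
  then have "(t / k) powr 1 \<le> (t / k) powr e" using assms by (intro powr_mono) auto
  then have "t \<le> k * (t / k) powr e" using assms by (simp add: field_simps)
  also have "\<dots> = k powr (1 - e) * t powr e"
    using assms by (simp add: powr_divide powr_diff)
  finally show ?thesis using assms by linarith
qed

text \<open>Young's inequality \<open>t \<le> k + k powr (1 - u y) * t powr u y\<close> is used with the level \<open>k = max K (wt m y)\<close>
  when \<open>K \<le> 1\<close>: the weight keeps \<open>k powr (u x - u y)\<close> bounded by the decay condition at infinity.
  For \<open>K > 1\<close> the cube must be small and the local log-Hoelder condition suffices.\<close>

lemma variable_young:
  fixes u :: "real ^ 'n \<Rightarrow> real"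
  assumes u: "log_hoelder c uinf u" and u1: "\<And>x. 1 \<le> u x" and m: "0 \<le> m"
    and l: "0 < l" and x: "x \<in> cube a l" and y: "y \<in> cube a l"
    and A: "0 \<le> A" "A \<le> 1 + l powr (- real CARD('n))" and t: "0 \<le> t"
  defines "K \<equiv> max (A powr (1 / u x)) (wt m x)"
    and "D \<equiv> exp (c * ln 2 + real CARD('n) * (c * (1 + ln (real CARD('n)))) + 2 * c * m)"
  shows "t \<le> K + wt m y + D * (K powr (1 - u x) * t powr u y)"
proof -
  let ?n = "real CARD('n)"
  have n1: "1 \<le> ?n" by (simp add: Suc_leI)
  have c0: "0 \<le> c" by (rule log_hoelder_nonneg[OF u])
  have K0: "0 < K" unfolding K_def using wt_pos(1)[of m x] by linarith
  define e where "e = \<bar>u x - u y\<bar>"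
  \<comment> \<open>Any level \<open>k\<close> meeting these four conditions will do; the cases
    below differ only in its choice.\<close>
  have claim: "t \<le> K + wt m y + D * (K powr (1 - u x) * t powr u y)"
    if "0 < k" "k \<le> K + wt m y" "k powr (1 - u x) \<le> K powr (1 - u x)" "k powr (u x - u y) \<le> D" for k
  proof -
    have "t \<le> k + k powr (1 - u y) * t powr u y"
      using young_split[OF t \<open>0 < k\<close> u1] .
    also have "k powr (1 - u y) = k powr (1 - u x) * k powr (u x - u y)"
      by (simp add: powr_add[symmetric])
    also have "\<dots> \<le> K powr (1 - u x) * D"
      using that by (intro mult_mono) auto
    finally show ?thesis
      using that by (smt (verit) mult.assoc mult.commute mult_right_mono powr_ge_zero)
  qed
  show ?thesis
  proof (cases "K \<le> 1")
    case True
    define k where "k = max K (wt m y)"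
    have k: "0 < k" "k \<le> 1" "wt m y \<le> k" "K \<le> k" "wt m x \<le> k"
      using K0 True wt_le_1[OF m, of y] by (auto simp: k_def K_def)
    \<comment> \<open>As \<open>k \<le> 1\<close>, lowering the exponent increases the power.
      Passing through \<open>uinf\<close> splits it into two factors, bounded because
      \<open>k\<close> dominates the weight at \<open>x\<close> and at \<open>y\<close>.\<close>
    have "k powr (u x - u y) \<le> k powr (- \<bar>u x - uinf\<bar> + - \<bar>u y - uinf\<bar>)"
      using k by (intro powr_mono') auto
    also have "\<dots> = k powr (- \<bar>u x - uinf\<bar>) * k powr (- \<bar>u y - uinf\<bar>)"
      by (rule powr_add)
    also have "\<dots> \<le> wt m x powr (- \<bar>u x - uinf\<bar>) * wt m y powr (- \<bar>u y - uinf\<bar>)"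
      using k by (intro mult_mono powr_mono2') auto
    also have "\<dots> \<le> exp (c * m) * exp (c * m)"
      using log_hoelder_wt[OF u m] by (intro mult_mono) auto
    also have "\<dots> \<le> D"
      using c0 n1 m by (simp add: D_def exp_add[symmetric] mult.assoc)
    finally show ?thesis
      using k K0 u1[of x] wt_pos(1)[of m y]
      by (intro claim[of k]) (auto simp: k_def intro!: powr_mono2')
  next
    case False
    \<comment> \<open>The weight is at most 1, so \<open>K > 1\<close> must come from
      \<open>A\<close>.\<close>
    have "A powr (1 / u x) > 1"
      using False wt_le_1[OF m, of x] by (auto simp: K_def max_def split: if_splits)
    then have A1: "1 < A"
      using u1[of x] A(1) by (smt (verit) divide_nonneg_pos powr_le1)
    have "K = A powr (1 / u x)"
      using \<open>A powr (1 / u x) > 1\<close> wt_le_1[OF m, of x] by (auto simp: K_def)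
    also have "\<dots> \<le> A powr 1" using A1 u1[of x] by (intro powr_mono) auto
    finally have KA: "K \<le> A" using A1 by simp
    have "K powr (u x - u y) \<le> K powr e"
      using False by (intro powr_mono) (auto simp: e_def)
    \<comment> \<open>The upper bound on \<open>A\<close> enters here: it ties the base
      \<open>K\<close> to the side length, where the local condition can act.\<close>
    also have "\<dots> \<le> (2 * max 1 (l powr (- ?n))) powr e"
      using KA A K0 by (intro powr_mono2) (auto simp: e_def)
    also have "\<dots> = 2 powr e * max 1 (l powr (- ?n)) powr e"
      by (simp add: powr_mult)
    also have "\<dots> \<le> exp (c * ln 2) * exp (?n * (c * (1 + ln ?n)))"
    proof (intro mult_mono)
      show "2 powr e \<le> exp (c * ln 2)"
        using log_hoelder_dist(1)[OF u, of x y] by (intro powr_le_exp_bound) (auto simp: e_def)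
      show "max 1 (l powr (- ?n)) powr e \<le> exp (?n * (c * (1 + ln ?n)))"
      proof (cases "l \<le> 1")
        case True
        then have "1 \<le> l powr (- ?n)"
          using l powr_mono'[of "- ?n" 0 l] by simp
        then have "max 1 (l powr (- ?n)) powr e = (l powr (- e)) powr ?n"
          by (simp add: powr_powr mult.commute)
        also have "\<dots> \<le> exp (c * (1 + ln ?n)) powr ?n"
          using log_hoelder_small_scale[OF u l True dist_cube[OF x y] n1]
          by (intro powr_mono2) (auto simp: e_def)
        finally show ?thesis by (simp add: powr_def mult.commute)
      next
        case False
        then have "l powr (- ?n) \<le> 1"
          using powr_mono[of "- ?n" 0 l] by simp
        then show ?thesis using c0 n1 by simp
      qed
    qed auto
    also have "\<dots> \<le> D"
      using c0 m by (simp add: D_def exp_add[symmetric])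
    finally show ?thesis
      using K0 by (intro claim[of K]) auto
  qed
qed

text \<open>Integrates \<open>variable_young\<close> over the cube; the weight at \<open>y\<close>
  becomes the error term. \<open>A\<close> stands for the average of \<open>f y powr u y\<close>.
  Its bound \<open>1 + l powr (- real CARD('n))\<close> is available both for modular at most 1 with
  exponent \<open>u\<close> and, later, for \<open>u = r / s\<close> with modular at most 1 with
  exponent \<open>r\<close>.\<close>

lemma variable_jensen:
  fixes u :: "real ^ 'n \<Rightarrow> real"
  assumes u: "log_hoelder c uinf u" and u1: "\<And>x. 1 \<le> u x" and m: "0 \<le> m"
    and [measurable]: "u \<in> borel_measurable lebesgue"
  obtains D where "1 \<le> D" "\<And>f a l x A. \<lbrakk>f \<in> borel_measurable lebesgue; \<And>x. 0 \<le> f x; 0 < l; x \<in> cube a l;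
     0 \<le> A; A \<le> 1 + l powr (- real CARD('n));
     (\<integral>\<^sup>+y\<in>cube a l. ennreal (f y powr u y) \<partial>lebesgue) \<le> ennreal (A * l powr real CARD('n))\<rbrakk> \<Longrightarrow>
     (\<integral>\<^sup>+y\<in>cube a l. ennreal (f y) \<partial>lebesgue)
       \<le> ennreal (D * max (A powr (1 / u x)) (wt m x) * l powr real CARD('n))
          + (\<integral>\<^sup>+y\<in>cube a l. ennreal (wt m y) \<partial>lebesgue)"
proof -
  let ?n = "real CARD('n)"
  define D where "D = exp (c * ln 2 + real CARD('n) * (c * (1 + ln (real CARD('n)))) + 2 * c * m)"
  have D0: "0 < D" by (simp add: D_def)
  have "(\<integral>\<^sup>+y\<in>cube a l. ennreal (f y) \<partial>lebesgue)
       \<le> ennreal ((1 + D) * max (A powr (1 / u x)) (wt m x) * l powr ?n)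
          + (\<integral>\<^sup>+y\<in>cube a l. ennreal (wt m y) \<partial>lebesgue)"
    if [measurable]: "f \<in> borel_measurable lebesgue" and f: "\<And>x. 0 \<le> f x" and l: "0 < l" and x: "x \<in> cube a l"
      and A: "0 \<le> A" "A \<le> 1 + l powr (- ?n)"
      and int: "(\<integral>\<^sup>+y\<in>cube a l. ennreal (f y powr u y) \<partial>lebesgue) \<le> ennreal (A * l powr ?n)" for f a l x A
  proof -
    define K where "K = max (A powr (1 / u x)) (wt m x)"
    have K0: "0 < K" unfolding K_def using wt_pos(1)[of m x] by linarith
    \<comment> \<open>\<open>K\<close> is at least \<open>A powr (1 / u x)\<close>, hence
      \<open>A \<le> K powr u x\<close>, and the factor \<open>K powr (1 - u x)\<close> brings this
      back to \<open>K\<close>.\<close>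
    have Ku: "K powr (1 - u x) * A \<le> K"
    proof -
      have "A = (A powr (1 / u x)) powr u x" using A u1[of x] by (simp add: powr_powr)
      also have "\<dots> \<le> K powr u x" using u1[of x] by (intro powr_mono2) (auto simp: K_def)
      finally have "K powr (1 - u x) * A \<le> K powr (1 - u x) * K powr u x"
        by (intro mult_left_mono) auto
      also have "\<dots> = K" using K0 by (simp add: powr_add[symmetric])
      finally show ?thesis .
    qed
    have "(\<integral>\<^sup>+y\<in>cube a l. ennreal (f y) \<partial>lebesgue) \<le>
       (\<integral>\<^sup>+y. ennreal K * indicator (cube a l) y + ennreal (wt m y) * indicator (cube a l) y +
           ennreal (D * K powr (1 - u x)) * (ennreal (f y powr u y) * indicator (cube a l) y) \<partial>lebesgue)"
    proof (intro nn_integral_mono)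
      fix y :: "real ^ 'n"
      have "ennreal (f y) \<le> ennreal K + ennreal (wt m y) + ennreal (D * K powr (1 - u x)) * ennreal (f y powr u y)"
        if "y \<in> cube a l"
      proof -
        have "f y \<le> K + wt m y + D * (K powr (1 - u x) * f y powr u y)"
          unfolding K_def D_def by (rule variable_young[OF u u1 m l x that A f])
        then have "ennreal (f y) \<le> ennreal (K + wt m y + D * (K powr (1 - u x) * f y powr u y))"
          by (rule ennreal_leI)
        also have "\<dots> = ennreal K + ennreal (wt m y) + ennreal (D * K powr (1 - u x)) * ennreal (f y powr u y)"
          using K0 D0 by (simp add: ennreal_mult[symmetric] ennreal_plus[symmetric] mult.assoc del: ennreal_plus)
        finally show ?thesis .
      qed
      then show "ennreal (f y) * indicator (cube a l) y \<le> ennreal K * indicator (cube a l) y + ennreal (wt m y) * indicator (cube a l) y +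
           ennreal (D * K powr (1 - u x)) * (ennreal (f y powr u y) * indicator (cube a l) y)"
        by (auto simp: indicator_def)
    qed
    also have "\<dots> = (\<integral>\<^sup>+y\<in>cube a l. ennreal K \<partial>lebesgue) + (\<integral>\<^sup>+y\<in>cube a l. ennreal (wt m y) \<partial>lebesgue)
       + ennreal (D * K powr (1 - u x)) * (\<integral>\<^sup>+y\<in>cube a l. ennreal (f y powr u y) \<partial>lebesgue)"
      by (subst nn_integral_add, measurable)+ (subst nn_integral_cmult, measurable)
    also have "\<dots> \<le> ennreal (K * l powr ?n) + (\<integral>\<^sup>+y\<in>cube a l. ennreal (wt m y) \<partial>lebesgue)
       + ennreal (D * K powr (1 - u x)) * ennreal (A * l powr ?n)"
      using K0 by (intro add_mono mult_left_mono int nn_integral_cube_le l) auto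
    also have "\<dots> = ennreal (K * l powr ?n + D * (K powr (1 - u x) * A) * l powr ?n) + (\<integral>\<^sup>+y\<in>cube a l. ennreal (wt m y) \<partial>lebesgue)"
      using D0 K0 A by (simp add: ennreal_mult[symmetric] ac_simps)
    also have "\<dots> \<le> ennreal ((1 + D) * K * l powr ?n) + (\<integral>\<^sup>+y\<in>cube a l. ennreal (wt m y) \<partial>lebesgue)"
    proof (intro add_right_mono ennreal_leI)
      have "D * (K powr (1 - u x) * A) * l powr ?n \<le> D * K * l powr ?n"
        using Ku D0 by (intro mult_right_mono mult_left_mono) auto
      then show "K * l powr ?n + D * (K powr (1 - u x) * A) * l powr ?n \<le> (1 + D) * K * l powr ?n"
        by (simp add: algebra_simps)
    qed
    finally show ?thesis unfolding K_def .
  qed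
  moreover have "1 \<le> 1 + D" using D0 by simp
  ultimately show thesis using that by blast
qed

section \<open>The maximal function over cubes\<close>

definition max_fun :: "(real ^ 'n \<Rightarrow> ennreal) \<Rightarrow> real ^ 'n \<Rightarrow> ennreal" where
  "max_fun G x = (SUP Q \<in> {Q \<in> cubes. x \<in> Q}. (\<integral>\<^sup>+y\<in>Q. G y \<partial>lebesgue) / emeasure lebesgue Q)"

definition rat_cubes :: "((real ^ 'n) \<times> real) set" where
  "rat_cubes = {a. \<forall>i. a $ i \<in> \<rat>} \<times> {l \<in> \<rat>. 0 < l}"

lemma countable_rat_cubes: "countable (rat_cubes :: ((real ^ 'n) \<times> real) set)"
proof -
  have "{a :: real ^ 'n. \<forall>i. a $ i \<in> \<rat>} \<subseteq> range (\<lambda>f::'n \<Rightarrow> rat. \<chi> i. of_rat (f i))"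
  proof
    fix a :: "real ^ 'n" assume "a \<in> {a. \<forall>i. a $ i \<in> \<rat>}"
    then have "\<forall>i. \<exists>q. a $ i = of_rat q" by (auto simp: Rats_def)
    then obtain f where "\<forall>i. a $ i = of_rat (f i)" by metis
    then have "a = (\<chi> i. of_rat (f i))" by (simp add: vec_eq_iff)
    then show "a \<in> range (\<lambda>f::'n \<Rightarrow> rat. \<chi> i. of_rat (f i))" by blast
  qed
  then have "countable {a :: real ^ 'n. \<forall>i. a $ i \<in> \<rat>}"
    by (rule countable_subset) simp
  moreover have "countable {l \<in> \<rat>. 0 < (l::real)}"
    by (rule countable_subset[OF _ countable_rat]) auto
  ultimately show ?thesis unfolding rat_cubes_def by (rule countable_SIGMA)
qed

lemma rat_cube_enclosing:
  fixes a :: "real ^ 'n"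
  assumes "0 < l" "0 < e"
  obtains a' l' where "(a', l') \<in> rat_cubes" "0 < l'" "l' < l + 2 * e" "cube a l \<subseteq> cube a' l'"
proof -
  have "\<forall>i. \<exists>q\<in>\<rat>. a $ i - e < q \<and> q < a $ i"
    using assms by (intro allI Rats_dense_in_real) simp
  then obtain f where f: "\<And>i. f i \<in> \<rat> \<and> a $ i - e < f i \<and> f i < a $ i" by metis
  \<comment> \<open>The corner moves down by less than \<open>e\<close>, so adding more than
    \<open>e\<close> to the side still covers the upper faces.\<close>
  obtain l' where l': "l' \<in> \<rat>" "l + e < l'" "l' < l + 2 * e"
    using Rats_dense_in_real[of "l + e" "l + 2 * e"] assms by auto
  have "cube a l \<subseteq> cube (\<chi> i. f i) l'"
  proof
    fix x assume "x \<in> cube a l"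
    then have "a $ i \<le> x $ i \<and> x $ i \<le> a $ i + l" for i by (simp add: mem_cube)
    then have "f i \<le> x $ i \<and> x $ i \<le> f i + l'" for i using f[of i] l' by (smt (verit))
    then show "x \<in> cube (\<chi> i. f i) l'" by (simp add: mem_cube)
  qed
  then show thesis
    using l' f assms by (intro that[of "\<chi> i. f i" l']) (auto simp: rat_cubes_def)
qed

text \<open>A countable family of cubes computes the same supremum, which gives measurability.\<close>

lemma SUP_cubes_eq_rat:
  fixes x :: "real ^ 'n" and F :: "(real ^ 'n) set \<Rightarrow> ennreal"
  assumes mono: "\<And>P Q. P \<subseteq> Q \<Longrightarrow> F P \<le> F Q"
  shows "(SUP Q \<in> {Q \<in> cubes. x \<in> Q}. F Q / emeasure lebesgue Q) =
    (SUP (a, l) \<in> rat_cubes. indicator (cube a l) x * (F (cube a l) / emeasure lebesgue (cube a l)))"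
    (is "_ = ?S")
proof (rule antisym)
  show "(SUP Q \<in> {Q \<in> cubes. x \<in> Q}. F Q / emeasure lebesgue Q) \<le> ?S"
  proof (rule SUP_least)
    fix Q assume "Q \<in> {Q \<in> cubes. x \<in> Q}"
    then obtain a l where Q: "Q = cube a l" and l: "0 < l" and x: "x \<in> cube a l"
      by (auto simp: cubes_eq)
    let ?n = "real CARD('n)"
    have pos: "0 < l powr ?n" using l by simp
    \<comment> \<open>Enlarging to a rational cube costs only the ratio of the measures, which tends
      to 1 as \<open>e\<close> tends to 0.\<close>
    have step: "F Q \<le> ?S * ennreal ((l + 2 * e) powr ?n)" if e: "0 < e" for e
    proof -
      obtain a' l' where *: "(a', l') \<in> rat_cubes" "0 < l'" "l' < l + 2 * e" "cube a l \<subseteq> cube a' l'"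
        using rat_cube_enclosing[OF l e] by blast
      have "F (cube a' l') / emeasure lebesgue (cube a' l') \<le> ?S"
        using * x by (intro SUP_upper2[of "(a', l')"]) auto
      then have "F (cube a' l') / emeasure lebesgue (cube a' l') * emeasure lebesgue (cube a' l') \<le> ?S * emeasure lebesgue (cube a' l')"
        by (rule mult_right_mono) simp
      moreover have "F (cube a' l') / emeasure lebesgue (cube a' l') * emeasure lebesgue (cube a' l') = F (cube a' l')"
        using \<open>0 < l'\<close> by (simp add: emeasure_cube ennreal_divide_times ennreal_times_divide ennreal_mult_divide_eq del: emeasure_completion)
      ultimately have "F (cube a' l') \<le> ?S * emeasure lebesgue (cube a' l')" by simp
      moreover have "emeasure lebesgue (cube a' l') \<le> ennreal ((l + 2 * e) powr ?n)"
        using * by (auto simp: emeasure_cube simp del: emeasure_completion intro!: ennreal_leI powr_mono2)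
      ultimately show ?thesis
        using mono[OF *(4)] unfolding Q by (meson mult_left_mono order_trans zero_le)
    qed
    have "F Q \<le> ?S * ennreal (l powr ?n)"
    proof (cases ?S)
      case (real s)
      have "((\<lambda>e. ennreal (s * (l + 2 * e) powr ?n)) \<longlongrightarrow> ennreal (s * (l + 2 * 0) powr ?n)) (at_right 0)"
        using l by (intro tendsto_ennrealI tendsto_intros) auto
      moreover have "\<forall>\<^sub>F e in at_right 0. F Q \<le> ennreal (s * (l + 2 * e) powr ?n)"
        using step real by (auto simp: eventually_at_right_less ennreal_mult intro!: eventually_at_rightI[of 0 1])
      ultimately have "F Q \<le> ennreal (s * (l + 2 * 0) powr ?n)"
        by (rule tendsto_lowerbound) simp
      then show ?thesis using real by (simp add: ennreal_mult)
    next
      case top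
      show ?thesis unfolding top using pos by (simp add: ennreal_top_mult)
    qed
    then have "F Q / ennreal (l powr ?n) \<le> ?S * ennreal (l powr ?n) / ennreal (l powr ?n)"
      by (rule divide_right_mono_ennreal)
    also have "\<dots> = ?S" using pos by (simp add: ennreal_mult_divide_eq)
    finally show "F Q / emeasure lebesgue Q \<le> ?S"
      using l by (simp add: Q emeasure_cube del: emeasure_completion)
  qed
  show "?S \<le> (SUP Q \<in> {Q \<in> cubes. x \<in> Q}. F Q / emeasure lebesgue Q)"
  proof (rule SUP_least, clarify)
    fix a :: "real ^ 'n" and l :: real assume "(a, l) \<in> rat_cubes"
    then have "0 < l" by (simp add: rat_cubes_def)
    show "indicator (cube a l) x * (F (cube a l) / emeasure lebesgue (cube a l))
      \<le> (SUP Q \<in> {Q \<in> cubes. x \<in> Q}. F Q / emeasure lebesgue Q)"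
    proof (cases "x \<in> cube a l")
      case True
      with \<open>0 < l\<close> have "cube a l \<in> {Q \<in> cubes. x \<in> Q}" by (auto simp: cubes_eq)
      then have "F (cube a l) / emeasure lebesgue (cube a l) \<le> (SUP Q \<in> {Q \<in> cubes. x \<in> Q}. F Q / emeasure lebesgue Q)"
        by (rule SUP_upper)
      then show ?thesis using True by (simp only: indicator_simps mult_1)
    qed simp
  qed
qed

lemma set_nn_integral_mono_set: "P \<subseteq> Q \<Longrightarrow> (\<integral>\<^sup>+y\<in>P. G y \<partial>M) \<le> (\<integral>\<^sup>+y\<in>Q. G y \<partial>M)"
  by (intro nn_integral_mono) (auto simp: indicator_def)

lemma borel_measurable_max_fun [measurable]:
  assumes [measurable]: "G \<in> borel_measurable lebesgue"
  shows "max_fun G \<in> borel_measurable lebesgue"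
proof -
  have "max_fun G = (\<lambda>x. SUP i \<in> rat_cubes. indicator (cube (fst i) (snd i)) x *
      ((\<integral>\<^sup>+y\<in>cube (fst i) (snd i). G y \<partial>lebesgue) / emeasure lebesgue (cube (fst i) (snd i))))"
    unfolding max_fun_def by (rule ext, subst SUP_cubes_eq_rat) (auto simp: set_nn_integral_mono_set split_def)
  also have "\<dots> \<in> borel_measurable lebesgue"
    by (intro borel_measurable_SUP countable_rat_cubes) measurable
  finally show ?thesis .
qed

section \<open>Weak and strong type bounds for the maximal function\<close>

lemma sigma_finite_lebesgue: "sigma_finite_measure (lebesgue :: 'a::euclidean_space measure)"
proof
  obtain A where A: "countable A" "A \<subseteq> sets (lborel :: 'a measure)" "\<Union>A = space lborel"
    "\<And>a. a \<in> A \<Longrightarrow> emeasure lborel a \<noteq> \<infinity>"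
    using sigma_finite_lborel[where 'a='a] unfolding sigma_finite_measure_def by blast
  then show "\<exists>A. countable A \<and> A \<subseteq> sets (lebesgue :: 'a measure) \<and> \<Union>A = space lebesgue \<and> (\<forall>a\<in>A. emeasure lebesgue a \<noteq> \<infinity>)"
    by (intro exI[of _ A]) (auto simp: space_lborel)
qed

text \<open>Vitali covering. Each point of the level set is the centre of a ball of radius
  \<open>n * l\<close> that contains a cube of side \<open>l\<close> with large average. Disjoint
  balls are selected whose 5-fold dilations cover; such a dilation fits into a cube of side
  \<open>10 * n * l\<close>, whence the constant.\<close>

lemma max_fun_weak_type:
  fixes G :: "real ^ 'n \<Rightarrow> ennreal"
  assumes [measurable]: "G \<in> borel_measurable lebesgue" and t: "0 < t"
  shows "ennreal t * emeasure lebesgue {x. ennreal t < max_fun G x} \<le>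
    ennreal ((10 * real CARD('n)) powr real CARD('n)) * (\<integral>\<^sup>+y. G y \<partial>lebesgue)"
proof (cases "(\<integral>\<^sup>+y. G y \<partial>lebesgue)")
  case top
  then show ?thesis by (simp add: ennreal_mult_top)
next
  case (real I)
  let ?n = "real CARD('n)" and ?S = "{x. ennreal t < max_fun G x}"
  have n1: "1 \<le> ?n" by (simp add: Suc_leI)
  \<comment> \<open>As a measure, \<open>G\<close> can be summed over the disjoint balls by
    countable additivity.\<close>
  define \<nu> where "\<nu> = density lebesgue G"
  have "\<exists>l. 0 < l \<and> ennreal (t * l powr ?n) \<le> emeasure \<nu> (cball x (?n * l))" if x: "x \<in> ?S" for x
  proof -
    obtain Q where "Q \<in> cubes" "x \<in> Q" and lt: "ennreal t < (\<integral>\<^sup>+y\<in>Q. G y \<partial>lebesgue) / emeasure lebesgue Q"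
      using x by (auto simp: max_fun_def less_SUP_iff)
    then obtain a l where Q: "Q = cube a l" and l: "0 < l" by (auto simp: cubes_eq)
    have "ennreal (t * l powr ?n) = ennreal t * emeasure lebesgue Q"
      using t l by (simp add: Q emeasure_cube ennreal_mult del: emeasure_completion)
    also have "\<dots> \<le> (\<integral>\<^sup>+y\<in>Q. G y \<partial>lebesgue) / emeasure lebesgue Q * emeasure lebesgue Q"
      using lt by (intro mult_right_mono) auto
    also have "\<dots> = (\<integral>\<^sup>+y\<in>Q. G y \<partial>lebesgue)"
      using l by (simp add: Q emeasure_cube ennreal_divide_times ennreal_times_divide ennreal_mult_divide_eq del: emeasure_completion)
    also have "\<dots> \<le> (\<integral>\<^sup>+y\<in>cball x (?n * l). G y \<partial>lebesgue)"
      using dist_cube \<open>x \<in> Q\<close> by (intro set_nn_integral_mono_set) (auto simp: Q dist_norm)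
    also have "\<dots> = emeasure \<nu> (cball x (?n * l))"
      unfolding \<nu>_def by (simp add: emeasure_density)
    finally show ?thesis using l by blast
  qed
  then obtain L where L: "\<And>x. x \<in> ?S \<Longrightarrow> 0 < L x \<and> ennreal (t * L x powr ?n) \<le> emeasure \<nu> (cball x (?n * L x))"
    by metis
  have nuI: "emeasure \<nu> A \<le> ennreal I" if "A \<in> sets lebesgue" for A
  proof -
    have "emeasure \<nu> A = (\<integral>\<^sup>+y\<in>A. G y \<partial>lebesgue)" using that unfolding \<nu>_def by (simp add: emeasure_density)
    also have "\<dots> \<le> (\<integral>\<^sup>+y. G y \<partial>lebesgue)" by (intro nn_integral_mono) (auto simp: indicator_def)
    finally show ?thesis using real by simp
  qed
  \<comment> \<open>The covering lemma needs bounded radii; finiteness of the integral of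
    \<open>G\<close> supplies the bound.\<close>
  have bdd: "0 < ?n * L x \<and> ?n * L x \<le> ?n * (I / t) powr (1 / ?n)" if "x \<in> ?S" for x
  proof -
    have "ennreal (t * L x powr ?n) \<le> ennreal I"
      using L[OF that] nuI[of "cball x (?n * L x)"] by (auto intro: order_trans)
    then have "L x powr ?n \<le> I / t"
      using t real by (simp add: ennreal_le_iff field_simps)
    then have "(L x powr ?n) powr (1 / ?n) \<le> (I / t) powr (1 / ?n)"
      by (intro powr_mono2) auto
    then show ?thesis using L[OF that] n1 by (simp add: powr_powr)
  qed
  have cov: "?S \<subseteq> (\<Union>x\<in>?S. cball x (?n * L x))"
    using bdd by (fastforce simp: less_imp_le)
  obtain C where C: "countable C" "C \<subseteq> ?S"
     "pairwise (\<lambda>i j. disjnt (cball i (?n * L i)) (cball j (?n * L j))) C"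
     "?S \<subseteq> (\<Union>i\<in>C. cball i (5 * (?n * L i)))"
    using Vitali_covering_lemma_cballs[where a = "\<lambda>x. x", OF cov bdd] by blast
  have ball: "emeasure lebesgue (cball x (5 * (?n * L x))) \<le> ennreal ((10 * ?n) powr ?n * L x powr ?n)" if "x \<in> ?S" for x
  proof -
    have l: "0 < 10 * ?n * L x" using L[OF that] n1 by simp
    have "cball x (5 * (?n * L x)) \<subseteq> cube (\<chi> i. x $ i - 5 * (?n * L x)) (10 * ?n * L x)"
    proof
      fix y assume "y \<in> cball x (5 * (?n * L x))"
      then have "norm (y - x) \<le> 5 * (?n * L x)" by (simp add: dist_norm norm_minus_commute)
      then have "\<bar>y $ i - x $ i\<bar> \<le> 5 * (?n * L x)" for i
        using component_le_norm_cart[of "y - x" i] by simp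
      then show "y \<in> cube (\<chi> i. x $ i - 5 * (?n * L x)) (10 * ?n * L x)"
        unfolding mem_cube by (auto simp: abs_le_iff algebra_simps)
    qed
    then have "emeasure lebesgue (cball x (5 * (?n * L x))) \<le> emeasure lebesgue (cube (\<chi> i. x $ i - 5 * (?n * L x)) (10 * ?n * L x))"
      by (intro emeasure_mono) auto
    also have "\<dots> = ennreal ((10 * ?n) powr ?n * L x powr ?n)"
      using l L[OF that] by (simp add: emeasure_cube powr_mult del: emeasure_completion)
    finally show ?thesis .
  qed
  have "emeasure lebesgue ?S \<le> emeasure lebesgue (\<Union>i\<in>C. cball i (5 * (?n * L i)))"
    using C by (intro emeasure_mono) auto
  \<comment> \<open>Countable subadditivity in integral form: the indicator of the union is at most
    the counting-measure sum of the indicators, and the integrals are interchanged.\<close>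
  also have "\<dots> = (\<integral>\<^sup>+x. indicator (\<Union>i\<in>C. cball i (5 * (?n * L i))) x \<partial>lebesgue)"
    using C by (intro nn_integral_indicator[symmetric] sets.countable_UN'') auto
  also have "\<dots> \<le> (\<integral>\<^sup>+x. \<integral>\<^sup>+i. indicator (cball i (5 * (?n * L i))) x \<partial>count_space C \<partial>lebesgue)"
  proof (intro nn_integral_mono)
    fix x
    show "indicator (\<Union>i\<in>C. cball i (5 * (?n * L i))) x \<le> (\<integral>\<^sup>+i. (indicator (cball i (5 * (?n * L i))) x :: ennreal) \<partial>count_space C)"
    proof (cases "x \<in> (\<Union>i\<in>C. cball i (5 * (?n * L i)))")
      case True
      then obtain j where j: "j \<in> C" "x \<in> cball j (5 * (?n * L j))" by blast
      then have "1 \<le> (\<integral>\<^sup>+i. (indicator (cball i (5 * (?n * L i))) x :: ennreal) \<partial>count_space C)"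
        using nn_integral_ge_point[of j C "\<lambda>i. indicator (cball i (5 * (?n * L i))) x"] by simp
      then show ?thesis using True by (simp only: indicator_simps)
    qed simp
  qed
  also have "\<dots> = (\<integral>\<^sup>+i. emeasure lebesgue (cball i (5 * (?n * L i))) \<partial>count_space C)"
  proof (subst nn_integral_count_space_nn_integral[OF C(1)])
    show "indicator (cball i (5 * (?n * L i))) \<in> borel_measurable lebesgue" for i
      by (intro borel_measurable_indicator) simp
  qed simp
  also have "\<dots> \<le> (\<integral>\<^sup>+i. ennreal ((10 * ?n) powr ?n * L i powr ?n) \<partial>count_space C)"
    using C ball by (intro nn_integral_mono) auto
  finally have "ennreal t * emeasure lebesgue ?S \<le> ennreal t * (\<integral>\<^sup>+i. ennreal ((10 * ?n) powr ?n * L i powr ?n) \<partial>count_space C)"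
    by (rule mult_left_mono) simp
  also have "\<dots> = ennreal ((10 * ?n) powr ?n) * (\<integral>\<^sup>+i. ennreal (t * L i powr ?n) \<partial>count_space C)"
    using t by (subst (1 2) nn_integral_cmult[symmetric]) (simp_all add: ennreal_mult[symmetric] ac_simps)
  also have "\<dots> \<le> ennreal ((10 * ?n) powr ?n) * (\<integral>\<^sup>+i. emeasure \<nu> (cball i (?n * L i)) \<partial>count_space C)"
    using C L by (intro mult_left_mono nn_integral_mono) auto
  also have "(\<integral>\<^sup>+i. emeasure \<nu> (cball i (?n * L i)) \<partial>count_space C) = emeasure \<nu> (\<Union>i\<in>C. cball i (?n * L i))"
    using C by (intro emeasure_UN_countable[symmetric])
      (auto simp: \<nu>_def disjoint_family_on_def pairwise_def disjnt_def)
  also have "\<dots> \<le> ennreal I"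
    using C by (intro nuI sets.countable_UN'') auto
  finally show ?thesis
    using real by (simp add: mult_left_mono)
qed

text \<open>The layer-cake formula at a single height, with \<open>T = \<infinity>\<close> allowed;
  integrating it over \<open>x\<close> expresses integrals of powers through level sets.\<close>

lemma nn_integral_powr_below:
  assumes a: "0 < a"
  shows "(\<integral>\<^sup>+t. ennreal (a * t powr (a - 1)) * indicator {t. 0 < t \<and> ennreal t < T} t \<partial>lborel) = ennpowr T a"
    (is "?L T = _")
proof -
  have fin: "?L (ennreal T) = ennreal (T powr a)" if T: "0 \<le> T" for T
  proof -
    have "((\<lambda>t. a * t powr (a - 1)) has_integral (a * (T powr (a - 1 + 1) / (a - 1 + 1)))) {0..T}"
      using a T by (intro has_integral_mult_right has_integral_powr_from_0) auto
    then have "((\<lambda>t. a * t powr (a - 1)) has_integral T powr a) {0..T}" using a by simp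
    then have "(\<integral>\<^sup>+t. ennreal (a * t powr (a - 1)) * indicator {0..T} t \<partial>lborel) = ennreal (T powr a)"
      using a by (intro nn_integral_has_integral_lebesgue') auto
    moreover have "?L (ennreal T) = (\<integral>\<^sup>+t. ennreal (a * t powr (a - 1)) * indicator {0..T} t \<partial>lborel)"
    proof (rule nn_integral_cong_AE)
      have "AE t in lborel. t \<noteq> 0 \<and> t \<noteq> T"
        using AE_lborel_singleton[of 0] AE_lborel_singleton[of T] by eventually_elim simp
      then show "AE t in lborel. ennreal (a * t powr (a - 1)) * indicator {t. 0 < t \<and> ennreal t < ennreal T} t =
         ennreal (a * t powr (a - 1)) * indicator {0..T} t"
        by eventually_elim (auto simp: indicator_def ennreal_less_iff)
    qed
    ultimately show ?thesis by simp
  qed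
  show ?thesis
  proof (cases T)
    case (real r)
    then show ?thesis using fin by (simp add: ennpowr_ennreal)
  next
    case top
    have "?L top = top"
    proof (rule ccontr)
      assume "?L top \<noteq> top"
      then obtain y where y: "0 \<le> y" "?L top = ennreal y" by (cases "?L top") auto
      \<comment> \<open>Truncating at height \<open>(y + 1) powr (1 / a)\<close> already gives
        \<open>y + 1\<close>, more than the supposed value \<open>y\<close>.\<close>
      have "ennreal (((y + 1) powr (1 / a)) powr a) \<le> ?L top"
        by (subst fin[symmetric]) (auto intro!: nn_integral_mono simp: indicator_def)
      then show False using y a by (simp add: powr_powr)
    qed
    then show ?thesis using top by (simp add: ennpowr_def)
  qed
qed

text \<open>Marcinkiewicz interpolation. At height \<open>t\<close> only the part of
  \<open>G\<close> above \<open>t / 2\<close> matters, since the rest has averages at most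
  \<open>t / 2\<close>; the weak type bound is applied to that part and integrated over
  \<open>t\<close>.\<close>

lemma max_fun_strong_type:
  fixes s :: real
  assumes s: "1 < s"
  obtains C where "0 \<le> C" "\<And>G :: real ^ 'n \<Rightarrow> ennreal. G \<in> borel_measurable lebesgue \<Longrightarrow>
    (\<integral>\<^sup>+x. ennpowr (max_fun G x) s \<partial>lebesgue) \<le> ennreal C * (\<integral>\<^sup>+x. ennpowr (G x) s \<partial>lebesgue)"
proof -
  let ?n = "real CARD('n)"
  define \<kappa> where "\<kappa> = (10 * ?n) powr ?n"
  \<comment> \<open>The weak type bound at height \<open>t / 2\<close> gives
    \<open>2 * \<kappa>\<close>, the two layer-cake densities differ by \<open>s / (s - 1)\<close>,
    and the height \<open>2 * G x\<close> gives \<open>2 powr (s - 1)\<close>.\<close>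
  define C where "C = 2 * \<kappa> * (s / (s - 1)) * 2 powr (s - 1)"
  have k0: "0 \<le> \<kappa>" by (simp add: \<kappa>_def)
  then have C0: "0 \<le> C" using s by (simp add: C_def)
  interpret L: sigma_finite_measure "lebesgue :: (real ^ 'n) measure" by (rule sigma_finite_lebesgue)
  interpret P: pair_sigma_finite lborel "lebesgue :: (real ^ 'n) measure" ..
  have "(\<integral>\<^sup>+x. ennpowr (max_fun G x) s \<partial>lebesgue) \<le> ennreal C * (\<integral>\<^sup>+x. ennpowr (G x) s \<partial>lebesgue)"
    if [measurable]: "G \<in> borel_measurable lebesgue" for G :: "real ^ 'n \<Rightarrow> ennreal"
  proof -
    let ?G1 = "\<lambda>t x. G x * indicator {x. ennreal (t / 2) < G x} x"
    have dist: "ennreal t * emeasure lebesgue {x. ennreal t < max_fun G x} \<le> ennreal (2 * \<kappa>) * (\<integral>\<^sup>+x. ?G1 t x \<partial>lebesgue)"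
      if t: "0 < t" for t
    proof -
      have "max_fun G x \<le> max_fun (?G1 t) x + ennreal (t / 2)" for x
        unfolding max_fun_def
      proof (rule SUP_least)
        fix Q :: "(real ^ 'n) set" assume "Q \<in> {Q \<in> cubes. x \<in> Q}"
        then obtain a l where Q: "Q = cube a l" and l: "0 < l" and Qin: "Q \<in> {Q \<in> cubes. x \<in> Q}"
          by (auto simp: cubes_eq)
        have [measurable]: "Q \<in> sets lebesgue" by (simp add: Q)
        have "(\<integral>\<^sup>+y\<in>Q. G y \<partial>lebesgue) \<le> (\<integral>\<^sup>+y. ?G1 t y * indicator Q y + ennreal (t / 2) * indicator Q y \<partial>lebesgue)"
          by (intro nn_integral_mono) (auto simp: indicator_def)
        also have "\<dots> = (\<integral>\<^sup>+y\<in>Q. ?G1 t y \<partial>lebesgue) + ennreal (t / 2) * emeasure lebesgue Q"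
          by (subst nn_integral_add) (auto simp: nn_integral_cmult_indicator)
        finally have "(\<integral>\<^sup>+y\<in>Q. G y \<partial>lebesgue) / emeasure lebesgue Q \<le>
            ((\<integral>\<^sup>+y\<in>Q. ?G1 t y \<partial>lebesgue) + ennreal (t / 2) * emeasure lebesgue Q) / emeasure lebesgue Q"
          by (rule divide_right_mono_ennreal)
        also have "\<dots> = (\<integral>\<^sup>+y\<in>Q. ?G1 t y \<partial>lebesgue) / emeasure lebesgue Q + ennreal (t / 2)"
          using l by (simp add: add_divide_distrib_ennreal ennreal_mult_divide_eq Q emeasure_cube del: emeasure_completion)
        also have "\<dots> \<le> (SUP Q \<in> {Q \<in> cubes. x \<in> Q}. (\<integral>\<^sup>+y\<in>Q. ?G1 t y \<partial>lebesgue) / emeasure lebesgue Q) + ennreal (t / 2)"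
          using Qin by (intro add_right_mono SUP_upper)
        finally show "(\<integral>\<^sup>+y\<in>Q. G y \<partial>lebesgue) / emeasure lebesgue Q \<le>
            (SUP Q \<in> {Q \<in> cubes. x \<in> Q}. (\<integral>\<^sup>+y\<in>Q. ?G1 t y \<partial>lebesgue) / emeasure lebesgue Q) + ennreal (t / 2)" .
      qed
      then have "ennreal (t / 2) < max_fun (?G1 t) x" if "ennreal t < max_fun G x" for x
      proof (rule_tac ccontr)
        assume "\<not> ennreal (t / 2) < max_fun (?G1 t) x"
        then have "max_fun G x \<le> ennreal (t / 2) + ennreal (t / 2)"
          using \<open>\<And>x. max_fun G x \<le> _ x\<close>[of x] by (meson add_right_mono not_less order_trans)
        also have "\<dots> = ennreal t" using t by (subst ennreal_plus[symmetric]) auto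
        finally show False using that by simp
      qed
      then have "emeasure lebesgue {x. ennreal t < max_fun G x} \<le> emeasure lebesgue {x. ennreal (t / 2) < max_fun (?G1 t) x}"
      proof (intro emeasure_mono)
        have "{x \<in> space lebesgue. ennreal (t / 2) < max_fun (?G1 t) x} \<in> sets lebesgue" by measurable
        then show "{x. ennreal (t / 2) < max_fun (?G1 t) x} \<in> sets lebesgue" by simp
      qed auto
      then have "ennreal t * emeasure lebesgue {x. ennreal t < max_fun G x} \<le>
         ennreal t * emeasure lebesgue {x. ennreal (t / 2) < max_fun (?G1 t) x}"
        by (rule mult_left_mono) simp
      also have "\<dots> = ennreal 2 * ennreal (t / 2) * emeasure lebesgue {x. ennreal (t / 2) < max_fun (?G1 t) x}"
        by (rule arg_cong[where f = "\<lambda>z. z * _"]) (use t in \<open>subst ennreal_mult[symmetric]; simp\<close>)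
      also have "\<dots> =
         ennreal 2 * (ennreal (t / 2) * emeasure lebesgue {x. ennreal (t / 2) < max_fun (?G1 t) x})"
        by (rule mult.assoc)
      also have "\<dots> \<le> ennreal 2 * (ennreal \<kappa> * (\<integral>\<^sup>+x. ?G1 t x \<partial>lebesgue))"
        unfolding \<kappa>_def using t by (intro mult_left_mono max_fun_weak_type) auto
      finally show ?thesis using k0 by (simp add: ennreal_mult mult.assoc)
    qed
    have "(\<integral>\<^sup>+x. ennpowr (max_fun G x) s \<partial>lebesgue) =
      (\<integral>\<^sup>+x. \<integral>\<^sup>+t. ennreal (s * t powr (s - 1)) * indicator {t. 0 < t \<and> ennreal t < max_fun G x} t \<partial>lborel \<partial>lebesgue)"
      using s by (simp add: nn_integral_powr_below)
    also have "\<dots> = (\<integral>\<^sup>+t. \<integral>\<^sup>+x. ennreal (s * t powr (s - 1)) * indicator {t. 0 < t \<and> ennreal t < max_fun G x} t \<partial>lebesgue \<partial>lborel)"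
      by (rule P.Fubini') measurable
    \<comment> \<open>Dividing by the \<open>t\<close> in the weak type bound lowers the density to
      a multiple of \<open>(s - 1) * t powr (s - 1 - 1)\<close>, so after interchanging the
      integrals the inner one is again a layer cake, now with exponent \<open>s - 1\<close>.\<close>
    also have "\<dots> \<le> (\<integral>\<^sup>+t. \<integral>\<^sup>+x. ennreal (2 * \<kappa> * (s / (s - 1))) * (G x * (ennreal ((s - 1) * t powr (s - 1 - 1)) *
        indicator {t. 0 < t \<and> ennreal t < ennreal 2 * G x} t)) \<partial>lebesgue \<partial>lborel)"
    proof (rule nn_integral_mono)
      fix t :: real
      show "(\<integral>\<^sup>+x. ennreal (s * t powr (s - 1)) * indicator {t. 0 < t \<and> ennreal t < max_fun G x} t \<partial>lebesgue)
        \<le> (\<integral>\<^sup>+x. ennreal (2 * \<kappa> * (s / (s - 1))) * (G x * (ennreal ((s - 1) * t powr (s - 1 - 1)) *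
        indicator {t. 0 < t \<and> ennreal t < ennreal 2 * G x} t)) \<partial>lebesgue)"
      proof (cases "0 < t")
        case t: True
        have "(\<integral>\<^sup>+x. ennreal (s * t powr (s - 1)) * indicator {t. 0 < t \<and> ennreal t < max_fun G x} t \<partial>lebesgue)
          = (\<integral>\<^sup>+x. ennreal (s * t powr (s - 1)) * indicator {x. ennreal t < max_fun G x} x \<partial>lebesgue)"
          using t by (intro nn_integral_cong) (auto simp: indicator_def)
        also have "\<dots> = ennreal (s * t powr (s - 1)) * emeasure lebesgue {x. ennreal t < max_fun G x}"
        proof (rule nn_integral_cmult_indicator)
          have "{x \<in> space lebesgue. ennreal t < max_fun G x} \<in> sets lebesgue" by measurable
          then show "{x. ennreal t < max_fun G x} \<in> sets lebesgue" by simp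
        qed
        also have "\<dots> = ennreal (s * t powr (s - 1 - 1)) * ennreal t * emeasure lebesgue {x. ennreal t < max_fun G x}"
          by (rule arg_cong[where f = "\<lambda>z. z * _"])
            (use s t in \<open>simp add: ennreal_mult[symmetric] powr_diff power2_eq_square\<close>)
        also have "\<dots> \<le>
           ennreal (s * t powr (s - 1 - 1)) * (ennreal (2 * \<kappa>) * (\<integral>\<^sup>+x. ?G1 t x \<partial>lebesgue))"
          unfolding mult.assoc by (intro mult_left_mono dist t) auto
        also have "\<dots> = ennreal (2 * \<kappa> * s * t powr (s - 1 - 1)) * (\<integral>\<^sup>+x. ?G1 t x \<partial>lebesgue)"
          using s k0 by (subst mult.assoc[symmetric], subst ennreal_mult[symmetric]) (auto simp: ac_simps)
        also have "\<dots> = (\<integral>\<^sup>+x. ennreal (2 * \<kappa> * s * t powr (s - 1 - 1)) * ?G1 t x \<partial>lebesgue)"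
          by (rule nn_integral_cmult[symmetric]) measurable
        also have "\<dots> = (\<integral>\<^sup>+x. ennreal (2 * \<kappa> * (s / (s - 1))) * (G x * (ennreal ((s - 1) * t powr (s - 1 - 1)) *
          indicator {t. 0 < t \<and> ennreal t < ennreal 2 * G x} t)) \<partial>lebesgue)"
        proof (intro nn_integral_cong)
          fix x
          have "ennreal (t / 2) < G x \<longleftrightarrow> ennreal t < ennreal 2 * G x"
            using t by (cases "G x") (auto simp: ennreal_mult[symmetric] ennreal_less_iff ennreal_mult_top
                simp del: ennreal_numeral)
          moreover have "ennreal (2 * \<kappa> * s * t powr (s - 1 - 1)) =
              ennreal (2 * \<kappa> * (s / (s - 1))) * ennreal ((s - 1) * t powr (s - 1 - 1))"
            using s k0 by (subst ennreal_mult[symmetric]) auto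
          ultimately show "ennreal (2 * \<kappa> * s * t powr (s - 1 - 1)) * ?G1 t x =
             ennreal (2 * \<kappa> * (s / (s - 1))) * (G x * (ennreal ((s - 1) * t powr (s - 1 - 1)) *
          indicator {t. 0 < t \<and> ennreal t < ennreal 2 * G x} t))"
            using t by (simp add: indicator_def ac_simps)
        qed
        finally show ?thesis .
      qed simp
    qed
    also have "\<dots> = (\<integral>\<^sup>+x. \<integral>\<^sup>+t. ennreal (2 * \<kappa> * (s / (s - 1))) * (G x * (ennreal ((s - 1) * t powr (s - 1 - 1)) *
        indicator {t. 0 < t \<and> ennreal t < ennreal 2 * G x} t)) \<partial>lborel \<partial>lebesgue)"
      by (rule P.Fubini'[symmetric]) measurable
    also have "\<dots> = (\<integral>\<^sup>+x. ennreal (2 * \<kappa> * (s / (s - 1))) * (G x * ennpowr (ennreal 2 * G x) (s - 1)) \<partial>lebesgue)"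
      using s nn_integral_powr_below[of "s - 1"] by (simp add: nn_integral_cmult)
    also have "\<dots> \<le> (\<integral>\<^sup>+x. ennreal C * ennpowr (G x) s \<partial>lebesgue)"
    proof (intro nn_integral_mono)
      fix x
      have "G x * ennpowr (ennreal 2 * G x) (s - 1) \<le> ennreal (2 powr (s - 1)) * ennpowr (G x) s"
      proof (cases "G x")
        case (real g)
        then have "G x * ennpowr (ennreal 2 * G x) (s - 1) = ennreal (g * (2 * g) powr (s - 1))"
          by (simp add: ennreal_mult[symmetric] ennpowr_ennreal del: ennreal_numeral)
        also have "g * (2 * g) powr (s - 1) = 2 powr (s - 1) * g powr s"
          using real by (cases "g = 0") (auto simp: powr_mult powr_diff)
        finally show ?thesis using real by (simp add: ennpowr_ennreal ennreal_mult)
      qed (simp add: ennpowr_def ennreal_mult_top)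
      then have "ennreal (2 * \<kappa> * (s / (s - 1))) * (G x * ennpowr (ennreal 2 * G x) (s - 1)) \<le>
        ennreal (2 * \<kappa> * (s / (s - 1))) * (ennreal (2 powr (s - 1)) * ennpowr (G x) s)"
        by (rule mult_left_mono) simp
      then show "ennreal (2 * \<kappa> * (s / (s - 1))) * (G x * ennpowr (ennreal 2 * G x) (s - 1)) \<le> ennreal C * ennpowr (G x) s"
        unfolding C_def using s k0 by (simp add: mult.assoc[symmetric] ennreal_mult[symmetric])
    qed
    also have "\<dots> = ennreal C * (\<integral>\<^sup>+x. ennpowr (G x) s \<partial>lebesgue)"
      by (rule nn_integral_cmult) measurable
    finally show ?thesis .
  qed
  then show thesis using that C0 by blast
qed

section \<open>Averages over cubes of functions with bounded modular\<close>

text \<open>Taking reciprocals does not increase distances between numbers that are at least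
  1.\<close>

lemma log_hoelder_large_scale_recip:
  fixes u :: "real ^ 'n \<Rightarrow> real"
  assumes u: "log_hoelder c uinf u" and u1: "1 \<le> u x" "1 \<le> uinf"
    and l: "1 \<le> l" and x: "l / 2 \<le> norm x" and k: "0 \<le> k"
  shows "l powr (k * \<bar>1 / u x - 1 / uinf\<bar>) \<le> exp (2 * c * k)"
proof -
  have "1 / u x - 1 / uinf = (uinf - u x) / (u x * uinf)"
    using u1 by (simp add: field_simps)
  moreover have "\<bar>(uinf - u x) / (u x * uinf)\<bar> \<le> \<bar>u x - uinf\<bar> / 1"
    unfolding abs_divide using u1 mult_mono[of 1 "u x" 1 uinf] by (intro frac_le) auto
  ultimately have "\<bar>1 / u x - 1 / uinf\<bar> \<le> \<bar>u x - uinf\<bar>" by simp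
  then have "l powr (k * \<bar>1 / u x - 1 / uinf\<bar>) \<le> l powr (\<bar>u x - uinf\<bar> * k)"
    using l k by (intro powr_mono) (auto simp: mult.commute intro: mult_left_mono)
  also have "\<dots> = (l powr \<bar>u x - uinf\<bar>) powr k"
    by (simp add: powr_powr)
  also have "\<dots> \<le> exp (2 * c) powr k"
    using log_hoelder_large_scale[OF u l x] k by (intro powr_mono2) auto
  also have "\<dots> = exp (2 * c * k)" by (simp add: powr_def mult.commute)
  finally show ?thesis .
qed

text \<open>This takes the place of Hoelder's inequality for an average: modular at most 1 on the
  cube gives the bound \<open>|Q| powr (- (1 / u x))\<close> up to a constant. It is
  \<open>variable_jensen\<close> with \<open>A = 1 / |Q|\<close>; the condition linking
  \<open>l\<close> and \<open>x\<close> makes the weight terms no larger than the main term.\<close>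

lemma cube_average_bound:
  fixes u :: "real ^ 'n \<Rightarrow> real"
  assumes u: "log_hoelder c uinf u" and u1: "\<And>x. 1 \<le> u x"
    and [measurable]: "u \<in> borel_measurable lebesgue" and \<epsilon>: "0 < \<epsilon>"
  obtains C where "1 \<le> C" "\<And>f a l x. \<lbrakk>f \<in> borel_measurable lebesgue; \<And>x. 0 \<le> f x; 0 < l; x \<in> cube a l;
     (\<integral>\<^sup>+y\<in>cube a l. ennreal (f y powr u y) \<partial>lebesgue) \<le> 1; l powr \<epsilon> \<le> exp 1 + norm x\<rbrakk> \<Longrightarrow>
     (\<integral>\<^sup>+y\<in>cube a l. ennreal (f y) \<partial>lebesgue)
       \<le> ennreal (C * l powr (- (real CARD('n) / u x)) * l powr real CARD('n))"
proof -
  let ?n = "real CARD('n)"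
  have n1: "1 \<le> ?n" by (simp add: Suc_leI)
  \<comment> \<open>\<open>2 * ?n\<close> makes the weight integrable;
    \<open>?n / \<epsilon>\<close> makes it at most \<open>l powr (- ?n)\<close> at \<open>x\<close>
    when \<open>l powr \<epsilon> \<le> exp 1 + norm x\<close> and \<open>l > 1\<close>.\<close>
  define m where "m = max (2 * ?n) (?n / \<epsilon>)"
  have m: "2 * ?n \<le> m" "0 \<le> m" "?n \<le> \<epsilon> * m"
    using n1 \<epsilon> by (auto simp: m_def max_def field_simps)
  obtain H where H: "0 \<le> H" "(\<integral>\<^sup>+x. ennreal (wt m (x :: real ^ 'n)) \<partial>lebesgue) = ennreal H"
    using wt_integrable[OF m(1)] by (cases "\<integral>\<^sup>+x. ennreal (wt m (x :: real ^ 'n)) \<partial>lebesgue") auto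
  obtain D where D: "1 \<le> D" "\<And>f a l x A. \<lbrakk>f \<in> borel_measurable lebesgue; \<And>x. 0 \<le> f x; 0 < l; x \<in> cube a l;
     0 \<le> A; A \<le> 1 + l powr (- ?n);
     (\<integral>\<^sup>+y\<in>cube a l. ennreal (f y powr u y) \<partial>lebesgue) \<le> ennreal (A * l powr ?n)\<rbrakk> \<Longrightarrow>
     (\<integral>\<^sup>+y\<in>cube a l. ennreal (f y) \<partial>lebesgue)
       \<le> ennreal (D * max (A powr (1 / u x)) (wt m x) * l powr ?n)
          + (\<integral>\<^sup>+y\<in>cube a l. ennreal (wt m y) \<partial>lebesgue)"
    using variable_jensen[OF u u1 m(2)] assms by blast
  have "(\<integral>\<^sup>+y\<in>cube a l. ennreal (f y) \<partial>lebesgue)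
       \<le> ennreal ((D + 1 + H) * l powr (- (?n / u x)) * l powr ?n)"
    if f: "f \<in> borel_measurable lebesgue" "\<And>x. 0 \<le> f x" and l: "0 < l" and x: "x \<in> cube a l"
      and int: "(\<integral>\<^sup>+y\<in>cube a l. ennreal (f y powr u y) \<partial>lebesgue) \<le> 1" and lx: "l powr \<epsilon> \<le> exp 1 + norm x" for f a l x
  proof -
    let ?A = "l powr (- ?n)" and ?K = "l powr (- (?n / u x))"
    have AK: "?A powr (1 / u x) = ?K" by (simp add: powr_powr)
    have nu: "0 \<le> ?n / u x" "?n / u x \<le> ?n" using u1[of x] n1 by (auto simp: field_simps)
    have 1: "wt m x \<le> ?K \<and> (\<integral>\<^sup>+y\<in>cube a l. ennreal (wt m y) \<partial>lebesgue) \<le> ennreal ((1 + H) * ?K * l powr ?n)"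
    proof (cases "l \<le> 1")
      case True
      then have K1: "1 \<le> ?K" using l nu powr_mono'[of "- (?n / u x)" 0 l] by simp
      have "(\<integral>\<^sup>+y\<in>cube a l. ennreal (wt m y) \<partial>lebesgue) \<le> ennreal (1 * l powr ?n)"
        using l wt_le_1[OF m(2)] by (intro nn_integral_cube_le) (auto intro!: ennreal_leI)
      also have "\<dots> \<le> ennreal ((1 + H) * ?K * l powr ?n)"
        using K1 H mult_mono[of 1 "1 + H" 1 ?K] by (intro ennreal_leI mult_right_mono) auto
      finally show ?thesis using K1 wt_le_1[OF m(2), of x] by simp
    next
      case False
      have "wt m x \<le> (l powr \<epsilon>) powr (- m)"
        unfolding wt_def using lx m l by (intro powr_mono2') auto
      also have "\<dots> = l powr (- (\<epsilon> * m))" by (simp add: powr_powr)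
      also have "\<dots> \<le> ?K" using False m nu by (intro powr_mono) auto
      finally have w: "wt m x \<le> ?K" .
      have "(\<integral>\<^sup>+y\<in>cube a l. ennreal (wt m y) \<partial>lebesgue) \<le> ennreal H"
        unfolding H(2)[symmetric] by (intro nn_integral_mono) (auto simp: indicator_def)
      \<comment> \<open>Since \<open>u x\<close> is at least 1, \<open>?K * l powr ?n\<close> is a
        nonnegative power of \<open>l > 1\<close> and absorbs the total mass of the weight.\<close>
      also have "\<dots> \<le> ennreal ((1 + H) * (?K * l powr ?n))"
      proof (rule ennreal_leI)
        have "1 \<le> l powr (- (?n / u x) + ?n)"
          using False nu by (intro ge_one_powr_ge_zero) auto
        then have "1 \<le> ?K * l powr ?n" by (simp only: powr_add)
        then show "H \<le> (1 + H) * (?K * l powr ?n)"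
          using H mult_mono[of H "1 + H" 1 "?K * l powr ?n"] by simp
      qed
      finally show ?thesis using w by (simp add: mult.assoc)
    qed
    have "(\<integral>\<^sup>+y\<in>cube a l. ennreal (f y) \<partial>lebesgue)
       \<le> ennreal (D * max (?A powr (1 / u x)) (wt m x) * l powr ?n)
          + (\<integral>\<^sup>+y\<in>cube a l. ennreal (wt m y) \<partial>lebesgue)"
      using l int by (intro D(2) f x) (auto simp: powr_minus)
    also have "\<dots> \<le> ennreal (D * ?K * l powr ?n) + ennreal ((1 + H) * ?K * l powr ?n)"
      using 1 unfolding AK by (intro add_mono) (auto simp: max_absorb1)
    also have "\<dots> = ennreal (D * ?K * l powr ?n + (1 + H) * ?K * l powr ?n)"
      using D(1) H by (intro ennreal_plus[symmetric]) auto
    also have "\<dots> = ennreal ((D + 1 + H) * ?K * l powr ?n)"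
      by (simp add: algebra_simps)
    finally show ?thesis .
  qed
  moreover have "1 \<le> D + 1 + H" using D(1) H by simp
  ultimately show thesis using that by blast
qed

section \<open>The fractional maximal operator of variable order\<close>

text \<open>Here \<open>t\<close> is the average of \<open>f\<close>. Both terms on the right can be
  integrated in \<open>x\<close>: the first through the maximal theorem, the second because the
  weight is integrable.\<close>

lemma fractional_average_bound:
  fixes r q \<delta> :: "real ^ 'n \<Rightarrow> real"
  assumes r: "log_hoelder c rinf r" and r1: "\<And>x. 1 \<le> r x" "1 \<le> rinf"
    and [measurable]: "r \<in> borel_measurable lebesgue"
    and q: "\<And>x. r x \<le> q x" "\<And>x. q x \<le> qmax" and dmax: "\<And>x. \<delta> x \<le> dmax" "rinf * dmax < real CARD('n)"
    and rq: "\<And>x. \<delta> x / real CARD('n) = 1 / r x - 1 / q x"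
  obtains C where "1 \<le> C" "\<And>f a l x t. \<lbrakk>f \<in> borel_measurable lebesgue; \<And>x. 0 \<le> f x; 0 < l; x \<in> cube a l;
     (\<integral>\<^sup>+y. ennreal (f y powr r y) \<partial>lebesgue) \<le> 1; 0 \<le> t;
     (\<integral>\<^sup>+y\<in>cube a l. ennreal (f y) \<partial>lebesgue) = ennreal (t * l powr real CARD('n))\<rbrakk> \<Longrightarrow>
     (l powr \<delta> x * t) powr q x \<le> C * (t powr r x + wt (2 * real CARD('n)) x)"
proof -
  let ?n = "real CARD('n)"
  have n1: "1 \<le> ?n" by (simp add: Suc_leI)
  \<comment> \<open>The rate at which \<open>l powr dmax\<close> times an average governed by
    \<open>rinf\<close> decays for large \<open>l\<close>; it is positive because
    \<open>rinf * dmax < n\<close>.\<close>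
  define \<sigma> where "\<sigma> = ?n / rinf - dmax"
  have \<sigma>: "0 < \<sigma>" using dmax r1 by (simp add: \<sigma>_def field_simps)
  \<comment> \<open>The bound \<open>1 / 2\<close> makes
    \<open>l powr \<epsilon> \<le> exp 1 + norm z\<close> at far points \<open>z\<close> of large
    cubes. The bound \<open>\<sigma> / (2 * ?n)\<close> turns the rate \<open>\<sigma>\<close> in
    \<open>l\<close> into the integrable rate \<open>2 * ?n\<close> in \<open>x\<close>.\<close>
  define \<epsilon> where "\<epsilon> = min (1 / 2) (\<sigma> / (2 * ?n))"
  have \<epsilon>: "0 < \<epsilon>" "\<epsilon> \<le> 1 / 2" using n1 \<sigma> by (auto simp: \<epsilon>_def)
  have \<epsilon>\<sigma>: "2 * ?n \<le> \<sigma> / \<epsilon>"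
  proof -
    have "\<epsilon> \<le> \<sigma> / (2 * ?n)" by (simp add: \<epsilon>_def)
    then show ?thesis using \<epsilon> n1 by (simp add: field_simps)
  qed
  obtain C1 where C1: "1 \<le> C1" "\<And>f a l x. \<lbrakk>f \<in> borel_measurable lebesgue; \<And>x. 0 \<le> f x; 0 < l; x \<in> cube a l;
     (\<integral>\<^sup>+y\<in>cube a l. ennreal (f y powr r y) \<partial>lebesgue) \<le> 1; l powr \<epsilon> \<le> exp 1 + norm x\<rbrakk> \<Longrightarrow>
     (\<integral>\<^sup>+y\<in>cube a l. ennreal (f y) \<partial>lebesgue) \<le> ennreal (C1 * l powr (- (?n / r x)) * l powr ?n)"
    using cube_average_bound[OF r r1(1) _ \<epsilon>(1)] assms(4) by blast
  have c0: "0 \<le> c" by (rule log_hoelder_nonneg[OF r])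
  define C2 where "C2 = C1 * exp (2 * c * ?n)"
  have C12: "C1 \<le> C2" "1 \<le> C2"
    using C1(1) c0 n1 mult_mono[of 1 C1 1 "exp (2 * c * ?n)"] by (auto simp: C2_def mult_le_cancel_left1)
  have q1: "1 \<le> q x" for x using r1(1)[of x] q(1)[of x] by linarith
  have main: "(l powr \<delta> x * t) powr q x \<le> C2 powr qmax * (t powr r x + wt (2 * ?n) x)"
    if f: "f \<in> borel_measurable lebesgue" "\<And>x. 0 \<le> f x" and l: "0 < l" and x: "x \<in> cube a l"
      and int: "(\<integral>\<^sup>+y. ennreal (f y powr r y) \<partial>lebesgue) \<le> 1" and t: "0 \<le> t"
      and tint: "(\<integral>\<^sup>+y\<in>cube a l. ennreal (f y) \<partial>lebesgue) = ennreal (t * l powr ?n)" for f a l x t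
  proof -
    have int': "(\<integral>\<^sup>+y\<in>cube a l. ennreal (f y powr r y) \<partial>lebesgue) \<le> 1"
      by (rule order_trans[OF nn_integral_mono int]) (auto simp: indicator_def)
    have tb: "t \<le> C1 * l powr (- (?n / r z))" if z: "z \<in> cube a l" "l powr \<epsilon> \<le> exp 1 + norm z" for z
    proof -
      have "ennreal (t * l powr ?n) \<le> ennreal (C1 * l powr (- (?n / r z)) * l powr ?n)"
        unfolding tint[symmetric] using C1(2)[OF f l z(1) int' z(2)] .
      then have "t * l powr ?n \<le> C1 * l powr (- (?n / r z)) * l powr ?n"
        using C1(1) by (subst (asm) ennreal_le_iff) auto
      then show ?thesis using l by simp
    qed
    have Cq: "C1 powr (q x - r x) \<le> C2 powr qmax" "C2 powr q x \<le> C2 powr qmax"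
    proof -
      have "C1 powr (q x - r x) \<le> C2 powr (q x - r x)"
        using C12 C1(1) q(1)[of x] by (intro powr_mono2) auto
      also have "\<dots> \<le> C2 powr qmax" using C12 q(2)[of x] r1(1)[of x] by (intro powr_mono) auto
      finally show "C1 powr (q x - r x) \<le> C2 powr qmax" .
      show "C2 powr q x \<le> C2 powr qmax" using C12 q(2)[of x] by (intro powr_mono) auto
    qed
    show ?thesis
    proof (cases "l powr \<epsilon> \<le> exp 1 + norm x")
      case True
      \<comment> \<open>Hedberg's trick: \<open>(l\<^sup>\<delta> t)\<^sup>q = (l powr (n / r) * t) powr (q - r) * t\<^sup>r\<close>\<close>
      show ?thesis
      proof (cases "t = 0")
        case True
        then show ?thesis by simp
      next
        case False
        with t have t0: "0 < t" by simp
        have "l powr (?n / r x) * t \<le> l powr (?n / r x) * (C1 * l powr (- (?n / r x)))"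
          using tb[OF x True] by (intro mult_left_mono) auto
        also have "\<dots> = C1" using l by (simp add: powr_minus)
        finally have ltC: "l powr (?n / r x) * t \<le> C1" .
        have "(l powr \<delta> x * t) powr q x = (l powr (?n / r x) * t) powr (q x - r x) * t powr r x"
        proof -
          have "\<delta> x = ?n * (1 / r x - 1 / q x)" using rq[of x] n1 by (simp add: field_simps)
          then have e: "\<delta> x * q x = ?n / r x * (q x - r x)"
            using r1(1)[of x] q1[of x] by (simp add: field_simps)
          have "(l powr \<delta> x * t) powr q x = l powr (\<delta> x * q x) * t powr q x"
            using l t0 by (simp add: powr_mult powr_powr)
          also have "t powr q x = t powr (q x - r x) * t powr r x"
            by (simp add: powr_add[symmetric])
          finally show ?thesis
            unfolding e using l t0 by (simp add: powr_mult powr_powr)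
        qed
        also have "\<dots> \<le> C1 powr (q x - r x) * t powr r x"
          using ltC q(1)[of x] l t0 by (intro mult_right_mono powr_mono2) auto
        also have "\<dots> \<le> C2 powr qmax * t powr r x"
          using Cq by (intro mult_right_mono) auto
        also have "\<dots> \<le> C2 powr qmax * (t powr r x + wt (2 * ?n) x)"
          by (intro mult_left_mono) auto
        finally show ?thesis .
      qed
    next
      case False
      then have lx: "exp 1 + norm x < l powr \<epsilon>" by simp
      have l1: "1 < l"
      proof (rule ccontr)
        assume "\<not> 1 < l"
        then have "l powr \<epsilon> \<le> 1" using l \<epsilon> powr_mono2[of \<epsilon> l 1] by simp
        then show False using lx exp1_norm(1)[of x] by linarith
      qed
      \<comment> \<open>\<open>x\<close> lies deep inside a huge cube, so the average is compared with the exponent far away\<close>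
      obtain z where z: "z \<in> cube a l" "l / 2 \<le> norm z" using far_point_in_cube[OF l] by blast
      have "l powr \<epsilon> \<le> l powr (1 / 2)" using \<epsilon> l1 by (intro powr_mono) auto
      also have "\<dots> = sqrt l" using l by (simp add: powr_half_sqrt)
      also have "\<dots> \<le> (l + 1) / 2" using arith_geo_mean_sqrt[of l 1] l by simp
      also have "\<dots> \<le> exp 1 + norm z" using z(2) exp1_ge_2 by (simp add: add_divide_distrib)
      finally have "t \<le> C1 * l powr (- (?n / r z))" using tb z by blast
      also have "l powr (- (?n / r z)) \<le> l powr (- (?n / rinf)) * exp (2 * c * ?n)"
      proof -
        have "- (?n / r z) \<le> - (?n / rinf) + ?n * \<bar>1 / r z - 1 / rinf\<bar>"
        proof -
          have "?n * (1 / rinf - 1 / r z) \<le> ?n * \<bar>1 / r z - 1 / rinf\<bar>" by (intro mult_left_mono) auto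
          then show ?thesis by (simp add: algebra_simps)
        qed
        then have "l powr (- (?n / r z)) \<le> l powr (- (?n / rinf) + ?n * \<bar>1 / r z - 1 / rinf\<bar>)"
          using l1 by (intro powr_mono) auto
        also have "\<dots> = l powr (- (?n / rinf)) * l powr (?n * \<bar>1 / r z - 1 / rinf\<bar>)" by (rule powr_add)
        also have "\<dots> \<le> l powr (- (?n / rinf)) * exp (2 * c * ?n)"
          using log_hoelder_large_scale_recip[OF r r1(1) r1(2) _ z(2), of ?n] l1 by (intro mult_left_mono) auto
        finally show ?thesis .
      qed
      finally have tC: "t \<le> C2 * l powr (- (?n / rinf))"
        using C1(1) by (simp add: C2_def mult_left_mono ac_simps)
      have "l powr \<delta> x * t \<le> l powr dmax * (C2 * l powr (- (?n / rinf)))"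
        using tC t l1 dmax by (intro mult_mono powr_mono) auto
      also have "\<dots> = C2 * l powr (- \<sigma>)"
        using l by (simp add: \<sigma>_def powr_diff powr_minus field_simps)
      \<comment> \<open>In this case \<open>l powr \<epsilon>\<close> exceeds
        \<open>exp 1 + norm x\<close>, so decay in \<open>l\<close> becomes decay in
        \<open>x\<close>.\<close>
      also have "l powr (- \<sigma>) = (l powr \<epsilon>) powr (- (\<sigma> / \<epsilon>))"
        using \<epsilon> by (simp add: powr_powr)
      also have "\<dots> \<le> (exp 1 + norm x) powr (- (\<sigma> / \<epsilon>))"
        using lx exp1_norm(2)[of x] \<sigma> \<epsilon> by (intro powr_mono2') auto
      also have "\<dots> \<le> wt (2 * ?n) x"
        unfolding wt_def using exp1_norm(1)[of x] \<epsilon>\<sigma> by (intro powr_mono) auto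
      finally have "l powr \<delta> x * t \<le> C2 * wt (2 * ?n) x" using C12 by simp
      then have "(l powr \<delta> x * t) powr q x \<le> (C2 * wt (2 * ?n) x) powr q x"
        using t q1[of x] by (intro powr_mono2) auto
      also have "\<dots> = C2 powr q x * wt (2 * ?n) x powr q x"
        using C12 by (simp add: powr_mult)
      also have "\<dots> \<le> C2 powr qmax * wt (2 * ?n) x powr 1"
        using q1[of x] wt_le_1[of "2 * ?n" x] by (intro mult_mono[OF Cq(2)] powr_mono') auto
      also have "\<dots> \<le> C2 powr qmax * (t powr r x + wt (2 * ?n) x)"
        by (intro mult_left_mono) auto
      finally show ?thesis .
    qed
  qed
  have "1 \<le> qmax" using q1 q(2) by (meson order_trans)
  then have "1 \<le> C2 powr qmax" using C12 by (intro ge_one_powr_ge_zero) auto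
  then show thesis using main that by blast
qed

lemma powr_sum3_le:
  fixes a b c :: real
  assumes "0 \<le> a" "0 \<le> b" "0 \<le> c" "0 \<le> s"
  shows "(a + b + c) powr s \<le> 3 powr s * (a powr s + b powr s + c powr s)"
proof -
  have "(a + b + c) powr s \<le> (3 * max a (max b c)) powr s"
    using assms by (intro powr_mono2) auto
  also have "\<dots> = 3 powr s * max a (max b c) powr s" by (simp add: powr_mult)
  also have "max a (max b c) powr s \<le> a powr s + b powr s + c powr s"
    by (simp add: max_def)
  finally show ?thesis by simp
qed

text \<open>Jensen's inequality for \<open>r / s\<close> bounds \<open>t powr (r x / s)\<close> by
  averages of \<open>f powr (r / s)\<close> and of the weight, and the outer power \<open>s\<close>
  then suits the maximal theorem in \<open>L^s\<close>. Using it for \<open>r\<close> itself would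
  lead to exponent 1, where the maximal operator is not bounded.\<close>

lemma average_powr_bound:
  fixes r :: "real ^ 'n \<Rightarrow> real"
  assumes r: "log_hoelder c rinf r" and s: "1 < s" "\<And>x. s \<le> r x" and rmax: "\<And>x. r x \<le> rmax"
    and [measurable]: "r \<in> borel_measurable lebesgue" and m: "0 \<le> m"
  obtains C where "1 \<le> C" "\<And>f a l x t. \<lbrakk>f \<in> borel_measurable lebesgue; \<And>x. 0 \<le> f x; 0 < l; x \<in> cube a l;
     (\<integral>\<^sup>+y. ennreal (f y powr r y) \<partial>lebesgue) \<le> 1; 0 \<le> t;
     (\<integral>\<^sup>+y\<in>cube a l. ennreal (f y) \<partial>lebesgue) = ennreal (t * l powr real CARD('n))\<rbrakk> \<Longrightarrow>
     ennreal (t powr r x) \<le> ennreal C *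
       ennpowr (max_fun (\<lambda>y. ennreal (f y powr (r y / s)) + ennreal (wt m y)) x + ennreal (wt m x)) s"
proof -
  let ?n = "real CARD('n)" and ?u = "\<lambda>x. r x / s"
  have u1: "1 \<le> ?u x" for x using s(1) s(2)[of x] by simp
  have u: "log_hoelder (c / s) (rinf / s) ?u"
    unfolding log_hoelder_def
  proof (intro allI)
    fix x y :: "real ^ 'n"
    have "\<bar>r x - r y\<bar> \<le> c / ln (exp 1 + 1 / norm (x - y))" "\<bar>r x - rinf\<bar> \<le> c / ln (exp 1 + norm x)"
      using r unfolding log_hoelder_def by blast+
    then have "\<bar>r x - r y\<bar> / s \<le> c / ln (exp 1 + 1 / norm (x - y)) / s" "\<bar>r x - rinf\<bar> / s \<le> c / ln (exp 1 + norm x) / s"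
      using s(1) by (intro divide_right_mono; simp)+
    moreover have "\<bar>r x / s - r y / s\<bar> = \<bar>r x - r y\<bar> / s" "\<bar>r x / s - rinf / s\<bar> = \<bar>r x - rinf\<bar> / s"
      using s(1) by (simp_all add: diff_divide_distrib[symmetric])
    ultimately show "\<bar>r x / s - r y / s\<bar> \<le> c / s / ln (exp 1 + 1 / norm (x - y)) \<and> \<bar>r x / s - rinf / s\<bar> \<le> c / s / ln (exp 1 + norm x)"
      by (simp add: divide_divide_eq_left mult.commute)
  qed
  have um: "?u \<in> borel_measurable lebesgue" by measurable
  obtain D where D: "1 \<le> D" "\<And>f a l x A. \<lbrakk>f \<in> borel_measurable lebesgue; \<And>x. 0 \<le> f x; 0 < l; x \<in> cube a l;
     0 \<le> A; A \<le> 1 + l powr (- ?n);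
     (\<integral>\<^sup>+y\<in>cube a l. ennreal (f y powr ?u y) \<partial>lebesgue) \<le> ennreal (A * l powr ?n)\<rbrakk> \<Longrightarrow>
     (\<integral>\<^sup>+y\<in>cube a l. ennreal (f y) \<partial>lebesgue)
       \<le> ennreal (D * max (A powr (1 / ?u x)) (wt m x) * l powr ?n)
          + (\<integral>\<^sup>+y\<in>cube a l. ennreal (wt m y) \<partial>lebesgue)"
    by (fact variable_jensen[OF u u1 m um])
  define C where "C = (D * 3) powr rmax * 3 powr rmax"
  have C1: "1 \<le> C"
  proof -
    have "0 \<le> rmax" using s rmax by (meson less_le order_trans zero_le_one)
    then have "1 \<le> (D * 3) powr rmax" "1 \<le> (3::real) powr rmax" using D(1) by (auto intro!: ge_one_powr_ge_zero)
    then show ?thesis unfolding C_def using mult_mono[of 1 "(D * 3) powr rmax" 1 "3 powr rmax"] by simp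
  qed
  have "ennreal (t powr r x) \<le> ennreal (C powr s) *
       ennpowr (max_fun (\<lambda>y. ennreal (f y powr (r y / s)) + ennreal (wt m y)) x + ennreal (wt m x)) s"
    if [measurable]: "f \<in> borel_measurable lebesgue" and f: "\<And>x. 0 \<le> f x" and l: "0 < l" and x: "x \<in> cube a l"
      and int: "(\<integral>\<^sup>+y. ennreal (f y powr r y) \<partial>lebesgue) \<le> 1" and t: "0 \<le> t"
      and tint: "(\<integral>\<^sup>+y\<in>cube a l. ennreal (f y) \<partial>lebesgue) = ennreal (t * l powr ?n)" for f a l x t
  proof -
    let ?g = "\<lambda>y. f y powr ?u y" and ?Q = "cube a l"
    have lpos: "0 < l powr ?n" using l by simp
    have gr: "?g y powr s = f y powr r y" for y using s by (simp add: powr_powr)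
    \<comment> \<open>Bounding \<open>?g\<close> by 1 plus its \<open>s\<close>-th power gives
      \<open>|Q| + 1\<close>, which is the restriction on \<open>A\<close> in
      \<open>variable_jensen\<close>.\<close>
    have "(\<integral>\<^sup>+y\<in>?Q. ennreal (?g y) \<partial>lebesgue) \<le> (\<integral>\<^sup>+y. indicator ?Q y + ennreal (f y powr r y) \<partial>lebesgue)"
    proof (rule nn_integral_mono)
      fix y
      have "?g y \<le> 1 + f y powr r y"
      proof (cases "?g y \<le> 1")
        case True
        then show ?thesis by (smt (verit) powr_ge_zero)
      next
        case False
        then have "?g y powr 1 \<le> ?g y powr s" using s by (intro powr_mono) auto
        then show ?thesis using False gr[of y] by (simp del: powr_powr)
      qed
      then have "ennreal (?g y) \<le> ennreal (1 + f y powr r y)" by (rule ennreal_leI)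
      then show "ennreal (?g y) * indicator ?Q y \<le> indicator ?Q y + ennreal (f y powr r y)"
        by (auto simp: indicator_def)
    qed
    also have "\<dots> = emeasure lebesgue ?Q + (\<integral>\<^sup>+y. ennreal (f y powr r y) \<partial>lebesgue)"
      by (subst nn_integral_add) (auto simp del: emeasure_completion)
    also have "\<dots> \<le> ennreal (l powr ?n) + 1"
      using int l by (intro add_mono) (auto simp: emeasure_cube simp del: emeasure_completion)
    also have "\<dots> = ennreal (l powr ?n + 1)" by simp
    finally have gint: "(\<integral>\<^sup>+y\<in>?Q. ennreal (?g y) \<partial>lebesgue) \<le> ennreal (l powr ?n + 1)" .
    then obtain A0 where A0: "0 \<le> A0" "(\<integral>\<^sup>+y\<in>?Q. ennreal (?g y) \<partial>lebesgue) = ennreal A0" "A0 \<le> l powr ?n + 1"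
      by (cases "\<integral>\<^sup>+y\<in>?Q. ennreal (?g y) \<partial>lebesgue") (auto simp: ennreal_le_iff top_unique simp del: ennreal_plus)
    define A where "A = A0 / l powr ?n"
    have A: "0 \<le> A" "A \<le> 1 + l powr (- ?n)" "A0 = A * l powr ?n"
      using A0 lpos by (auto simp: A_def powr_minus field_simps)
    have "(\<integral>\<^sup>+y\<in>?Q. ennreal (wt m y) \<partial>lebesgue) \<le> ennreal (1 * l powr ?n)"
      using l wt_le_1[OF m] by (intro nn_integral_cube_le) (auto intro!: ennreal_leI)
    then obtain B0 where B0: "0 \<le> B0" "(\<integral>\<^sup>+y\<in>?Q. ennreal (wt m y) \<partial>lebesgue) = ennreal B0" "B0 \<le> l powr ?n"
      by (cases "\<integral>\<^sup>+y\<in>?Q. ennreal (wt m y) \<partial>lebesgue") (auto simp: ennreal_le_iff top_unique)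
    define B where "B = B0 / l powr ?n"
    have B: "0 \<le> B" "B \<le> 1" "B0 = B * l powr ?n"
      using B0 lpos by (auto simp: B_def field_simps)
    have "ennreal (t * l powr ?n) \<le> ennreal (D * max (A powr (1 / ?u x)) (wt m x) * l powr ?n) + ennreal (B * l powr ?n)"
      unfolding tint[symmetric] B(3)[symmetric] B0(2)[symmetric]
      using A A0 by (intro D(2) f l x) auto
    also have "\<dots> = ennreal (D * max (A powr (1 / ?u x)) (wt m x) * l powr ?n + B * l powr ?n)"
      using D(1) B A by (intro ennreal_plus[symmetric]) (auto simp: le_max_iff_disj)
    finally have "t * l powr ?n \<le> D * max (A powr (1 / ?u x)) (wt m x) * l powr ?n + B * l powr ?n"
      using D(1) B by (subst (asm) ennreal_le_iff) (auto simp: le_max_iff_disj)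
    then have "t * l powr ?n \<le> (D * max (A powr (1 / ?u x)) (wt m x) + B) * l powr ?n"
      by (simp add: algebra_simps)
    then have "t \<le> D * max (A powr (1 / ?u x)) (wt m x) + B" using lpos by simp
    also have "\<dots> \<le> D * (A powr (1 / ?u x) + wt m x + B)"
    proof -
      have "D * max (A powr (1 / ?u x)) (wt m x) \<le> D * (A powr (1 / ?u x) + wt m x)"
        using D(1) by (intro mult_left_mono) auto
      moreover have "B \<le> D * B" using D(1) B by (simp add: mult_le_cancel_right1)
      ultimately show ?thesis by (simp add: algebra_simps)
    qed
    finally have tD: "t \<le> D * (A powr (1 / ?u x) + wt m x + B)" .
    have u0: "0 \<le> ?u x" "?u x \<le> rmax"
    proof -
      have "0 < r x" using s(1) s(2)[of x] by linarith
      then show "0 \<le> ?u x" using s(1) by simp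
      have "r x / s \<le> r x / 1" using s(1) \<open>0 < r x\<close> by (intro divide_left_mono) auto
      then show "?u x \<le> rmax" using rmax[of x] by simp
    qed
    have "t powr ?u x \<le> (D * (A powr (1 / ?u x) + wt m x + B)) powr ?u x"
      using tD t u0 by (intro powr_mono2) auto
    also have "\<dots> = D powr ?u x * (A powr (1 / ?u x) + wt m x + B) powr ?u x"
      using D(1) by (simp add: powr_mult)
    also have "\<dots> \<le> D powr ?u x * (3 powr ?u x * ((A powr (1 / ?u x)) powr ?u x + wt m x powr ?u x + B powr ?u x))"
      using u0 B by (intro mult_left_mono powr_sum3_le) auto
    \<comment> \<open>The outer power undoes the root of \<open>A\<close>; the weight and its
      average \<open>B\<close> are at most 1, so a power with exponent at least 1 does not enlarge
      them.\<close>
    also have "\<dots> \<le> D powr ?u x * (3 powr ?u x * (A + wt m x + B))"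
    proof (intro mult_left_mono add_mono)
      show "(A powr (1 / ?u x)) powr ?u x \<le> A" using A s(1) s(2)[of x] by (auto simp: powr_powr)
      show "wt m x powr ?u x \<le> wt m x" using powr_mono'[of 1 "?u x" "wt m x"] u1[of x] wt_le_1[OF m, of x] by simp
      show "B powr ?u x \<le> B" using powr_mono'[of 1 "?u x" B] u1[of x] B by simp
    qed auto
    also have "\<dots> = (D * 3) powr ?u x * (A + wt m x + B)"
      using D(1) by (simp add: powr_mult)
    also have "\<dots> \<le> C * (A + wt m x + B)"
    proof (intro mult_right_mono)
      have "(D * 3) powr ?u x \<le> (D * 3) powr rmax" using D(1) u0 by (intro powr_mono) auto
      also have "\<dots> \<le> C" unfolding C_def
        using u0 by (simp add: mult_le_cancel_left1 ge_one_powr_ge_zero)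
      finally show "(D * 3) powr ?u x \<le> C" .
    qed (use A B in auto)
    finally have tu: "t powr ?u x \<le> C * (A + wt m x + B)" .
    have "t powr r x = (t powr ?u x) powr s" using s(1) by (simp add: powr_powr)
    also have "\<dots> \<le> (C * (A + wt m x + B)) powr s" using tu s(1) by (intro powr_mono2) auto
    also have "\<dots> = C powr s * (A + B + wt m x) powr s" using C1 A B by (simp add: powr_mult ac_simps)
    finally have "ennreal (t powr r x) \<le> ennreal (C powr s) * ennreal ((A + B + wt m x) powr s)"
      by (simp add: ennreal_mult[symmetric] ennreal_leI)
    also have "\<dots> = ennreal (C powr s) * ennpowr (ennreal (A + B) + ennreal (wt m x)) s"
      using A B by (simp add: ennpowr_ennreal ennreal_plus[symmetric] del: ennreal_plus)
    also have "\<dots> \<le> ennreal (C powr s) *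
       ennpowr (max_fun (\<lambda>y. ennreal (?g y) + ennreal (wt m y)) x + ennreal (wt m x)) s"
    proof (intro mult_left_mono ennpowr_mono add_right_mono)
      have "(\<integral>\<^sup>+y\<in>?Q. (ennreal (?g y) + ennreal (wt m y)) \<partial>lebesgue) =
          (\<integral>\<^sup>+y. ennreal (?g y) * indicator ?Q y + ennreal (wt m y) * indicator ?Q y \<partial>lebesgue)"
        by (simp add: distrib_right)
      also have "\<dots> = ennreal A0 + ennreal B0"
        unfolding A0(2)[symmetric] B0(2)[symmetric] by (rule nn_integral_add) measurable
      also have "\<dots> = ennreal ((A + B) * l powr ?n)"
        using A B A0 B0 by (simp add: ennreal_plus[symmetric] algebra_simps del: ennreal_plus)
      finally have "(\<integral>\<^sup>+y\<in>?Q. (ennreal (?g y) + ennreal (wt m y)) \<partial>lebesgue) / emeasure lebesgue ?Q = ennreal (A + B)"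
        using l lpos A B by (simp add: emeasure_cube divide_ennreal del: emeasure_completion)
      then have avg: "ennreal (A + B) \<le> (\<integral>\<^sup>+y\<in>?Q. (ennreal (?g y) + ennreal (wt m y)) \<partial>lebesgue) / emeasure lebesgue ?Q"
        by (rule eq_refl[OF sym])
      have "?Q \<in> {Q \<in> cubes. x \<in> Q}" using l x by (auto simp: cubes_eq)
      then show "ennreal (A + B) \<le> max_fun (\<lambda>y. ennreal (?g y) + ennreal (wt m y)) x"
        unfolding max_fun_def by (rule SUP_upper2) (rule avg)
    qed (use s(1) in auto)
    finally show ?thesis .
  qed
  moreover have "1 \<le> C powr s" using C1 s(1) by (intro ge_one_powr_ge_zero) auto
  ultimately show thesis using that by blast
qed

text \<open>A measurable majorant \<open>\<Phi>\<close> independent of the cube stands in for the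
  \<open>q x\<close>-th power of the fractional maximal function, so the supremum carrying
  \<open>l powr \<delta> x\<close> is never integrated itself.\<close>

proposition fractional_maximal_modular_bound:
  fixes r q \<delta> :: "real ^ 'n \<Rightarrow> real"
  assumes r: "log_hoelder c rinf r" and s: "1 < s" "\<And>x. s \<le> r x" and r1: "1 \<le> rinf"
    and [measurable]: "r \<in> borel_measurable lebesgue"
    and q: "\<And>x. r x \<le> q x" "\<And>x. q x \<le> qmax" and dmax: "\<And>x. \<delta> x \<le> dmax" "rinf * dmax < real CARD('n)"
    and rq: "\<And>x. \<delta> x / real CARD('n) = 1 / r x - 1 / q x"
  obtains K where "0 \<le> K" "\<And>f. \<lbrakk>f \<in> borel_measurable lebesgue; \<And>x. 0 \<le> f x; (\<integral>\<^sup>+y. ennreal (f y powr r y) \<partial>lebesgue) \<le> 1\<rbrakk> \<Longrightarrow>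
     \<exists>\<Phi> \<in> borel_measurable lebesgue. (\<integral>\<^sup>+x. \<Phi> x \<partial>lebesgue) \<le> ennreal K \<and>
       (\<forall>x a l. 0 < l \<longrightarrow> x \<in> cube a l \<longrightarrow>
         ennpowr (ennreal (l powr \<delta> x) * ((\<integral>\<^sup>+y\<in>cube a l. ennreal (f y) \<partial>lebesgue) / emeasure lebesgue (cube a l))) (q x) \<le> \<Phi> x)"
proof -
  let ?n = "real CARD('n)"
  let ?w = "wt (2 * ?n) :: real ^ 'n \<Rightarrow> real"
  have n1: "1 \<le> ?n" by (simp add: Suc_leI)
  have r1': "1 \<le> r x" for x using s(1) s(2)[of x] by linarith
  have rmax: "r x \<le> qmax" for x using q by (meson order_trans)
  obtain C1 where C1: "1 \<le> C1" "\<And>f a l x t. \<lbrakk>f \<in> borel_measurable lebesgue; \<And>x. 0 \<le> f x; 0 < l; x \<in> cube a l;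
     (\<integral>\<^sup>+y. ennreal (f y powr r y) \<partial>lebesgue) \<le> 1; 0 \<le> t;
     (\<integral>\<^sup>+y\<in>cube a l. ennreal (f y) \<partial>lebesgue) = ennreal (t * l powr ?n)\<rbrakk> \<Longrightarrow>
     (l powr \<delta> x * t) powr q x \<le> C1 * (t powr r x + ?w x)"
    by (fact fractional_average_bound[OF r r1' r1 assms(5) q dmax rq])
  have m0: "0 \<le> 2 * ?n" by simp
  obtain C2 where C2: "1 \<le> C2" "\<And>f a l x t. \<lbrakk>f \<in> borel_measurable lebesgue; \<And>x. 0 \<le> f x; 0 < l; x \<in> cube a l;
     (\<integral>\<^sup>+y. ennreal (f y powr r y) \<partial>lebesgue) \<le> 1; 0 \<le> t;
     (\<integral>\<^sup>+y\<in>cube a l. ennreal (f y) \<partial>lebesgue) = ennreal (t * l powr ?n)\<rbrakk> \<Longrightarrow>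
     ennreal (t powr r x) \<le> ennreal C2 *
       ennpowr (max_fun (\<lambda>y. ennreal (f y powr (r y / s)) + ennreal (?w y)) x + ennreal (?w x)) s"
    by (fact average_powr_bound[OF r s rmax assms(5) m0])
  obtain S where S: "0 \<le> S" "\<And>G :: real ^ 'n \<Rightarrow> ennreal. G \<in> borel_measurable lebesgue \<Longrightarrow>
    (\<integral>\<^sup>+x. ennpowr (max_fun G x) s \<partial>lebesgue) \<le> ennreal S * (\<integral>\<^sup>+x. ennpowr (G x) s \<partial>lebesgue)"
    by (fact max_fun_strong_type[OF s(1)])
  obtain H where H: "0 \<le> H" "(\<integral>\<^sup>+x. ennreal (?w x) \<partial>lebesgue) = ennreal H"
    using wt_integrable[where 'n = 'n, of "2 * ?n"] by (cases "\<integral>\<^sup>+x. ennreal (?w x) \<partial>lebesgue") auto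
  \<comment> \<open>\<open>S\<close> is the constant of the maximal theorem, each
    \<open>2 powr s\<close> comes from splitting the power of a sum, and \<open>H\<close> is the
    integral of the weight.\<close>
  define K where "K = C1 * (C2 * (2 powr s * (S * (2 powr s * (1 + H)) + H)) + H)"
  have "\<exists>\<Phi> \<in> borel_measurable lebesgue. (\<integral>\<^sup>+x. \<Phi> x \<partial>lebesgue) \<le> ennreal K \<and>
       (\<forall>x a l. 0 < l \<longrightarrow> x \<in> cube a l \<longrightarrow>
         ennpowr (ennreal (l powr \<delta> x) * ((\<integral>\<^sup>+y\<in>cube a l. ennreal (f y) \<partial>lebesgue) / emeasure lebesgue (cube a l))) (q x) \<le> \<Phi> x)"
    if [measurable]: "f \<in> borel_measurable lebesgue" and f: "\<And>x. 0 \<le> f x"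
      and int: "(\<integral>\<^sup>+y. ennreal (f y powr r y) \<partial>lebesgue) \<le> 1" for f
  proof -
    define G where "G = (\<lambda>y. ennreal (f y powr (r y / s)) + ennreal (?w y))"
    have [measurable]: "G \<in> borel_measurable lebesgue" unfolding G_def by measurable
    define \<Phi> where "\<Phi> = (\<lambda>x. ennreal C1 * (ennreal C2 * ennpowr (max_fun G x + ennreal (?w x)) s + ennreal (?w x)))"
    have ws: "ennpowr (ennreal (?w x)) s \<le> ennreal (?w x)" for x
      using powr_mono'[of 1 s "?w x"] s(1) wt_le_1[OF m0, of x] by (simp add: ennpowr_ennreal ennreal_leI)
    have wsH: "(\<integral>\<^sup>+x. ennpowr (ennreal (?w x)) s \<partial>lebesgue) \<le> ennreal H"
      unfolding H(2)[symmetric] by (intro nn_integral_mono ws)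
    have add: "(\<integral>\<^sup>+x. ennpowr (F x + F' x) s \<partial>lebesgue) \<le>
        ennreal (2 powr s) * ((\<integral>\<^sup>+x. ennpowr (F x) s \<partial>lebesgue) + (\<integral>\<^sup>+x. ennpowr (F' x) s \<partial>lebesgue))"
      if [measurable]: "F \<in> borel_measurable lebesgue" "F' \<in> borel_measurable lebesgue" for F F' :: "real ^ 'n \<Rightarrow> ennreal"
    proof -
      have "(\<integral>\<^sup>+x. ennpowr (F x + F' x) s \<partial>lebesgue) \<le> (\<integral>\<^sup>+x. ennreal (2 powr s) * (ennpowr (F x) s + ennpowr (F' x) s) \<partial>lebesgue)"
        using s(1) by (intro nn_integral_mono ennpowr_add) auto
      then show ?thesis by (simp add: nn_integral_cmult nn_integral_add)
    qed
    have "(\<integral>\<^sup>+x. ennpowr (G x) s \<partial>lebesgue) \<le> ennreal (2 powr s) *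
        ((\<integral>\<^sup>+x. ennpowr (ennreal (f x powr (r x / s))) s \<partial>lebesgue) + (\<integral>\<^sup>+x. ennpowr (ennreal (?w x)) s \<partial>lebesgue))"
      unfolding G_def by (rule add) measurable
    also have "\<dots> \<le> ennreal (2 powr s) * (1 + ennreal H)"
      using int s(1) by (intro mult_left_mono add_mono wsH) (auto simp: ennpowr_ennreal powr_powr)
    finally have GI: "(\<integral>\<^sup>+x. ennpowr (G x) s \<partial>lebesgue) \<le> ennreal (2 powr s) * (1 + ennreal H)" .
    have "(\<integral>\<^sup>+x. ennpowr (max_fun G x + ennreal (?w x)) s \<partial>lebesgue) \<le> ennreal (2 powr s) *
        ((\<integral>\<^sup>+x. ennpowr (max_fun G x) s \<partial>lebesgue) + (\<integral>\<^sup>+x. ennpowr (ennreal (?w x)) s \<partial>lebesgue))"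
      by (rule add) measurable
    also have "\<dots> \<le> ennreal (2 powr s) * (ennreal S * (ennreal (2 powr s) * (1 + ennreal H)) + ennreal H)"
      using GI by (intro mult_left_mono add_mono wsH order_trans[OF S(2)]) auto
    finally have MI: "(\<integral>\<^sup>+x. ennpowr (max_fun G x + ennreal (?w x)) s \<partial>lebesgue) \<le>
      ennreal (2 powr s) * (ennreal S * (ennreal (2 powr s) * (1 + ennreal H)) + ennreal H)" .
    have "(\<integral>\<^sup>+x. \<Phi> x \<partial>lebesgue) = ennreal C1 * (ennreal C2 * (\<integral>\<^sup>+x. ennpowr (max_fun G x + ennreal (?w x)) s \<partial>lebesgue) + ennreal H)"
      unfolding \<Phi>_def H(2)[symmetric] by (simp add: nn_integral_cmult nn_integral_add)
    also have "\<dots> \<le> ennreal C1 * (ennreal C2 * (ennreal (2 powr s) * (ennreal S * (ennreal (2 powr s) * (1 + ennreal H)) + ennreal H)) + ennreal H)"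
      by (intro mult_left_mono add_right_mono MI) auto
    also have "\<dots> = ennreal K"
      using H S C1(1) C2(1) unfolding K_def ennreal_1[symmetric]
      by (simp add: ennreal_mult[symmetric] ennreal_plus[symmetric] del: ennreal_plus ennreal_1)
    finally have 1: "(\<integral>\<^sup>+x. \<Phi> x \<partial>lebesgue) \<le> ennreal K" .
    have 2: "ennpowr (ennreal (l powr \<delta> x) * ((\<integral>\<^sup>+y\<in>cube a l. ennreal (f y) \<partial>lebesgue) / emeasure lebesgue (cube a l))) (q x) \<le> \<Phi> x"
      if l: "0 < l" and x: "x \<in> cube a l" for x a l
    proof -
      have lpos: "0 < l powr ?n" using l by simp
      \<comment> \<open>A crude bound that makes the average finite, so that it can be named by a
        real number \<open>t\<close>.\<close>
      have "(\<integral>\<^sup>+y\<in>cube a l. ennreal (f y) \<partial>lebesgue) \<le> (\<integral>\<^sup>+y. indicator (cube a l) y + ennreal (f y powr r y) \<partial>lebesgue)"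
      proof (rule nn_integral_mono)
        fix y
        have "f y \<le> 1 + f y powr r y"
          using young_split[OF f, of 1 "r y" y] r1' by simp
        then have "ennreal (f y) \<le> ennreal (1 + f y powr r y)" by (rule ennreal_leI)
        then show "ennreal (f y) * indicator (cube a l) y \<le> indicator (cube a l) y + ennreal (f y powr r y)"
          by (auto simp: indicator_def)
      qed
      also have "\<dots> = ennreal (l powr ?n) + (\<integral>\<^sup>+y. ennreal (f y powr r y) \<partial>lebesgue)"
        using l by (subst nn_integral_add) (auto simp: emeasure_cube simp del: emeasure_completion)
      also have "\<dots> \<le> ennreal (l powr ?n) + 1" by (intro add_left_mono int)
      also have "\<dots> < top" by simp
      finally obtain t0 where t0: "0 \<le> t0" "(\<integral>\<^sup>+y\<in>cube a l. ennreal (f y) \<partial>lebesgue) = ennreal t0"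
        by (cases "\<integral>\<^sup>+y\<in>cube a l. ennreal (f y) \<partial>lebesgue") auto
      define t where "t = t0 / l powr ?n"
      have t: "0 \<le> t" "(\<integral>\<^sup>+y\<in>cube a l. ennreal (f y) \<partial>lebesgue) = ennreal (t * l powr ?n)"
        using t0 lpos by (auto simp: t_def)
      have "(\<integral>\<^sup>+y\<in>cube a l. ennreal (f y) \<partial>lebesgue) / emeasure lebesgue (cube a l) = ennreal t"
        unfolding t(2) using t(1) l lpos by (simp add: emeasure_cube divide_ennreal del: emeasure_completion)
      then have "ennpowr (ennreal (l powr \<delta> x) * ((\<integral>\<^sup>+y\<in>cube a l. ennreal (f y) \<partial>lebesgue) / emeasure lebesgue (cube a l))) (q x)
        = ennreal ((l powr \<delta> x * t) powr q x)"
        using t(1) by (simp add: ennreal_mult[symmetric] ennpowr_ennreal)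
      also have "\<dots> \<le> ennreal (C1 * (t powr r x + ?w x))"
        by (intro ennreal_leI C1(2)[OF _ f l x int t]) measurable
      also have "\<dots> = ennreal C1 * (ennreal (t powr r x) + ennreal (?w x))"
        using C1(1) by (simp add: ennreal_mult ennreal_plus)
      also have "\<dots> \<le> \<Phi> x"
        unfolding \<Phi>_def G_def by (intro mult_left_mono add_right_mono C2(2)[OF _ f l x int t]) auto
      finally show ?thesis .
    qed
    have "\<Phi> \<in> borel_measurable lebesgue" unfolding \<Phi>_def by measurable
    then show ?thesis using 1 2 by blast
  qed
  moreover have "0 \<le> K" using C1(1) C2(1) S H by (simp add: K_def)
  ultimately show thesis using that by blast
qed

section \<open>Variable Lebesgue spaces\<close>

lemma divide_ennreal_mult:
  assumes "0 < c" "0 < l"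
  shows "a / ennreal (c * l) = ennreal (1 / c) * (a / ennreal l)"
  using assms by (cases a) (auto simp: divide_ennreal ennreal_mult[symmetric] ennreal_top_divide ennreal_mult_top)

text \<open>As \<open>p x\<close> is at least 1, the factor \<open>(1 / c) powr p x\<close> is at
  most \<open>1 / c\<close>. A modular bound \<open>K\<close> thus becomes the bound 1 after
  enlarging the scale by \<open>K\<close>.\<close>

lemma var_modular_scale:
  assumes [measurable]: "p \<in> borel_measurable lebesgue" "F \<in> borel_measurable lebesgue"
    and p: "\<And>x. 1 \<le> p x" and c: "1 \<le> c" and l: "0 < l"
  shows "var_modular p (\<lambda>x. F x / ennreal (c * l)) \<le> ennreal (1 / c) * var_modular p (\<lambda>x. F x / ennreal l)"
proof -
  have "var_modular p (\<lambda>x. F x / ennreal (c * l)) \<le> (\<integral>\<^sup>+x. ennreal (1 / c) * ennpowr (F x / ennreal l) (p x) \<partial>lebesgue)"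
    unfolding var_modular_def
  proof (rule nn_integral_mono)
    fix x
    have "ennpowr (F x / ennreal (c * l)) (p x) \<le> ennreal ((1 / c) powr p x) * ennpowr (F x / ennreal l) (p x)"
      using c l by (subst divide_ennreal_mult) (auto intro: ennpowr_mult)
    also have "\<dots> \<le> ennreal (1 / c) * ennpowr (F x / ennreal l) (p x)"
      using powr_mono'[of 1 "p x" "1 / c"] p[of x] c by (intro mult_right_mono ennreal_leI) auto
    finally show "ennpowr (F x / ennreal (c * l)) (p x) \<le> ennreal (1 / c) * ennpowr (F x / ennreal l) (p x)" .
  qed
  also have "\<dots> = ennreal (1 / c) * var_modular p (\<lambda>x. F x / ennreal l)"
    unfolding var_modular_def by (rule nn_integral_cmult) measurable
  finally show ?thesis .
qed

lemma var_modular_mono: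
  assumes "\<And>x. 0 \<le> p x" "\<And>x. F x \<le> G x"
  shows "var_modular p F \<le> var_modular p G"
  unfolding var_modular_def using assms by (intro nn_integral_mono ennpowr_mono)

text \<open>This makes the set in \<open>var_norm_enn\<close> nonempty, so that its
  \<open>Inf\<close> is a true infimum.\<close>

lemma var_Lebesgue_enn_modular_le_1:
  assumes "p \<in> borel_measurable lebesgue" "\<And>x. 1 \<le> p x" "F \<in> var_Lebesgue_enn p"
  obtains l where "0 < l" "var_modular p (\<lambda>x. F x / ennreal l) \<le> 1"
proof -
  obtain l where l: "0 < l" "var_modular p (\<lambda>x. F x / ennreal l) < \<infinity>" and F: "F \<in> borel_measurable lebesgue"
    using assms(3) by (auto simp: var_Lebesgue_enn_def)
  then obtain v where v: "0 \<le> v" "var_modular p (\<lambda>x. F x / ennreal l) = ennreal v"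
    by (cases "var_modular p (\<lambda>x. F x / ennreal l)") auto
  have "var_modular p (\<lambda>x. F x / ennreal (max 1 v * l)) \<le> ennreal (1 / max 1 v) * ennreal v"
    using var_modular_scale[OF assms(1) F assms(2), of "max 1 v" l] l v by simp
  also have "\<dots> \<le> 1" using v by (simp add: ennreal_mult[symmetric] ennreal_le_1)
  finally show thesis using l by (intro that[of "max 1 v * l"]) auto
qed

lemma var_norm_enn_le:
  assumes "0 < l" "var_modular p (\<lambda>x. F x / ennreal l) \<le> 1"
  shows "var_norm_enn p F \<le> l"
  unfolding var_norm_enn_def using assms by (intro cInf_lower bdd_belowI[of _ 0]) auto

text \<open>Homogeneity reduces the norm inequality to a uniform modular bound on nonnegative
  functions of modular at most 1; \<open>scale\<close> also passes from \<open>f\<close> to its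
  absolute value.\<close>

lemma bounded_betweenI:
  fixes r q :: "real ^ 'n \<Rightarrow> real"
  assumes [measurable]: "r \<in> borel_measurable lebesgue" "q \<in> borel_measurable lebesgue"
    and r1: "\<And>x. 1 \<le> r x" and q1: "\<And>x. 1 \<le> q x" and K: "1 \<le> K"
    and meas: "\<And>f. f \<in> borel_measurable lebesgue \<Longrightarrow> T f \<in> borel_measurable lebesgue"
    and scale: "\<And>f l. f \<in> borel_measurable lebesgue \<Longrightarrow> 0 < l \<Longrightarrow> T f = (\<lambda>x. ennreal l * T (\<lambda>y. \<bar>f y\<bar> / l) x)"
    and bound: "\<And>f. f \<in> borel_measurable lebesgue \<Longrightarrow> (\<And>x. 0 \<le> f x) \<Longrightarrow>
      (\<integral>\<^sup>+y. ennreal (f y powr r y) \<partial>lebesgue) \<le> 1 \<Longrightarrow> var_modular q (T f) \<le> ennreal K"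
  shows "bounded_between r q T"
  unfolding bounded_between_def
proof (intro exI[of _ K] ballI conjI)
  fix f assume "f \<in> var_Lebesgue r"
  then have fm [measurable]: "f \<in> borel_measurable lebesgue" and fL: "(\<lambda>x. ennreal \<bar>f x\<bar>) \<in> var_Lebesgue_enn r"
    by (auto simp: var_Lebesgue_def)
  let ?S = "{l. 0 < l \<and> var_modular r (\<lambda>x. ennreal \<bar>f x\<bar> / ennreal l) \<le> 1}"
  have main: "var_modular q (\<lambda>x. T f x / ennreal (K * l)) \<le> 1" if "l \<in> ?S" for l
  proof -
    have l: "0 < l" using that by simp
    have "(\<integral>\<^sup>+y. ennreal ((\<bar>f y\<bar> / l) powr r y) \<partial>lebesgue) = var_modular r (\<lambda>x. ennreal \<bar>f x\<bar> / ennreal l)"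
      unfolding var_modular_def using l by (simp add: divide_ennreal ennpowr_ennreal)
    then have "var_modular q (T (\<lambda>y. \<bar>f y\<bar> / l)) \<le> ennreal K"
      using that l by (intro bound) auto
    moreover have "(\<lambda>x. T f x / ennreal l) = T (\<lambda>y. \<bar>f y\<bar> / l)"
    proof
      fix x
      have "ennreal l * a / ennreal l = a" for a
        using l ennreal_mult_divide_eq[of "ennreal l" a] by (simp add: mult.commute)
      then show "T f x / ennreal l = T (\<lambda>y. \<bar>f y\<bar> / l) x"
        by (subst scale[OF fm l])
    qed
    ultimately have "var_modular q (\<lambda>x. T f x / ennreal l) \<le> ennreal K" by simp
    moreover have "var_modular q (\<lambda>x. T f x / ennreal (K * l)) \<le> ennreal (1 / K) * var_modular q (\<lambda>x. T f x / ennreal l)"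
      using var_modular_scale[OF assms(2) meas[OF fm] q1 K l] .
    ultimately have "var_modular q (\<lambda>x. T f x / ennreal (K * l)) \<le> ennreal (1 / K) * ennreal K"
      by (meson mult_left_mono order_trans zero_le)
    then show ?thesis using K by (simp add: ennreal_mult[symmetric])
  qed
  obtain l0 where l0: "l0 \<in> ?S"
    using var_Lebesgue_enn_modular_le_1[OF assms(1) r1 fL] by blast
  have "var_modular q (\<lambda>x. T f x / ennreal (K * l0)) < \<infinity>"
    using main[OF l0] by (simp add: order_le_less_trans[of _ 1])
  then show "T f \<in> var_Lebesgue_enn q"
    using l0 K meas[OF fm] by (auto simp: var_Lebesgue_enn_def intro!: exI[of _ "K * l0"])
  have "var_norm_enn q (T f) / K \<le> Inf ?S"
  proof (rule cInf_greatest)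
    fix l assume l: "l \<in> ?S"
    have "var_norm_enn q (T f) \<le> K * l"
      using main[OF l] l K by (intro var_norm_enn_le) auto
    then show "var_norm_enn q (T f) / K \<le> l" using K by (simp add: field_simps)
  qed (use l0 in blast)
  then show "var_norm_enn q (T f) \<le> K * var_norm r f"
    using K by (simp add: var_norm_def var_norm_enn_def field_simps)
qed

section \<open>The maximal commutator\<close>

text \<open>The function is the pointwise limit of its restrictions to growing balls.\<close>

lemma locally_integrable_borel_measurable:
  fixes b :: "real ^ 'n \<Rightarrow> real"
  assumes "locally_integrable b"
  shows "b \<in> borel_measurable lebesgue"
proof (rule borel_measurable_LIMSEQ_real)
  show "(\<lambda>x. indicator (cball 0 (real k)) x *\<^sub>R b x) \<in> borel_measurable lebesgue" for k
    using assms compact_cball[of "0 :: real ^ 'n" "real k"]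
    unfolding locally_integrable_def set_integrable_def by (blast intro: borel_measurable_integrable)
  fix x :: "real ^ 'n"
  obtain k0 where "norm x \<le> real k0" using real_arch_simple by blast
  then have "indicator (cball 0 (real k)) x *\<^sub>R b x = b x" if "k0 \<le> k" for k
    using that by (auto simp: indicator_def)
  then show "(\<lambda>k. indicator (cball 0 (real k)) x *\<^sub>R b x) \<longlonglongrightarrow> b x"
    by (intro tendsto_eventually) (auto simp: eventually_sequentially)
qed

text \<open>The point \<open>x\<close> also occurs inside the integral here, so measurability in
  \<open>x\<close> of each term rests on sigma-finiteness.\<close>

lemma borel_measurable_max_commutator:
  fixes b f :: "real ^ 'n \<Rightarrow> real"
  assumes [measurable]: "b \<in> borel_measurable lebesgue" "f \<in> borel_measurable lebesgue"
  shows "max_commutator b f \<in> borel_measurable lebesgue"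
proof -
  interpret L: sigma_finite_measure "lebesgue :: (real ^ 'n) measure" by (rule sigma_finite_lebesgue)
  have "max_commutator b f = (\<lambda>x. SUP i \<in> rat_cubes. indicator (cube (fst i) (snd i)) x *
      ((\<integral>\<^sup>+y\<in>cube (fst i) (snd i). ennreal (\<bar>b x - b y\<bar> * \<bar>f y\<bar>) \<partial>lebesgue) / emeasure lebesgue (cube (fst i) (snd i))))"
    unfolding max_commutator_def by (rule ext, subst SUP_cubes_eq_rat) (auto simp: set_nn_integral_mono_set split_def)
  also have "\<dots> \<in> borel_measurable lebesgue"
    by (intro borel_measurable_SUP countable_rat_cubes) measurable
  finally show ?thesis .
qed

lemma max_commutator_scale:
  fixes b f :: "real ^ 'n \<Rightarrow> real"
  assumes [measurable]: "b \<in> borel_measurable lebesgue" "f \<in> borel_measurable lebesgue" and l: "0 < l"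
  shows "max_commutator b f = (\<lambda>x. ennreal l * max_commutator b (\<lambda>y. \<bar>f y\<bar> / l) x)"
proof
  fix x :: "real ^ 'n"
  have "ennreal l * ((\<integral>\<^sup>+y\<in>Q. ennreal (\<bar>b x - b y\<bar> * \<bar>\<bar>f y\<bar> / l\<bar>) \<partial>lebesgue) / emeasure lebesgue Q) =
     (\<integral>\<^sup>+y\<in>Q. ennreal (\<bar>b x - b y\<bar> * \<bar>f y\<bar>) \<partial>lebesgue) / emeasure lebesgue Q" if "Q \<in> cubes" for Q
  proof -
    have [measurable]: "Q \<in> sets lebesgue" using that by (auto simp: cubes_eq)
    have "ennreal l * (\<integral>\<^sup>+y\<in>Q. ennreal (\<bar>b x - b y\<bar> * \<bar>\<bar>f y\<bar> / l\<bar>) \<partial>lebesgue) =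
       (\<integral>\<^sup>+y. ennreal l * (ennreal (\<bar>b x - b y\<bar> * \<bar>\<bar>f y\<bar> / l\<bar>) * indicator Q y) \<partial>lebesgue)"
      by (rule nn_integral_cmult[symmetric]) measurable
    also have "\<dots> = (\<integral>\<^sup>+y\<in>Q. ennreal (\<bar>b x - b y\<bar> * \<bar>f y\<bar>) \<partial>lebesgue)"
      using l by (intro nn_integral_cong) (auto simp: mult.assoc[symmetric] ennreal_mult[symmetric])
    finally show ?thesis by (simp add: ennreal_times_divide)
  qed
  then show "max_commutator b f x = ennreal l * max_commutator b (\<lambda>y. \<bar>f y\<bar> / l) x"
    unfolding max_commutator_def by (subst SUP_mult_left_ennreal) (auto intro!: SUP_cong)
qed

theorem bounded_max_commutator_if_lipschitz:
  fixes r q \<delta> b :: "real ^ 'n \<Rightarrow> real"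
  assumes r: "log_hoelder c rinf r" and s: "1 < s" "\<And>x. s \<le> r x" and r1: "1 \<le> rinf"
    and [measurable]: "r \<in> borel_measurable lebesgue" "q \<in> borel_measurable lebesgue" "b \<in> borel_measurable lebesgue"
    and q: "\<And>x. r x \<le> q x" "\<And>x. q x \<le> qmax"
    and d: "\<And>x. 0 \<le> \<delta> x" "\<And>x. \<delta> x \<le> real CARD('n)" "\<And>x. \<delta> x \<le> dmax" "rinf * dmax < real CARD('n)"
    and rq: "\<And>x. \<delta> x / real CARD('n) = 1 / r x - 1 / q x"
    and b: "b \<in> var_Lipschitz \<delta>"
  shows "bounded_between r q (max_commutator b)"
proof -
  let ?n = "real CARD('n)"
  have n1: "1 \<le> ?n" by (simp add: Suc_leI)
  obtain K0 where K0: "0 \<le> K0" "\<And>f. \<lbrakk>f \<in> borel_measurable lebesgue; \<And>x. 0 \<le> f x; (\<integral>\<^sup>+y. ennreal (f y powr r y) \<partial>lebesgue) \<le> 1\<rbrakk> \<Longrightarrow>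
     \<exists>\<Phi> \<in> borel_measurable lebesgue. (\<integral>\<^sup>+x. \<Phi> x \<partial>lebesgue) \<le> ennreal K0 \<and>
       (\<forall>x a l. 0 < l \<longrightarrow> x \<in> cube a l \<longrightarrow>
         ennpowr (ennreal (l powr \<delta> x) * ((\<integral>\<^sup>+y\<in>cube a l. ennreal (f y) \<partial>lebesgue) / emeasure lebesgue (cube a l))) (q x) \<le> \<Phi> x)"
    by (fact fractional_maximal_modular_bound[OF r s r1 assms(5) q d(3,4) rq])
  obtain b' C0 where b': "AE x in lebesgue. b x = b' x" "\<And>x y. \<bar>b' x - b' y\<bar> \<le> C0 * norm (x - y) powr \<delta> x"
    using b by (auto simp: var_Lipschitz_def)
  \<comment> \<open>The diameter of a cube is at most \<open>?n * l\<close>, and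
    \<open>?n powr \<delta> x\<close> is at most \<open>?n powr ?n\<close>. The outer maximum lets
    \<open>B powr q x\<close> be raised to \<open>B powr qmax\<close>.\<close>
  define B where "B = max 1 (max 0 C0 * ?n powr ?n)"
  have B1: "1 \<le> B" by (simp add: B_def)
  have q1: "1 \<le> q x" for x using s(1) s(2)[of x] q(1)[of x] by linarith
  have qmax: "1 \<le> qmax" using q1 q(2) by (meson order_trans)
  have osc: "\<bar>b' x - b' y\<bar> \<le> B * l powr \<delta> x" if "x \<in> cube a l" "y \<in> cube a l" "0 < l" for x y a l
  proof -
    have "\<bar>b' x - b' y\<bar> \<le> max 0 C0 * norm (x - y) powr \<delta> x"
      by (rule order_trans[OF b'(2) mult_right_mono]) auto
    also have "\<dots> \<le> max 0 C0 * (?n * l) powr \<delta> x"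
      using d(1) dist_cube[OF that(1,2)] by (intro mult_left_mono powr_mono2) auto
    also have "\<dots> = max 0 C0 * ?n powr \<delta> x * l powr \<delta> x"
      using that by (simp add: powr_mult)
    also have "\<dots> \<le> max 0 C0 * ?n powr ?n * l powr \<delta> x"
      using n1 d(2) by (intro mult_right_mono mult_left_mono powr_mono) auto
    also have "\<dots> \<le> B * l powr \<delta> x"
      by (intro mult_right_mono) (auto simp: B_def)
    finally show ?thesis .
  qed
  define K where "K = max 1 (B powr qmax * K0)"
  show ?thesis
  proof (rule bounded_betweenI[where K = K])
    fix f :: "real ^ 'n \<Rightarrow> real"
    assume [measurable]: "f \<in> borel_measurable lebesgue" and f: "\<And>x. 0 \<le> f x"
      and int: "(\<integral>\<^sup>+y. ennreal (f y powr r y) \<partial>lebesgue) \<le> 1"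
    obtain \<Phi> where [measurable]: "\<Phi> \<in> borel_measurable lebesgue" and \<Phi>: "(\<integral>\<^sup>+x. \<Phi> x \<partial>lebesgue) \<le> ennreal K0"
       "\<And>x a l. 0 < l \<Longrightarrow> x \<in> cube a l \<Longrightarrow>
         ennpowr (ennreal (l powr \<delta> x) * ((\<integral>\<^sup>+y\<in>cube a l. ennreal (f y) \<partial>lebesgue) / emeasure lebesgue (cube a l))) (q x) \<le> \<Phi> x"
      using K0(2)[OF _ f int] by auto
    \<comment> \<open>The representative is used twice: outside the integral at almost every
      \<open>x\<close>, and inside it at almost every \<open>y\<close>.\<close>
    have "AE x in lebesgue. ennpowr (max_commutator b f x) (q x) \<le> ennreal (B powr qmax) * \<Phi> x"
      using b'(1)
    proof eventually_elim
      case (elim x)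
      show ?case
        unfolding max_commutator_def
      proof (rule ennpowr_SUP_le)
        show "0 < q x" using q1[of x] by linarith
        fix Q :: "(real ^ 'n) set" assume "Q \<in> {Q \<in> cubes. x \<in> Q}"
        then obtain a l where Q: "Q = cube a l" and l: "0 < l" and x: "x \<in> cube a l"
          by (auto simp: cubes_eq)
        have "(\<integral>\<^sup>+y\<in>Q. ennreal (\<bar>b x - b y\<bar> * \<bar>f y\<bar>) \<partial>lebesgue) \<le>
          (\<integral>\<^sup>+y. ennreal (B * l powr \<delta> x) * (ennreal (f y) * indicator Q y) \<partial>lebesgue)"
        proof (rule nn_integral_mono_AE)
          show "AE y in lebesgue. ennreal (\<bar>b x - b y\<bar> * \<bar>f y\<bar>) * indicator Q y \<le>
             ennreal (B * l powr \<delta> x) * (ennreal (f y) * indicator Q y)"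
            using b'(1)
          proof eventually_elim
            case (elim y)
            show ?case
            proof (cases "y \<in> Q")
              case True
              then have "\<bar>b x - b y\<bar> * \<bar>f y\<bar> \<le> B * l powr \<delta> x * f y"
                using osc[OF x _ l, of y] \<open>b x = b' x\<close> elim f[of y] by (simp add: Q mult_right_mono)
              then show ?thesis
                using True B1 f[of y] by (simp add: ennreal_mult[symmetric] ennreal_leI)
            qed simp
          qed
        qed
        also have "\<dots> = ennreal (B * l powr \<delta> x) * (\<integral>\<^sup>+y\<in>Q. ennreal (f y) \<partial>lebesgue)"
          unfolding Q by (rule nn_integral_cmult) measurable
        finally have "(\<integral>\<^sup>+y\<in>Q. ennreal (\<bar>b x - b y\<bar> * \<bar>f y\<bar>) \<partial>lebesgue) / emeasure lebesgue Q \<le>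
          ennreal (B * l powr \<delta> x) * (\<integral>\<^sup>+y\<in>Q. ennreal (f y) \<partial>lebesgue) / emeasure lebesgue Q"
          by (rule divide_right_mono_ennreal)
        also have "\<dots> = ennreal B * (ennreal (l powr \<delta> x) * ((\<integral>\<^sup>+y\<in>Q. ennreal (f y) \<partial>lebesgue) / emeasure lebesgue Q))"
          using B1 by (simp add: ennreal_mult ennreal_times_divide mult.assoc)
        finally have "ennpowr ((\<integral>\<^sup>+y\<in>Q. ennreal (\<bar>b x - b y\<bar> * \<bar>f y\<bar>) \<partial>lebesgue) / emeasure lebesgue Q) (q x) \<le>
          ennpowr (ennreal B * (ennreal (l powr \<delta> x) * ((\<integral>\<^sup>+y\<in>Q. ennreal (f y) \<partial>lebesgue) / emeasure lebesgue Q))) (q x)"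
          using q1[of x] by (intro ennpowr_mono) auto
        also have "\<dots> \<le> ennreal (B powr q x) * ennpowr (ennreal (l powr \<delta> x) * ((\<integral>\<^sup>+y\<in>Q. ennreal (f y) \<partial>lebesgue) / emeasure lebesgue Q)) (q x)"
          using B1 by (intro ennpowr_mult) auto
        also have "\<dots> \<le> ennreal (B powr qmax) * \<Phi> x"
          using B1 q(2) \<Phi>(2)[OF l x] unfolding Q by (intro mult_mono ennreal_leI powr_mono) auto
        finally show "ennpowr ((\<integral>\<^sup>+y\<in>Q. ennreal (\<bar>b x - b y\<bar> * \<bar>f y\<bar>) \<partial>lebesgue) / emeasure lebesgue Q) (q x) \<le>
          ennreal (B powr qmax) * \<Phi> x" .
      qed
    qed
    then have "var_modular q (max_commutator b f) \<le> (\<integral>\<^sup>+x. ennreal (B powr qmax) * \<Phi> x \<partial>lebesgue)"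
      unfolding var_modular_def by (rule nn_integral_mono_AE)
    also have "\<dots> = ennreal (B powr qmax) * (\<integral>\<^sup>+x. \<Phi> x \<partial>lebesgue)"
      by (rule nn_integral_cmult) measurable
    also have "\<dots> \<le> ennreal (B powr qmax) * ennreal K0"
      by (intro mult_left_mono \<Phi>) auto
    also have "\<dots> \<le> ennreal K"
      using K0(1) by (simp add: K_def ennreal_mult[symmetric] ennreal_leI)
    finally show "var_modular q (max_commutator b f) \<le> ennreal K" .
  next
    show "1 \<le> r x" for x using s(1) s(2)[of x] by linarith
    show "1 \<le> K" by (simp add: K_def)
  qed (use q1 in \<open>auto intro: borel_measurable_max_commutator max_commutator_scale\<close>)
qed

section \<open>Mean oscillation\<close>

text \<open>The norm of an indicator is at most a multiple of \<open>|Q| powr (1 / r x)\<close>. For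
  \<open>\<tau> = l powr (- (n / r x))\<close>, the power \<open>\<tau> powr r y\<close> is at most
  a multiple of \<open>1 / |Q|\<close> plus the weight at \<open>y\<close>, and this integrates over
  the cube to at most \<open>1 + H\<close>.\<close>

lemma indicator_modular_bound:
  fixes r :: "real ^ 'n \<Rightarrow> real"
  assumes r: "log_hoelder c rinf r" and r1: "\<And>x. 1 \<le> r x" "1 \<le> rinf"
    and [measurable]: "r \<in> borel_measurable lebesgue"
  obtains C where "1 \<le> C" "\<And>a l x. \<lbrakk>0 < l; x \<in> cube a l; l \<le> 1 \<or> l / 2 \<le> norm x\<rbrakk> \<Longrightarrow>
    var_modular r (\<lambda>y. ennreal (indicator (cube a l) y) / ennreal (C * l powr (real CARD('n) / r x))) \<le> 1"
proof -
  let ?n = "real CARD('n)"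
  let ?w = "wt (2 * ?n) :: real ^ 'n \<Rightarrow> real"
  have n1: "1 \<le> ?n" by (simp add: Suc_leI)
  have c0: "0 \<le> c" by (rule log_hoelder_nonneg[OF r])
  obtain H where H: "0 \<le> H" "(\<integral>\<^sup>+x. ennreal (?w x) \<partial>lebesgue) = ennreal H"
    using wt_integrable[where 'n = 'n, of "2 * ?n"] by (cases "\<integral>\<^sup>+x. ennreal (?w x) \<partial>lebesgue") auto
  \<comment> \<open>The first factor pays for small cubes through the local condition. The other two
    pay for large cubes: one for trading \<open>r x\<close> against \<open>rinf\<close>, one for
    trading \<open>r y\<close> against \<open>rinf\<close>.\<close>
  define E where "E = exp (c * (1 + ln ?n) * ?n) * (exp (2 * c * ?n) * exp (2 * c * ?n))"
  have E1: "1 \<le> E" unfolding E_def exp_add[symmetric] using c0 n1 by simp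
  define C where "C = E * (1 + H)"
  have C1: "1 \<le> C" unfolding C_def using E1 H mult_mono[of 1 E 1 "1 + H"] by simp
  have "var_modular r (\<lambda>y. ennreal (indicator (cube a l) y) / ennreal (C * l powr (?n / r x))) \<le> 1"
    if l: "0 < l" and x: "x \<in> cube a l" and lx: "l \<le> 1 \<or> l / 2 \<le> norm x" for a l x
  proof -
    define \<tau> where "\<tau> = l powr (- (?n / r x))"
    have \<tau>0: "0 < \<tau>" using l by (simp add: \<tau>_def)
    have pt: "\<tau> powr r y \<le> E * (l powr (- ?n) + ?w y)" if y: "y \<in> cube a l" for y
    proof (cases "l \<le> 1")
      case True
      define e where "e = \<bar>r x - r y\<bar>"
      have nr: "0 \<le> ?n / r x" "?n / r x \<le> ?n" using r1(1)[of x] n1 by (auto simp: field_simps)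
      have "1 \<le> \<tau>" using l True nr powr_mono'[of "- (?n / r x)" 0 l] by (simp add: \<tau>_def)
      then have "\<tau> powr r y \<le> \<tau> powr (r x + e)" by (intro powr_mono) (auto simp: e_def)
      also have "\<dots> = l powr (- ?n) * (l powr (- e)) powr (?n / r x)"
      proof -
        have "- (?n / r x) * (r x + e) = - ?n + - e * (?n / r x)"
          using r1(1)[of x] by (simp add: field_simps)
        then show ?thesis by (simp only: \<tau>_def powr_powr powr_add[symmetric])
      qed
      also have "\<dots> \<le> l powr (- ?n) * exp (c * (1 + ln ?n)) powr (?n / r x)"
        using log_hoelder_small_scale[OF r l True dist_cube[OF x y] n1] nr
        by (intro mult_left_mono powr_mono2) (auto simp: e_def)
      also have "\<dots> \<le> l powr (- ?n) * exp (c * (1 + ln ?n)) powr ?n"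
        using nr c0 n1 by (intro mult_left_mono powr_mono) auto
      also have "\<dots> = l powr (- ?n) * exp (c * (1 + ln ?n) * ?n)" by (simp add: powr_def mult.commute)
      also have "\<dots> \<le> l powr (- ?n) * E"
        unfolding E_def exp_add[symmetric] using c0 n1 by (intro mult_left_mono) auto
      also have "\<dots> \<le> E * (l powr (- ?n) + ?w y)" using E1 by (simp add: algebra_simps)
      finally show ?thesis .
    next
      case False
      then have l1: "1 \<le> l" and lx': "l / 2 \<le> norm x" using lx by auto
      \<comment> \<open>Keeping \<open>k\<close> above the weight makes the change from
        \<open>r y\<close> to \<open>rinf\<close> cost a bounded factor. Where the weight is the
        larger one, \<open>k powr rinf\<close> is at most the integrable weight.\<close>
      define k where "k = max \<tau> (?w y)"
      have "\<tau> \<le> 1" unfolding \<tau>_def using l1 r1(1)[of x] n1 powr_mono[of "- (?n / r x)" 0 l] by simp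
      then have k: "0 < k" "k \<le> 1" "\<tau> \<le> k" "?w y \<le> k"
        using \<tau>0 wt_le_1[of "2 * ?n" y] by (auto simp: k_def)
      have \<tau>inf: "\<tau> powr rinf \<le> l powr (- ?n) * exp (2 * c * ?n)"
      proof -
        have "- (?n / r x) * rinf = - ?n + ?n * ((r x - rinf) / r x)"
          using r1(1)[of x] by (simp add: field_simps)
        also have "\<dots> \<le> - ?n + \<bar>r x - rinf\<bar> * ?n"
        proof -
          have "(r x - rinf) / r x \<le> \<bar>r x - rinf\<bar> / 1"
            using r1(1)[of x] by (intro frac_le) auto
          then have "?n * ((r x - rinf) / r x) \<le> ?n * (\<bar>r x - rinf\<bar> / 1)"
            by (rule mult_left_mono) simp
          then show ?thesis by (simp add: mult.commute)
        qed
        finally have "l powr (- (?n / r x) * rinf) \<le> l powr (- ?n + \<bar>r x - rinf\<bar> * ?n)"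
          using l1 by (intro powr_mono) auto
        then have "\<tau> powr rinf \<le> l powr (- ?n + \<bar>r x - rinf\<bar> * ?n)"
          by (simp add: \<tau>_def powr_powr)
        also have "\<dots> = l powr (- ?n) * (l powr \<bar>r x - rinf\<bar>) powr ?n"
          by (simp only: powr_add powr_powr)
        also have "\<dots> \<le> l powr (- ?n) * exp (2 * c) powr ?n"
          using log_hoelder_large_scale[OF r l1 lx'] by (intro mult_left_mono powr_mono2) auto
        also have "\<dots> = l powr (- ?n) * exp (2 * c * ?n)" by (simp add: powr_def mult.commute)
        finally show ?thesis .
      qed
      have "\<tau> powr r y \<le> k powr r y" using k \<tau>0 r1(1)[of y] by (intro powr_mono2) auto
      also have "\<dots> \<le> k powr (rinf + - \<bar>r y - rinf\<bar>)" using k by (intro powr_mono') auto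
      also have "\<dots> = k powr rinf * k powr (- \<bar>r y - rinf\<bar>)" by (rule powr_add)
      also have "\<dots> \<le> k powr rinf * ?w y powr (- \<bar>r y - rinf\<bar>)"
        using k by (intro mult_left_mono powr_mono2') auto
      also have "\<dots> \<le> k powr rinf * exp (2 * c * ?n)"
        using log_hoelder_wt[OF r, of "2 * ?n" y] by (intro mult_left_mono) (auto simp: ac_simps)
      also have "\<dots> \<le> (\<tau> powr rinf + ?w y) * exp (2 * c * ?n)"
      proof (intro mult_right_mono)
        have "?w y powr rinf \<le> ?w y" using powr_mono'[of 1 rinf "?w y"] r1(2) wt_le_1[of "2 * ?n" y] by simp
        then show "k powr rinf \<le> \<tau> powr rinf + ?w y"
          by (smt (verit) k_def max_def powr_ge_zero wt_pos(2))
      qed simp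
      also have "\<dots> \<le> (l powr (- ?n) * exp (2 * c * ?n) + ?w y) * exp (2 * c * ?n)"
        using \<tau>inf by (intro mult_right_mono add_right_mono) auto
      also have "\<dots> \<le>
          (l powr (- ?n) * exp (2 * c * ?n) + ?w y * exp (2 * c * ?n)) * exp (2 * c * ?n)"
        using c0 n1 mult_left_mono[of 1 "exp (2 * c * ?n)" "?w y"] by (intro mult_right_mono add_left_mono) auto
      also have "\<dots> = (exp (2 * c * ?n) * exp (2 * c * ?n)) * (l powr (- ?n) + ?w y)"
        by (simp add: algebra_simps)
      also have "\<dots> \<le> E * (l powr (- ?n) + ?w y)"
      proof (rule mult_right_mono)
        have "1 \<le> exp (c * (1 + ln ?n) * ?n)" using c0 n1 by simp
        then show "exp (2 * c * ?n) * exp (2 * c * ?n) \<le> E"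
          unfolding E_def using mult_right_mono[of 1 _ "exp (2 * c * ?n) * exp (2 * c * ?n)"] by fastforce
      qed (simp add: less_imp_le add_pos_pos)
      finally show ?thesis by simp
    qed
    have "var_modular r (\<lambda>y. ennreal (indicator (cube a l) y) / ennreal (C * l powr (?n / r x))) \<le>
      (\<integral>\<^sup>+y. ennreal (E / C) * (ennreal (l powr (- ?n)) * indicator (cube a l) y + ennreal (?w y)) \<partial>lebesgue)"
      unfolding var_modular_def
    proof (rule nn_integral_mono)
      fix y
      show "ennpowr (ennreal (indicator (cube a l) y) / ennreal (C * l powr (?n / r x))) (r y) \<le>
        ennreal (E / C) * (ennreal (l powr (- ?n)) * indicator (cube a l) y + ennreal (?w y))"
      proof (cases "y \<in> cube a l")
        case True
        have "ennreal 1 / ennreal (C * l powr (?n / r x)) = ennreal (\<tau> / C)"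
          using C1 l by (subst divide_ennreal) (auto simp: \<tau>_def powr_minus field_simps)
        then have "ennpowr (ennreal (indicator (cube a l) y) / ennreal (C * l powr (?n / r x))) (r y) = ennreal ((\<tau> / C) powr r y)"
          using True \<tau>0 C1 by (simp add: ennpowr_ennreal)
        also have "(\<tau> / C) powr r y \<le> E / C * (l powr (- ?n) + ?w y)"
        proof -
          have "(\<tau> / C) powr r y = \<tau> powr r y / C powr r y" using \<tau>0 C1 by (simp add: powr_divide)
          also have "\<dots> \<le> \<tau> powr r y / C"
            using C1 r1(1)[of y] powr_mono[of 1 "r y" C] by (intro divide_left_mono) auto
          also have "\<dots> \<le> E * (l powr (- ?n) + ?w y) / C"
            using pt[OF True] C1 by (intro divide_right_mono) auto
          finally show ?thesis by simp
        qed
        finally show ?thesis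
          using True C1 E1 by (simp add: ennreal_mult[symmetric] ennreal_plus[symmetric] ennreal_leI del: ennreal_plus)
      qed (simp add: ennpowr_def)
    qed
    also have "\<dots> = ennreal (E / C) * (ennreal (l powr (- ?n)) * emeasure lebesgue (cube a l) + ennreal H)"
      unfolding H(2)[symmetric]
      by (subst nn_integral_cmult, measurable) (subst nn_integral_add, auto simp: nn_integral_cmult_indicator simp del: emeasure_completion)
    also have "\<dots> = ennreal (E / C) * (1 + ennreal H)"
      using l by (simp add: emeasure_cube ennreal_mult[symmetric] powr_minus del: emeasure_completion)
    also have "\<dots> = ennreal (E / C * (1 + H))"
      using H E1 C1 unfolding ennreal_1[symmetric]
      by (simp add: ennreal_mult[symmetric] ennreal_plus[symmetric] del: ennreal_plus ennreal_1)
    also have "E / C * (1 + H) = 1" using E1 H by (simp add: C_def)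
    finally show ?thesis by simp
  qed
  then show thesis using that C1 by blast
qed

text \<open>Translates the norm inequality into a statement about modulars, the form in which test
  functions are inserted.\<close>

lemma bounded_betweenD:
  fixes r q :: "real ^ 'n \<Rightarrow> real"
  assumes [measurable]: "r \<in> borel_measurable lebesgue" "q \<in> borel_measurable lebesgue"
    and r1: "\<And>x. 1 \<le> r x" and q1: "\<And>x. 1 \<le> q x"
    and bdd: "bounded_between r q T"
  obtains C where "0 < C" "\<And>f l. \<lbrakk>f \<in> borel_measurable lebesgue; 0 < l; var_modular r (\<lambda>x. ennreal \<bar>f x\<bar> / ennreal l) \<le> 1\<rbrakk> \<Longrightarrow>
    var_modular q (\<lambda>x. T f x / ennreal (C * l)) \<le> 1"
proof -
  obtain C0 where C0: "\<And>f. f \<in> var_Lebesgue r \<Longrightarrow> T f \<in> var_Lebesgue_enn q"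
     "\<And>f. f \<in> var_Lebesgue r \<Longrightarrow> var_norm_enn q (T f) \<le> C0 * var_norm r f"
    using bdd unfolding bounded_between_def by blast
  \<comment> \<open>\<open>C0\<close> may be negative, and the infimum in the norm is not assumed to
    be attained. \<open>|C0| + 1\<close> makes the norm of \<open>T f\<close> strictly smaller than
    the new scale, so an admissible \<open>l'\<close> exists below it.\<close>
  have "var_modular q (\<lambda>x. T f x / ennreal ((\<bar>C0\<bar> + 1) * l)) \<le> 1"
    if f: "f \<in> borel_measurable lebesgue" and l: "0 < l" and mod: "var_modular r (\<lambda>x. ennreal \<bar>f x\<bar> / ennreal l) \<le> 1" for f l
  proof -
    have "var_modular r (\<lambda>x. ennreal \<bar>f x\<bar> / ennreal l) < \<infinity>"
      using mod by (rule order_le_less_trans) simp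
    then have fL: "f \<in> var_Lebesgue r"
      using f l unfolding var_Lebesgue_def var_Lebesgue_enn_def by auto
    have "0 \<le> var_norm r f"
      unfolding var_norm_def var_norm_enn_def using l mod by (intro cInf_greatest) auto
    moreover have "var_norm r f \<le> l"
      unfolding var_norm_def using l mod by (rule var_norm_enn_le)
    ultimately have "C0 * var_norm r f \<le> \<bar>C0\<bar> * l"
      by (intro mult_mono) auto
    then have lt: "var_norm_enn q (T f) < (\<bar>C0\<bar> + 1) * l"
      using C0(2)[OF fL] l by (simp add: algebra_simps)
    obtain l0 where "0 < l0" "var_modular q (\<lambda>x. T f x / ennreal l0) \<le> 1"
      using var_Lebesgue_enn_modular_le_1[OF assms(2) q1 C0(1)[OF fL]] by blast
    then have "{l. 0 < l \<and> var_modular q (\<lambda>x. T f x / ennreal l) \<le> 1} \<noteq> {}" by blast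
    from cInf_lessD[OF this lt[unfolded var_norm_enn_def]]
    obtain l' where l': "0 < l'" "var_modular q (\<lambda>x. T f x / ennreal l') \<le> 1" "l' < (\<bar>C0\<bar> + 1) * l"
      by auto
    have "var_modular q (\<lambda>x. T f x / ennreal ((\<bar>C0\<bar> + 1) * l)) \<le> var_modular q (\<lambda>x. T f x / ennreal l')"
    proof (rule var_modular_mono)
      show "0 \<le> q x" for x using q1[of x] by linarith
      show "T f x / ennreal ((\<bar>C0\<bar> + 1) * l) \<le> T f x / ennreal l'" for x
        using l' l by (cases "T f x") (auto simp: divide_ennreal ennreal_top_divide intro!: ennreal_leI divide_left_mono mult_pos_pos)
    qed
    then show ?thesis using l'(2) by (rule order_trans)
  qed
  then show thesis using that[of "\<bar>C0\<bar> + 1"] by fastforce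
qed

lemma locally_integrable_cube:
  assumes "locally_integrable b"
  shows "set_integrable lebesgue (cube a l) b"
  using assms unfolding locally_integrable_def cube_def by (blast intro: compact_cbox)

text \<open>Left unnormalised: division by the square of the measure of \<open>Q\<close> gives the
  double average of \<open>|b z - b y|\<close>.\<close>

definition oscillation :: "(real ^ 'n \<Rightarrow> real) \<Rightarrow> (real ^ 'n) set \<Rightarrow> ennreal" where
  "oscillation b Q = (\<integral>\<^sup>+z\<in>Q. (\<integral>\<^sup>+y\<in>Q. ennreal \<bar>b z - b y\<bar> \<partial>lebesgue) \<partial>lebesgue)"

text \<open>On \<open>Q\<close>, the commutator of the indicator of \<open>Q\<close> dominates the
  average of \<open>|b z - b y|\<close> over \<open>y\<close>. Its modular bound together with
  \<open>cube_average_bound\<close> for \<open>q\<close> gives the factor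
  \<open>l powr (- (n / q x))\<close>, the norm of the indicator gives
  \<open>l powr (n / r x)\<close>, and the exponents add up to \<open>\<delta> x\<close>.\<close>

lemma oscillation_bound:
  fixes r q \<delta> b :: "real ^ 'n \<Rightarrow> real"
  assumes r: "log_hoelder c rinf r" and r1: "\<And>x. 1 \<le> r x" "1 \<le> rinf"
    and q: "log_hoelder c' qinf q" and q1: "\<And>x. 1 \<le> q x"
    and [measurable]: "r \<in> borel_measurable lebesgue" "q \<in> borel_measurable lebesgue"
    and rq: "\<And>x. \<delta> x / real CARD('n) = 1 / r x - 1 / q x"
    and b: "locally_integrable b" and bdd: "bounded_between r q (max_commutator b)"
  obtains C where "0 < C" "\<And>a l x. \<lbrakk>0 < l; x \<in> cube a l; l \<le> 1 \<or> l / 2 \<le> norm x\<rbrakk> \<Longrightarrow>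
    oscillation b (cube a l) \<le> ennreal (C * l powr \<delta> x * (l powr real CARD('n))\<^sup>2)"
proof -
  let ?n = "real CARD('n)"
  have n1: "1 \<le> ?n" by (simp add: Suc_leI)
  have [measurable]: "b \<in> borel_measurable lebesgue" by (rule locally_integrable_borel_measurable[OF b])
  obtain C1 where C1: "1 \<le> C1" "\<And>a l x. \<lbrakk>0 < l; x \<in> cube a l; l \<le> 1 \<or> l / 2 \<le> norm x\<rbrakk> \<Longrightarrow>
    var_modular r (\<lambda>y. ennreal (indicator (cube a l) y) / ennreal (C1 * l powr (?n / r x))) \<le> 1"
    by (fact indicator_modular_bound[OF r r1 assms(6)])
  obtain C2 where C2: "0 < C2" "\<And>f l. \<lbrakk>f \<in> borel_measurable lebesgue; 0 < l; var_modular r (\<lambda>x. ennreal \<bar>f x\<bar> / ennreal l) \<le> 1\<rbrakk> \<Longrightarrow>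
    var_modular q (\<lambda>x. max_commutator b f x / ennreal (C2 * l)) \<le> 1"
    by (fact bounded_betweenD[OF assms(6,7) r1(1) q1 bdd])
  obtain C3 where C3: "1 \<le> C3" "\<And>f a l x. \<lbrakk>f \<in> borel_measurable lebesgue; \<And>x. 0 \<le> f x; 0 < l; x \<in> cube a l;
     (\<integral>\<^sup>+y\<in>cube a l. ennreal (f y powr q y) \<partial>lebesgue) \<le> 1; l powr (1 / 2) \<le> exp 1 + norm x\<rbrakk> \<Longrightarrow>
     (\<integral>\<^sup>+y\<in>cube a l. ennreal (f y) \<partial>lebesgue) \<le> ennreal (C3 * l powr (- (?n / q x)) * l powr ?n)"
    by (fact cube_average_bound[OF q q1 assms(7) half_gt_zero[OF zero_less_one]])
  have "oscillation b (cube a l) \<le> ennreal (C1 * C2 * C3 * l powr \<delta> x * (l powr ?n)\<^sup>2)"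
    if l: "0 < l" and x: "x \<in> cube a l" and lx: "l \<le> 1 \<or> l / 2 \<le> norm x" for a l x
  proof -
    let ?Q = "cube a l"
    have lpos: "0 < l powr ?n" using l by simp
    \<comment> \<open>The scale at which the commutator of the indicator has modular at most 1: the
      operator constant times the norm bound for the indicator.\<close>
    define \<mu> where "\<mu> = C2 * (C1 * l powr (?n / r x))"
    have \<mu>: "0 < \<mu>" using C1(1) C2(1) l by (simp add: \<mu>_def)
    define I where "I = (\<lambda>z. \<integral>\<^sup>+y\<in>?Q. ennreal \<bar>b z - b y\<bar> \<partial>lebesgue)"
    interpret L: sigma_finite_measure "lebesgue :: (real ^ 'n) measure" by (rule sigma_finite_lebesgue)
    have [measurable]: "I \<in> borel_measurable lebesgue" unfolding I_def by measurable
    have fin: "I z < top" for z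
    proof -
      have "I z \<le> (\<integral>\<^sup>+y. ennreal \<bar>b z\<bar> * indicator ?Q y + ennreal (norm (indicator ?Q y *\<^sub>R b y)) \<partial>lebesgue)"
        unfolding I_def
      proof (rule nn_integral_mono)
        fix y
        have "ennreal \<bar>b z - b y\<bar> \<le> ennreal \<bar>b z\<bar> + ennreal \<bar>b y\<bar>"
          using ennreal_leI[OF abs_triangle_ineq4[of "b z" "b y"]] by simp
        then show "ennreal \<bar>b z - b y\<bar> * indicator ?Q y \<le> ennreal \<bar>b z\<bar> * indicator ?Q y + ennreal (norm (indicator ?Q y *\<^sub>R b y))"
          by (auto simp: indicator_def)
      qed
      also have "\<dots> = ennreal \<bar>b z\<bar> * emeasure lebesgue ?Q + (\<integral>\<^sup>+y. ennreal (norm (indicator ?Q y *\<^sub>R b y)) \<partial>lebesgue)"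
        by (subst nn_integral_add) (auto simp: nn_integral_cmult_indicator simp del: emeasure_completion)
      also have "\<dots> < top"
      proof -
        have "(\<integral>\<^sup>+y. ennreal (norm (indicator ?Q y *\<^sub>R b y)) \<partial>lebesgue) < \<infinity>"
          using locally_integrable_cube[OF b, of a l] unfolding set_integrable_def integrable_iff_bounded by blast
        then show ?thesis
          using l by (simp add: emeasure_cube ennreal_mult[symmetric] del: emeasure_completion)
      qed
      finally show ?thesis .
    qed
    \<comment> \<open>The average over \<open>y\<close> divided by \<open>\<mu>\<close>, hence at
      most \<open>?M z / \<mu>\<close> on the cube; real-valued thanks to local integrability of
      \<open>b\<close>.\<close>
    define \<phi> where "\<phi> = (\<lambda>z. enn2real (I z) / (l powr ?n * \<mu>))"
    have [measurable]: "\<phi> \<in> borel_measurable lebesgue" unfolding \<phi>_def by measurable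
    have \<phi>0: "0 \<le> \<phi> z" for z using \<mu> by (simp add: \<phi>_def)
    have I\<phi>: "I z = ennreal (\<phi> z * (l powr ?n * \<mu>))" for z
      using \<mu> lpos fin[of z] by (simp add: \<phi>_def)
    let ?M = "max_commutator b (indicator ?Q)"
    have "(\<integral>\<^sup>+z\<in>?Q. ennreal (\<phi> z powr q z) \<partial>lebesgue) \<le> var_modular q (\<lambda>z. ?M z / ennreal \<mu>)"
      unfolding var_modular_def
    proof (rule nn_integral_mono)
      fix z
      show "ennreal (\<phi> z powr q z) * indicator ?Q z \<le> ennpowr (?M z / ennreal \<mu>) (q z)"
      proof (cases "z \<in> ?Q")
        case True
        then have "?Q \<in> {Q \<in> cubes. z \<in> Q}" using l by (auto simp: cubes_eq)
        then have "(\<integral>\<^sup>+y\<in>?Q. ennreal (\<bar>b z - b y\<bar> * \<bar>indicator ?Q y\<bar>) \<partial>lebesgue) / emeasure lebesgue ?Q \<le> ?M z"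
          unfolding max_commutator_def by (rule SUP_upper)
        moreover have "(\<integral>\<^sup>+y\<in>?Q. ennreal (\<bar>b z - b y\<bar> * \<bar>indicator ?Q y\<bar>) \<partial>lebesgue) = I z"
          unfolding I_def by (intro nn_integral_cong) (auto simp: indicator_def)
        moreover have "I z / emeasure lebesgue ?Q = ennreal (\<phi> z * \<mu>)"
          unfolding I\<phi> using l lpos \<mu> \<phi>0[of z]
          by (simp add: emeasure_cube divide_ennreal del: emeasure_completion)
        ultimately have "ennreal (\<phi> z * \<mu>) \<le> ?M z" by simp
        then have "ennreal (\<phi> z * \<mu>) / ennreal \<mu> \<le> ?M z / ennreal \<mu>"
          by (rule divide_right_mono_ennreal)
        then have "ennreal (\<phi> z) \<le> ?M z / ennreal \<mu>"
          using \<mu> \<phi>0[of z] by (simp add: divide_ennreal)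
        then have "ennpowr (ennreal (\<phi> z)) (q z) \<le> ennpowr (?M z / ennreal \<mu>) (q z)"
          using q1[of z] by (intro ennpowr_mono) auto
        then show ?thesis using True \<phi>0[of z] by (simp add: ennpowr_ennreal)
      qed simp
    qed
    also have "\<dots> \<le> 1"
      unfolding \<mu>_def using C1 l x lx by (intro C2(2)) auto
    finally have mod: "(\<integral>\<^sup>+z\<in>?Q. ennreal (\<phi> z powr q z) \<partial>lebesgue) \<le> 1" .
    \<comment> \<open>The condition of \<open>cube_average_bound\<close> for its parameter
      \<open>1 / 2\<close>; either alternative for \<open>l\<close> implies it.\<close>
    have half: "l powr (1 / 2) \<le> exp 1 + norm x"
      using lx
    proof
      assume "l \<le> 1"
      then have "l powr (1 / 2) \<le> 1" using l powr_mono2[of "1 / 2" l 1] by simp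
      then show ?thesis using exp1_norm(1)[of x] by linarith
    next
      assume "l / 2 \<le> norm x"
      have "l powr (1 / 2) = sqrt l" using l by (simp add: powr_half_sqrt)
      also have "\<dots> \<le> (l + 1) / 2" using arith_geo_mean_sqrt[of l 1] l by simp
      also have "\<dots> \<le> exp 1 + norm x" using \<open>l / 2 \<le> norm x\<close> exp1_ge_2 by (simp add: add_divide_distrib)
      finally show ?thesis .
    qed
    have "oscillation b ?Q = (\<integral>\<^sup>+z\<in>?Q. I z \<partial>lebesgue)"
      by (simp only: oscillation_def I_def)
    also have "\<dots> = (\<integral>\<^sup>+z. ennreal (l powr ?n * \<mu>) * (ennreal (\<phi> z) * indicator ?Q z) \<partial>lebesgue)"
      unfolding I\<phi> using \<mu> \<phi>0 lpos
      by (intro nn_integral_cong) (auto simp: indicator_def ennreal_mult[symmetric] mult.commute)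
    also have "\<dots> = ennreal (l powr ?n * \<mu>) * (\<integral>\<^sup>+z\<in>?Q. ennreal (\<phi> z) \<partial>lebesgue)"
      by (rule nn_integral_cmult) measurable
    also have "\<dots> \<le> ennreal (l powr ?n * \<mu>) * ennreal (C3 * l powr (- (?n / q x)) * l powr ?n)"
      by (intro mult_left_mono C3(2)[OF _ \<phi>0 l x mod half]) auto
    also have "\<dots> = ennreal (C1 * C2 * C3 * (l powr (?n / r x) * l powr (- (?n / q x))) * (l powr ?n)\<^sup>2)"
      using C1(1) C2(1) C3(1) by (subst ennreal_mult[symmetric]) (auto simp: \<mu>_def power2_eq_square ac_simps)
    also have "l powr (?n / r x) * l powr (- (?n / q x)) = l powr \<delta> x"
    proof -
      have "\<delta> x = ?n * (1 / r x - 1 / q x)" using rq[of x] n1 by (simp add: field_simps)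
      then have "?n / r x + - (?n / q x) = \<delta> x" by (simp add: algebra_simps)
      then show ?thesis by (simp only: powr_add[symmetric])
    qed
    finally show ?thesis .
  qed
  moreover have "0 < C1 * C2 * C3" using C1(1) C2(1) C3(1) by simp
  ultimately show thesis using that by blast
qed

section \<open>From oscillation decay to variable Lipschitz continuity\<close>

definition cube_avg :: "(real ^ 'n \<Rightarrow> real) \<Rightarrow> real ^ 'n \<Rightarrow> real \<Rightarrow> real" where
  "cube_avg b a l = (LINT y:cube a l|lebesgue. b y) / l powr real CARD('n)"

lemma integrable_indicator_cube: "0 < l \<Longrightarrow> set_integrable lebesgue (cube a l) (\<lambda>_. c :: real)"
  by (auto simp: set_integrable_def emeasure_cube simp del: emeasure_completion intro!: integrable_real_indicator integrable_mult_left)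

lemma cube_avg_deviation:
  fixes b :: "real ^ 'n \<Rightarrow> real"
  assumes b: "locally_integrable b" and l: "0 < l"
  shows "ennreal (\<bar>cube_avg b a l - c\<bar> * l powr real CARD('n)) \<le> (\<integral>\<^sup>+y\<in>cube a l. ennreal \<bar>b y - c\<bar> \<partial>lebesgue)"
proof -
  let ?n = "real CARD('n)"
  have lpos: "0 < l powr ?n" using l by simp
  note ib = locally_integrable_cube[OF b, of a l]
  note ic = integrable_indicator_cube[OF l, of a c]
  have "(LINT y:cube a l|lebesgue. c) = c * l powr ?n"
    using l by (simp add: set_lebesgue_integral_def measure_def emeasure_cube mult.commute del: emeasure_completion measure_completion)
  then have "(LINT y:cube a l|lebesgue. b y - c) = (cube_avg b a l - c) * l powr ?n"
    using lpos by (simp add: set_integral_diff(2)[OF ib ic] cube_avg_def left_diff_distrib)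
  then have "ennreal (\<bar>cube_avg b a l - c\<bar> * l powr ?n) = ennreal (norm (LINT y:cube a l|lebesgue. b y - c))"
    by (simp add: abs_mult)
  also have "\<dots> \<le> (\<integral>\<^sup>+y. ennreal (norm (indicator (cube a l) y *\<^sub>R (b y - c))) \<partial>lebesgue)"
    unfolding set_lebesgue_integral_def
    using set_integral_diff(1)[OF ib ic] by (intro integral_norm_bound_ennreal) (simp add: set_integrable_def)
  also have "\<dots> = (\<integral>\<^sup>+y\<in>cube a l. ennreal \<bar>b y - c\<bar> \<partial>lebesgue)"
    by (intro nn_integral_cong) (auto simp: indicator_def)
  finally show ?thesis .
qed

text \<open>\<open>cube_avg_deviation\<close> is used twice: over the small cube with the average of
  the large cube as constant, then over the large cube with the constant \<open>b z\<close>.\<close>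

lemma cube_avg_diff_le_oscillation:
  fixes b :: "real ^ 'n \<Rightarrow> real"
  assumes b: "locally_integrable b" and l: "0 < l" "0 < l'" and sub: "cube a' l' \<subseteq> cube a l"
  shows "ennreal (\<bar>cube_avg b a' l' - cube_avg b a l\<bar> * l' powr real CARD('n) * l powr real CARD('n)) \<le> oscillation b (cube a l)"
proof -
  let ?n = "real CARD('n)"
  have [measurable]: "b \<in> borel_measurable lebesgue" by (rule locally_integrable_borel_measurable[OF b])
  have "ennreal (\<bar>cube_avg b a' l' - cube_avg b a l\<bar> * l' powr ?n * l powr ?n) =
     ennreal (\<bar>cube_avg b a' l' - cube_avg b a l\<bar> * l' powr ?n) * ennreal (l powr ?n)"
    by (simp add: ennreal_mult)
  also have "\<dots> \<le> (\<integral>\<^sup>+z\<in>cube a' l'. ennreal \<bar>b z - cube_avg b a l\<bar> \<partial>lebesgue) * ennreal (l powr ?n)"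
    by (intro mult_right_mono cube_avg_deviation b l) auto
  also have "\<dots> = (\<integral>\<^sup>+z. ennreal \<bar>b z - cube_avg b a l\<bar> * indicator (cube a' l') z * ennreal (l powr ?n) \<partial>lebesgue)"
    by (rule nn_integral_multc[symmetric]) measurable
  also have "\<dots> \<le> oscillation b (cube a l)"
    unfolding oscillation_def
  proof (rule nn_integral_mono)
    fix z
    have "ennreal \<bar>b z - cube_avg b a l\<bar> * ennreal (l powr ?n) \<le> (\<integral>\<^sup>+y\<in>cube a l. ennreal \<bar>b z - b y\<bar> \<partial>lebesgue)"
      using cube_avg_deviation[OF b l(1), of a "b z"] by (simp add: ennreal_mult abs_minus_commute)
    then show "ennreal \<bar>b z - cube_avg b a l\<bar> * indicator (cube a' l') z * ennreal (l powr ?n)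
       \<le> (\<integral>\<^sup>+y\<in>cube a l. ennreal \<bar>b z - b y\<bar> \<partial>lebesgue) * indicator (cube a l) z"
      using sub by (auto simp: indicator_def)
  qed
  finally show ?thesis .
qed

lemma cube_eq_cbox_One:
  fixes x :: "real ^ 'n"
  shows "cube x h = cbox x (x + h *\<^sub>R One)"
proof -
  have "(One :: real ^ 'n) $ i = 1" for i
  proof -
    have ax: "axis i 1 \<in> (Basis :: (real ^ 'n) set)" by (simp add: axis_in_Basis_iff)
    have "(One :: real ^ 'n) $ i = (\<Sum>b\<in>(Basis :: (real ^ 'n) set). b \<bullet> axis i 1)"
      unfolding cart_eq_inner_axis by (simp add: inner_sum_left)
    also have "\<dots> = (\<Sum>b\<in>(Basis :: (real ^ 'n) set). if b = axis i 1 then 1 else 0)"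
      using ax by (intro sum.cong) (auto simp: inner_Basis)
    also have "\<dots> = 1" using ax by (simp add: sum.delta)
    finally show ?thesis .
  qed
  then have "(\<chi> i. x $ i + h) = x + h *\<^sub>R One" by (simp add: vec_eq_iff)
  then show ?thesis by (simp add: cube_def)
qed

text \<open>The cubes have \<open>x\<close> as lower corner and not as centre, which is the form of
  the differentiation theorem \<open>integrable_ccontinuous_explicit\<close>. One null set serves
  all initial sides \<open>l\<close>.\<close>

lemma lebesgue_points_cube:
  fixes b :: "real ^ 'n \<Rightarrow> real"
  assumes b: "locally_integrable b"
  obtains N where "negligible N" "\<And>x l. x \<notin> N \<Longrightarrow> 0 < l \<Longrightarrow> (\<lambda>k. cube_avg b x (l / 2 ^ k)) \<longlonglongrightarrow> b x"
proof -
  have int: "set_integrable lebesgue (cbox u v) b" for u v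
    using b unfolding locally_integrable_def by (blast intro: compact_cbox)
  then have "b integrable_on cbox u v" for u v
    by (blast intro: set_lebesgue_integral_eq_integral(1))
  from integrable_ccontinuous_explicit[OF this] obtain N where N: "negligible N"
     "\<And>x e. \<lbrakk>x \<notin> N; 0 < e\<rbrakk> \<Longrightarrow> \<exists>d>0. \<forall>h. 0 < h \<and> h < d \<longrightarrow>
        norm (integral (cbox x (x + h *\<^sub>R One)) b /\<^sub>R h ^ DIM(real ^ 'n) - b x) < e"
    by metis
  have "(\<lambda>k. cube_avg b x (l / 2 ^ k)) \<longlonglongrightarrow> b x" if x: "x \<notin> N" and l: "0 < l" for x l
    unfolding lim_sequentially
  proof (intro allI impI)
    fix e :: real assume "0 < e"
    from N(2)[OF x this] obtain d where d: "0 < d" "\<And>h. 0 < h \<Longrightarrow> h < d \<Longrightarrow>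
        norm (integral (cbox x (x + h *\<^sub>R One)) b /\<^sub>R h ^ DIM(real ^ 'n) - b x) < e" by blast
    have "(\<lambda>k. l * (1 / 2) ^ k) \<longlonglongrightarrow> l * 0" by (intro tendsto_mult tendsto_const LIMSEQ_power_zero) auto
    then have "\<forall>\<^sub>F k in sequentially. l * (1 / 2) ^ k < d" using d(1) by (intro order_tendstoD(2)) auto
    then obtain k0 where k0: "\<And>k. k0 \<le> k \<Longrightarrow> l * (1 / 2) ^ k < d" by (auto simp: eventually_sequentially)
    have "dist (cube_avg b x (l / 2 ^ k)) (b x) < e" if k: "k0 \<le> k" for k
    proof -
      let ?h = "l / 2 ^ k"
      have h: "0 < ?h" "?h < d" using l k0[OF k] by (auto simp: power_divide)
      have "(LINT y:cube x ?h|lebesgue. b y) = integral (cube x ?h) b"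
        unfolding cube_def by (rule set_lebesgue_integral_eq_integral(2)[OF int])
      then have "cube_avg b x ?h = integral (cbox x (x + ?h *\<^sub>R One)) b /\<^sub>R ?h ^ DIM(real ^ 'n)"
        using h by (simp add: cube_avg_def cube_eq_cbox_One[symmetric] powr_realpow divide_inverse mult.commute)
      then show ?thesis using d(2)[OF h] by (simp add: dist_norm)
    qed
    then show "\<exists>no. \<forall>k\<ge>no. dist (cube_avg b x (l / 2 ^ k)) (b x) < e" by blast
  qed
  then show thesis using that N(1) by blast
qed

text \<open>Telescoping; the induction carries the exact partial sum of the geometric
  series.\<close>

lemma geometric_steps_limit_bound:
  fixes a :: "nat \<Rightarrow> real"
  assumes lim: "a \<longlonglongrightarrow> L" and step: "\<And>k. \<bar>a (Suc k) - a k\<bar> \<le> B * \<rho> ^ k" and \<rho>: "0 \<le> \<rho>" "\<rho> < 1" and B: "0 \<le> B"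
  shows "\<bar>a 0 - L\<bar> \<le> B / (1 - \<rho>)"
proof -
  have "\<bar>a 0 - a k\<bar> \<le> B * (1 - \<rho> ^ k) / (1 - \<rho>)" for k
  proof (induction k)
    case (Suc k)
    have "\<bar>a 0 - a (Suc k)\<bar> \<le> \<bar>a 0 - a k\<bar> + \<bar>a (Suc k) - a k\<bar>" by linarith
    also have "\<dots> \<le> B * (1 - \<rho> ^ k) / (1 - \<rho>) + B * \<rho> ^ k" using Suc step[of k] by linarith
    also have "\<dots> = B * (1 - \<rho> ^ Suc k) / (1 - \<rho>)" using \<rho> by (simp add: field_simps)
    finally show ?case .
  qed simp
  moreover have "B * (1 - \<rho> ^ k) / (1 - \<rho>) \<le> B / (1 - \<rho>)" for k
    using \<rho> B by (intro divide_right_mono) (auto simp: mult_le_cancel_left2)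
  ultimately have "\<bar>a 0 - a k\<bar> \<le> B / (1 - \<rho>)" for k by (meson order_trans)
  moreover have "(\<lambda>k. \<bar>a 0 - a k\<bar>) \<longlonglongrightarrow> \<bar>a 0 - L\<bar>" by (intro tendsto_intros lim)
  ultimately show ?thesis by (intro LIMSEQ_le_const2) auto
qed

text \<open>Below scale 1 the oscillation is governed by the local exponent \<open>d\<close>, above by the limit exponent.\<close>

definition modulus :: "real \<Rightarrow> real \<Rightarrow> real \<Rightarrow> real" where
  "modulus dinf d l = (if l \<le> 1 then l powr d else l powr dinf)"

lemma modulus_nonneg: "0 \<le> modulus dinf d l"
  by (simp add: modulus_def)

text \<open>A common lower bound \<open>\<theta>\<close> of both exponents gives decay that survives
  the change of exponent at scale 1. In the crossing case \<open>t * l \<le> 1\<close> allows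
  lowering \<open>d\<close> to \<open>\<theta>\<close>, and \<open>1 < l\<close> allows raising
  \<open>\<theta>\<close> to \<open>dinf\<close>.\<close>

lemma modulus_shrink:
  assumes \<theta>: "0 \<le> \<theta>" "\<theta> \<le> d" "\<theta> \<le> dinf" and l: "0 < l" and t: "0 < t" "t \<le> 1"
  shows "modulus dinf d (t * l) \<le> t powr \<theta> * modulus dinf d l"
proof -
  consider "l \<le> 1" | "1 < l" "t * l \<le> 1" | "1 < l" "1 < t * l" by linarith
  then show ?thesis
  proof cases
    case 1
    then have "t * l \<le> 1" using t l by (simp add: mult_le_one)
    then have "modulus dinf d (t * l) = t powr d * l powr d" using t l by (simp add: modulus_def powr_mult)
    also have "\<dots> \<le> t powr \<theta> * l powr d" using t \<theta> by (intro mult_right_mono powr_mono') auto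
    finally show ?thesis using 1 by (simp add: modulus_def)
  next
    case 2
    then have "modulus dinf d (t * l) = (t * l) powr d" by (simp add: modulus_def)
    also have "\<dots> \<le> (t * l) powr \<theta>" using 2 t l \<theta> by (intro powr_mono') auto
    also have "\<dots> = t powr \<theta> * l powr \<theta>" using t l by (simp add: powr_mult)
    also have "\<dots> \<le> t powr \<theta> * l powr dinf" using 2 \<theta> by (intro mult_left_mono powr_mono) auto
    finally show ?thesis using 2 by (simp add: modulus_def)
  next
    case 3
    then have "modulus dinf d (t * l) = t powr dinf * l powr dinf" using t l by (simp add: modulus_def powr_mult)
    also have "\<dots> \<le> t powr \<theta> * l powr dinf" using t \<theta> by (intro mult_right_mono powr_mono') auto
    finally show ?thesis using 3 by (simp add: modulus_def)
  qed
qed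

text \<open>When \<open>2 * l\<close> has passed 1 and \<open>l\<close> has not, the two sides carry
  different exponents; then \<open>(2 * l) powr dinf\<close> is at most \<open>2 powr n\<close> and
  \<open>l powr d\<close> at least \<open>(1 / 2) powr n\<close>, whence
  \<open>4 powr n\<close>.\<close>

lemma modulus_double:
  assumes d: "0 \<le> d" "d \<le> n" and dinf: "0 \<le> dinf" "dinf \<le> n" and l: "0 < l"
  shows "modulus dinf d (2 * l) \<le> 4 powr n * modulus dinf d l"
proof -
  have n: "0 \<le> n" using d by linarith
  have two: "2 powr d \<le> 4 powr n" "2 powr dinf \<le> 4 powr n"
  proof -
    have "2 powr d \<le> 2 powr n" "2 powr dinf \<le> 2 powr n" "(2::real) powr n \<le> 4 powr n"
      using d dinf n by (auto intro: powr_mono powr_mono2)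
    then show "2 powr d \<le> 4 powr n" "2 powr dinf \<le> 4 powr n" by linarith+
  qed
  consider "2 * l \<le> 1" | "1 < 2 * l" "l \<le> 1" | "1 < l" by linarith
  then show ?thesis
  proof cases
    case 1
    then have "modulus dinf d (2 * l) = 2 powr d * l powr d" "modulus dinf d l = l powr d"
      using l by (simp_all add: modulus_def powr_mult)
    then show ?thesis using two by (simp add: mult_right_mono)
  next
    case 2
    have "(2 * l) powr dinf \<le> 2 powr n"
    proof -
      have "(2 * l) powr dinf \<le> 2 powr dinf" using 2 dinf by (intro powr_mono2) auto
      also have "\<dots> \<le> 2 powr n" using dinf by (intro powr_mono) auto
      finally show ?thesis .
    qed
    moreover have "(1 / 2) powr n \<le> l powr d"
    proof -
      have "(1 / 2) powr n \<le> (1 / 2) powr d" using d by (intro powr_mono') auto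
      also have "\<dots> \<le> l powr d" using 2 d by (intro powr_mono2) auto
      finally show ?thesis .
    qed
    then have "4 powr n * (1 / 2) powr n \<le> 4 powr n * l powr d" by (intro mult_left_mono) auto
    moreover have "4 powr n * (1 / 2) powr n = (2::real) powr n"
      by (simp add: powr_mult[symmetric])
    ultimately show ?thesis using 2 by (simp add: modulus_def)
  next
    case 3
    then have "modulus dinf d (2 * l) = 2 powr dinf * l powr dinf" "modulus dinf d l = l powr dinf"
      using l by (simp_all add: modulus_def powr_mult)
    then show ?thesis using two by (simp add: mult_right_mono)
  qed
qed

theorem lipschitz_if_oscillation_bound:
  fixes \<delta> b :: "real ^ 'n \<Rightarrow> real"
  assumes d: "log_hoelder c dinf \<delta>" and \<theta>: "0 < \<theta>" "\<And>x. \<theta> \<le> \<delta> x" "\<theta> \<le> dinf"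
    and dn: "\<And>x. \<delta> x \<le> real CARD('n)" "dinf \<le> real CARD('n)"
    and dinf: "AE x in lebesgue. dinf \<le> \<delta> x"
    and b: "locally_integrable b"
    and C: "0 < C" "\<And>a l x. \<lbrakk>0 < l; x \<in> cube a l; l \<le> 1 \<or> l / 2 \<le> norm x\<rbrakk> \<Longrightarrow>
    oscillation b (cube a l) \<le> ennreal (C * l powr \<delta> x * (l powr real CARD('n))\<^sup>2)"
  shows "b \<in> var_Lipschitz \<delta>"
proof -
  let ?n = "real CARD('n)" and ?m = "\<lambda>x. modulus dinf (\<delta> x)"
  have n1: "1 \<le> ?n" by (simp add: Suc_leI)
  have c0: "0 \<le> c" by (rule log_hoelder_nonneg[OF d])
  have d0: "0 < \<delta> x" "0 < dinf" for x using \<theta>(1) \<theta>(2)[of x] \<theta>(3) by linarith+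
  \<comment> \<open>The factor \<open>exp (2 * c)\<close> pays for replacing the exponent at a far
    point of a large cube by \<open>dinf\<close>.\<close>
  define C1 where "C1 = C * exp (2 * c)"
  have C1: "0 < C1" using C(1) by (simp add: C1_def)
  have osc: "oscillation b (cube a l) \<le> ennreal (C1 * ?m x l * (l powr ?n)\<^sup>2)"
    if l: "0 < l" and x: "x \<in> cube a l" for a l x
  proof (cases "l \<le> 1")
    case True
    have "oscillation b (cube a l) \<le> ennreal (C * l powr \<delta> x * (l powr ?n)\<^sup>2)"
      using C(2)[OF l x] True by blast
    also have "\<dots> \<le> ennreal (C1 * l powr \<delta> x * (l powr ?n)\<^sup>2)"
      using C(1) c0 by (intro ennreal_leI mult_right_mono) (auto simp: C1_def mult_le_cancel_left1)
    finally show ?thesis using True by (simp add: modulus_def)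
  next
    case False
    then have l1: "1 \<le> l" by simp
    obtain z where z: "z \<in> cube a l" "l / 2 \<le> norm z" using far_point_in_cube[OF l] by blast
    have "oscillation b (cube a l) \<le> ennreal (C * l powr \<delta> z * (l powr ?n)\<^sup>2)"
      using C(2)[OF l z(1)] z(2) by blast
    also have "\<dots> \<le> ennreal (C1 * l powr dinf * (l powr ?n)\<^sup>2)"
    proof (intro ennreal_leI mult_right_mono)
      have "l powr \<delta> z \<le> l powr (\<bar>\<delta> z - dinf\<bar> + dinf)" using l1 by (intro powr_mono) auto
      also have "\<dots> = l powr \<bar>\<delta> z - dinf\<bar> * l powr dinf" by (rule powr_add)
      also have "\<dots> \<le> exp (2 * c) * l powr dinf"
        using log_hoelder_large_scale[OF d l1 z(2)] by (intro mult_right_mono) auto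
      finally show "C * l powr \<delta> z \<le> C1 * l powr dinf"
        using C(1) by (simp add: C1_def mult.assoc mult_left_mono)
    qed simp
    finally show ?thesis using False by (simp add: modulus_def)
  qed
  \<comment> \<open>Halving the side changes the measure by \<open>2 powr ?n\<close>, the only loss
    against the oscillation bound.\<close>
  have avg: "\<bar>cube_avg b a' l' - cube_avg b a l\<bar> \<le> C1 * 2 powr ?n * ?m x l"
    if "0 < l" "l' = l / 2" "cube a' l' \<subseteq> cube a l" "x \<in> cube a l" for a a' l l' x
  proof -
    have lpos: "0 < l powr ?n" using that by simp
    have "ennreal (\<bar>cube_avg b a' l' - cube_avg b a l\<bar> * l' powr ?n * l powr ?n) \<le> ennreal (C1 * ?m x l * (l powr ?n)\<^sup>2)"
      using cube_avg_diff_le_oscillation[OF b, of l l' a' a] osc[of l x a] that by (auto intro: order_trans)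
    then have "\<bar>cube_avg b a' l' - cube_avg b a l\<bar> * l' powr ?n * l powr ?n \<le> C1 * ?m x l * (l powr ?n)\<^sup>2"
      using C1 modulus_nonneg[of dinf "\<delta> x" l] by (subst (asm) ennreal_le_iff) auto
    moreover have "l' powr ?n = l powr ?n / 2 powr ?n" unfolding that(2) using that(1) by (simp add: powr_divide)
    ultimately have "\<bar>cube_avg b a' l' - cube_avg b a l\<bar> * (l powr ?n)\<^sup>2 \<le> (C1 * 2 powr ?n * ?m x l) * (l powr ?n)\<^sup>2"
      by (simp add: field_simps power2_eq_square)
    then show ?thesis using lpos by simp
  qed
  obtain N where N: "negligible N" "\<And>x l. x \<notin> N \<Longrightarrow> 0 < l \<Longrightarrow> (\<lambda>k. cube_avg b x (l / 2 ^ k)) \<longlonglongrightarrow> b x"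
    using lebesgue_points_cube[OF b] by blast
  \<comment> \<open>The gain per halving in \<open>modulus_shrink\<close>;
    \<open>\<theta> > 0\<close> makes it less than 1.\<close>
  define \<rho> where "\<rho> = (1 / 2 :: real) powr \<theta>"
  have \<rho>: "0 \<le> \<rho>" "\<rho> < 1" using \<theta>(1) gr_one_powr[of 2 \<theta>] by (auto simp: \<rho>_def powr_divide)
  have point: "\<bar>cube_avg b x l - b x\<bar> \<le> C1 * 2 powr ?n / (1 - \<rho>) * ?m x l" if x: "x \<notin> N" and l: "0 < l" for x l
  proof -
    have "\<bar>cube_avg b x (l / 2 ^ 0) - b x\<bar> \<le> C1 * 2 powr ?n * ?m x l / (1 - \<rho>)"
    proof (rule geometric_steps_limit_bound[OF N(2)[OF x l] _ \<rho>])
      fix k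
      have "cube x (l / 2 ^ Suc k) \<subseteq> cube x (l / 2 ^ k)"
      proof
        fix z assume "z \<in> cube x (l / 2 ^ Suc k)"
        moreover have "l / 2 ^ Suc k \<le> l / 2 ^ k" using l by (intro divide_left_mono) auto
        ultimately show "z \<in> cube x (l / 2 ^ k)" unfolding mem_cube by (meson add_left_mono order_trans)
      qed
      then have "\<bar>cube_avg b x (l / 2 ^ Suc k) - cube_avg b x (l / 2 ^ k)\<bar> \<le> C1 * 2 powr ?n * ?m x (l / 2 ^ k)"
        using l by (intro avg corner_in_cube) auto
      also have "\<dots> \<le> C1 * 2 powr ?n * ((1 / 2 ^ k) powr \<theta> * ?m x l)"
        using modulus_shrink[of \<theta> "\<delta> x" dinf l "1 / 2 ^ k"] \<theta> l C1 by (intro mult_left_mono) (auto simp: less_imp_le)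
      also have "(1 / 2 ^ k) powr \<theta> = \<rho> ^ k"
      proof -
        have "\<rho> ^ k = \<rho> powr real k" by (simp add: \<rho>_def powr_realpow)
        also have "\<dots> = ((1 / 2) powr real k) powr \<theta>" by (simp add: \<rho>_def powr_powr mult.commute)
        finally show ?thesis by (simp add: powr_realpow power_one_over)
      qed
      finally show "\<bar>cube_avg b x (l / 2 ^ Suc k) - cube_avg b x (l / 2 ^ k)\<bar> \<le> C1 * 2 powr ?n * ?m x l * \<rho> ^ k"
        by (simp add: ac_simps)
    qed (use C1 modulus_nonneg in auto)
    then show ?thesis by simp
  qed
  define E where "E = {x. x \<notin> N \<and> dinf \<le> \<delta> x}"
  define C2 where "C2 = C1 * 2 powr ?n / (1 - \<rho>)"
  have C2: "0 < C2" using C1 \<rho> by (simp add: C2_def)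
  \<comment> \<open>\<open>C2\<close> and \<open>C2 * exp c\<close> come from the dyadic sums at
    \<open>x\<close> and at \<open>y\<close>, the latter after an exchange of exponents. The last
    summand is for moving from the two cubes at \<open>x\<close> and \<open>y\<close> to a common
    cube of twice the side.\<close>
  define C3 where "C3 = C2 * (1 + exp c) + 2 * (C1 * 2 powr ?n * 4 powr ?n)"
  have C3: "0 < C3" using C1 C2 by (auto simp: C3_def intro!: add_pos_pos mult_pos_pos)
  have lip: "\<bar>b x - b y\<bar> \<le> C3 * norm (x - y) powr \<delta> x" if x: "x \<in> E" and y: "y \<in> E" for x y
  proof (cases "x = y")
    case False
    define l where "l = norm (x - y)"
    have l: "0 < l" using False by (simp add: l_def)
    \<comment> \<open>The coordinatewise minimum is the corner of a cube of side
      \<open>2 * l\<close> that contains both cubes of side \<open>l\<close>, since coordinates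
      differ by at most \<open>l\<close>.\<close>
    define a where "a = (\<chi> i. min (x $ i) (y $ i))"
    have xy: "\<bar>x $ i - y $ i\<bar> \<le> l" for i
      using component_le_norm_cart[of "x - y" i] by (simp add: l_def)
    have sub: "cube x l \<subseteq> cube a (2 * l)" "cube y l \<subseteq> cube a (2 * l)"
      using xy by (auto simp: mem_cube a_def abs_le_iff min_def) (smt (verit))+
    have xa: "x \<in> cube a (2 * l)" using sub(1) corner_in_cube[of l x] l by auto
    have 1: "\<bar>cube_avg b x l - cube_avg b a (2 * l)\<bar> \<le> C1 * 2 powr ?n * ?m x (2 * l)"
      "\<bar>cube_avg b y l - cube_avg b a (2 * l)\<bar> \<le> C1 * 2 powr ?n * ?m x (2 * l)"
      using l by (intro avg sub xa; simp)+
    have 2: "C1 * 2 powr ?n * ?m x (2 * l) \<le> C1 * 2 powr ?n * (4 powr ?n * ?m x l)"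
      using C1 modulus_double[of "\<delta> x" ?n dinf l] d0(1)[of x] d0(2) dn l by (intro mult_left_mono) auto
    have 3: "\<bar>cube_avg b x l - b x\<bar> \<le> C2 * ?m x l" "\<bar>cube_avg b y l - b y\<bar> \<le> C2 * ?m y l"
      using point[of x l] point[of y l] x y l by (auto simp: C2_def E_def)
    \<comment> \<open>Below scale 1 this is the local log-Hoelder condition; above it both moduli
      equal \<open>l powr dinf\<close>.\<close>
    have 4: "?m y l \<le> exp c * ?m x l"
    proof (cases "l \<le> 1")
      case True
      have "l powr \<delta> y \<le> l powr (- \<bar>\<delta> x - \<delta> y\<bar> + \<delta> x)" using True l by (intro powr_mono') auto
      also have "\<dots> = l powr (- \<bar>\<delta> x - \<delta> y\<bar>) * l powr \<delta> x" by (rule powr_add)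
      also have "\<dots> \<le> exp (c * (1 + ln 1)) * l powr \<delta> x"
        using log_hoelder_small_scale[OF d l True, where k = 1 and x = x and y = y] by (intro mult_right_mono) (auto simp: l_def)
      finally show ?thesis using True by (simp add: modulus_def)
    next
      case False
      then show ?thesis using c0 by (simp add: modulus_def mult_le_cancel_right1)
    qed
    \<comment> \<open>Membership in \<open>E\<close> gives \<open>dinf \<le> \<delta> x\<close>,
      which is what the powers of \<open>l > 1\<close> require.\<close>
    have 5: "?m x l \<le> l powr \<delta> x"
      using x l by (auto simp: modulus_def E_def intro: powr_mono)
    have "\<bar>b x - b y\<bar> \<le> C2 * ?m x l + C2 * (exp c * ?m x l) + 2 * (C1 * 2 powr ?n * (4 powr ?n * ?m x l))"
      using 1 2 3 mult_left_mono[OF 4, of C2] C2 by linarith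
    also have "\<dots> = C3 * ?m x l" by (simp add: C3_def algebra_simps)
    also have "\<dots> \<le> C3 * l powr \<delta> x" using 5 C3 by (intro mult_left_mono) auto
    finally show ?thesis by (simp add: l_def)
  qed simp
  have "AE x in lebesgue. x \<notin> N"
    using N(1) by (simp add: negligible_iff_null_sets AE_not_in)
  with dinf have AE: "AE x in lebesgue. x \<in> E" by eventually_elim (simp add: E_def)
  \<comment> \<open>A negligible set has empty interior, so a set of full measure is dense.\<close>
  have dense: "closure E = UNIV"
  proof -
    from AE have "negligible (- E)"
      by (simp add: negligible_iff_null_sets completion.AE_iff_null_sets Compl_eq eventually_mono)
    then have "negligible (interior (- E))" by (rule negligible_subset) (rule interior_subset)
    then have "interior (- E) = {}" using open_not_negligible by blast
    then show ?thesis unfolding interior_closure by auto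
  qed
  have "uniformly_continuous_on E b"
    unfolding uniformly_continuous_on_def
  proof (intro allI impI)
    fix e :: real assume e: "0 < e"
    \<comment> \<open>The cap 1 allows replacing the variable exponent by \<open>\<theta>\<close>,
      which makes the continuity of \<open>b\<close> on \<open>E\<close> uniform.\<close>
    define D where "D = min 1 ((e / (2 * C3)) powr (1 / \<theta>))"
    have D: "0 < D" using e C3 by (simp add: D_def)
    have "dist (b y) (b x) < e" if "x \<in> E" "y \<in> E" "dist y x < D" for x y
    proof -
      let ?t = "norm (x - y)"
      have t: "?t < D" "?t \<le> 1" "?t \<le> (e / (2 * C3)) powr (1 / \<theta>)" using that(3) by (auto simp: dist_norm norm_minus_commute D_def)
      have "?t powr \<delta> x \<le> ?t powr \<theta>" using t \<theta> by (intro powr_mono') auto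
      also have "\<dots> \<le> ((e / (2 * C3)) powr (1 / \<theta>)) powr \<theta>" using t \<theta>(1) by (intro powr_mono2) auto
      also have "\<dots> = e / (2 * C3)" using e C3 \<theta>(1) by (simp add: powr_powr)
      finally have "C3 * ?t powr \<delta> x \<le> C3 * (e / (2 * C3))" using C3 by (intro mult_left_mono) auto
      also have "\<dots> < e" using C3 e by simp
      finally show ?thesis using lip[OF that(1,2)] by (simp add: dist_real_def abs_minus_commute)
    qed
    then show "\<exists>d>0. \<forall>x\<in>E. \<forall>x'\<in>E. dist x' x < d \<longrightarrow> dist (b x') (b x) < e" using D by blast
  qed
  from uniformly_continuous_on_extension_on_closure[OF this] obtain b' where
    b': "uniformly_continuous_on (closure E) b'" "\<And>x. x \<in> E \<Longrightarrow> b x = b' x" by metis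
  have cb: "continuous_on UNIV b'" using uniformly_continuous_imp_continuous[OF b'(1)] dense by simp
  have "\<bar>b' x - b' y\<bar> \<le> C3 * norm (x - y) powr \<delta> x" for x y
  proof -
    let ?P = "{z. \<bar>b' (fst z) - b' (snd z)\<bar> \<le> C3 * norm (fst z - snd z) powr \<delta> (fst z)}"
    have "closed ?P"
    proof (rule closed_Collect_le)
      show "continuous_on UNIV (\<lambda>z. \<bar>b' (fst z) - b' (snd z)\<bar>)"
        by (intro continuous_intros continuous_on_compose2[OF cb]) auto
      \<comment> \<open>Positivity of \<open>\<delta>\<close> gives continuity on the diagonal too,
        where the base is 0.\<close>
      have "continuous_on UNIV (\<lambda>z :: (real ^ 'n) \<times> (real ^ 'n). norm (fst z - snd z) powr \<delta> (fst z))"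
        by (intro continuous_on_powr' continuous_intros continuous_on_compose2[OF log_hoelder_continuous_on[OF d]])
          (auto simp: d0)
      then show "continuous_on UNIV (\<lambda>z :: (real ^ 'n) \<times> (real ^ 'n). C3 * norm (fst z - snd z) powr \<delta> (fst z))"
        by (rule continuous_on_mult_left)
    qed
    moreover have "E \<times> E \<subseteq> ?P" using lip b'(2) by auto
    ultimately have "closure (E \<times> E) \<subseteq> ?P" by (simp add: closure_minimal)
    then have "(x, y) \<in> ?P" unfolding closure_Times dense by blast
    then show ?thesis by simp
  qed
  moreover have "AE x in lebesgue. b x = b' x" using AE by eventually_elim (rule b'(2))
  ultimately show ?thesis unfolding var_Lipschitz_def by blast
qed

section \<open>From the hypotheses on the exponents to both implications\<close>

lemma var_exponentD:
  assumes "var_exponent p"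
  shows "p \<in> borel_measurable lebesgue" "1 < (INF x. p x)" "(INF x. p x) \<le> p x" "p x \<le> (SUP x. p x)" "1 < p x"
proof -
  have p: "1 < p x" "p \<in> borel_measurable lebesgue" "1 < (INF x. p x)" "bdd_above (range p)" for x
    using assms by (auto simp: var_exponent_def)
  have "bdd_below (range p)" using p(1) by (auto intro!: bdd_belowI[of _ 1] less_imp_le)
  then show "(INF x. p x) \<le> p x" by (intro cINF_lower) auto
  show "p x \<le> (SUP x. p x)" using p(4) by (intro cSUP_upper) auto
qed (use assms in \<open>auto simp: var_exponent_def\<close>)

lemma log_hoelder_limit_ge:
  fixes u :: "real ^ 'n \<Rightarrow> real"
  assumes "log_hoelder c uinf u" "\<And>x. k \<le> u x"
  shows "k \<le> uinf"
  by (rule tendsto_lowerbound[OF log_hoelder_tendsto[OF assms(1)]])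
    (use assms(2) in \<open>auto simp: trivial_limit_at_infinity\<close>)

text \<open>Since \<open>1 / t\<close> is 1-Lipschitz on \<open>t \<ge> 1\<close>,
  \<open>\<delta> x = n * (1 / \<beta> - 1 / p x)\<close> inherits log-Hoelder continuity from
  \<open>p\<close>, together with the value of its limit.\<close>

lemma log_hoelder_reciprocal:
  fixes p :: "real ^ 'n \<Rightarrow> real"
  assumes p: "log_hoelder c pinf p" "\<And>x. 1 \<le> p x" "1 \<le> pinf" and k: "0 \<le> k"
    and d: "\<And>x. \<delta> x = k * (a - 1 / p x)"
  shows "log_hoelder (k * c) (k * (a - 1 / pinf)) \<delta>"
proof -
  have *: "\<bar>k * (a - 1 / s) - k * (a - 1 / t)\<bar> \<le> k * \<bar>s - t\<bar>" if "1 \<le> s" "1 \<le> t" for s t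
  proof -
    have "k * (a - 1 / s) - k * (a - 1 / t) = k * ((s - t) / (s * t))"
      using that by (simp add: field_simps)
    moreover have "\<bar>(s - t) / (s * t)\<bar> \<le> \<bar>s - t\<bar> / 1"
      unfolding abs_divide using that mult_mono[of 1 s 1 t] by (intro frac_le) auto
    then have "k * \<bar>(s - t) / (s * t)\<bar> \<le> k * (\<bar>s - t\<bar> / 1)" using k by (rule mult_left_mono)
    ultimately show ?thesis using k by (simp add: abs_mult)
  qed
  show ?thesis
    unfolding log_hoelder_def
  proof (intro allI conjI)
    fix x y
    have "\<bar>p x - p y\<bar> \<le> c / ln (exp 1 + 1 / norm (x - y))" "\<bar>p x - pinf\<bar> \<le> c / ln (exp 1 + norm x)"
      using p(1) unfolding log_hoelder_def by blast+
    from this[THEN mult_left_mono[OF _ k]]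
    show "\<bar>\<delta> x - \<delta> y\<bar> \<le> k * c / ln (exp 1 + 1 / norm (x - y))"
      "\<bar>\<delta> x - k * (a - 1 / pinf)\<bar> \<le> k * c / ln (exp 1 + norm x)"
      using *[OF p(2)[of x] p(2)[of y]] *[OF p(2)[of x] p(3)] unfolding d by simp_all
  qed
qed

theorem corollary3p5:
  fixes \<delta> p q r b :: "real ^ 'n \<Rightarrow> real" and \<beta> :: real
  assumes delta_range: "\<And>x. 0 < \<delta> x \<and> \<delta> x < real CARD('n)"
    and p: "log_var_exponent p"
    and q: "log_var_exponent q"
    and r: "log_var_exponent r"
    and beta: "1 < \<beta>" "\<beta> < (INF x. p x)"
    and delta_inf: "0 < (INF x. \<delta> x)"
    and r_delta: "(SUP x. r x * \<delta> x) < real CARD('n)"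
    and r_inf_delta: "exponent_at_infinity r * (SUP x. \<delta> x) < real CARD('n)"
    and p_inf: "AE x in lebesgue. exponent_at_infinity p \<le> p x"
    and beta_p_delta: "\<And>x. 1 / \<beta> - 1 / p x = \<delta> x / real CARD('n)"
    and r_q_delta: "\<And>x. \<delta> x / real CARD('n) = 1 / r x - 1 / q x"
    and b: "locally_integrable b"
  shows "b \<in> var_Lipschitz \<delta> \<longleftrightarrow> bounded_between r q (max_commutator b)"
proof -
  let ?n = "real CARD('n)"
  have n1: "1 \<le> ?n" by (simp add: Suc_leI)
  note P = var_exponentD[OF p[unfolded log_var_exponent_def, THEN conjunct1]]
  note Q = var_exponentD[OF q[unfolded log_var_exponent_def, THEN conjunct1]]
  note R = var_exponentD[OF r[unfolded log_var_exponent_def, THEN conjunct1]]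
  define pinf qinf rinf where "pinf = exponent_at_infinity p" and "qinf = exponent_at_infinity q"
    and "rinf = exponent_at_infinity r"
  obtain cp where cp: "log_hoelder cp pinf p" using log_var_exponentE[OF p] unfolding pinf_def .
  obtain cq where cq: "log_hoelder cq qinf q" using log_var_exponentE[OF q] unfolding qinf_def .
  obtain cr where cr: "log_hoelder cr rinf r" using log_var_exponentE[OF r] unfolding rinf_def .
  have p1: "1 \<le> p x" and q1: "1 \<le> q x" and r1: "1 \<le> r x" for x
    using P(5)[of x] Q(5)[of x] R(5)[of x] by auto
  have inf1: "1 \<le> pinf" "1 \<le> rinf"
    using log_hoelder_limit_ge[OF cp p1] log_hoelder_limit_ge[OF cr r1] by auto
  define dinf where "dinf = ?n * (1 / \<beta> - 1 / pinf)"
  have d_eq: "\<delta> x = ?n * (1 / \<beta> - 1 / p x)" for x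
    using beta_p_delta[of x] n1 by (simp add: field_simps)
  have cd: "log_hoelder (?n * cp) dinf \<delta>"
    unfolding dinf_def using n1 by (intro log_hoelder_reciprocal[OF cp p1 inf1(1) _ d_eq]) auto
  have [measurable]: "b \<in> borel_measurable lebesgue" by (rule locally_integrable_borel_measurable[OF b])
  show ?thesis
  proof
    assume "b \<in> var_Lipschitz \<delta>"
    moreover have "r x \<le> q x" for x
    proof -
      have "0 \<le> 1 / r x - 1 / q x" using r_q_delta[of x] delta_range[of x] by (metis divide_nonneg_nonneg less_imp_le of_nat_0_le_iff)
      then show ?thesis using r1[of x] q1[of x] by (simp add: field_simps)
    qed
    moreover have "\<delta> x \<le> (SUP x. \<delta> x)" for x
      using delta_range by (intro cSUP_upper bdd_aboveI[of _ ?n]) (auto intro: less_imp_le)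
    moreover have "rinf * (SUP x. \<delta> x) < ?n" using r_inf_delta by (simp add: rinf_def)
    \<comment> \<open>The \<open>s\<close> of the forward theorem is \<open>INF x. r x\<close>,
      which \<open>var_exponent\<close> keeps above 1, and \<open>dmax\<close> is
      \<open>SUP x. \<delta> x\<close>.\<close>
    ultimately show "bounded_between r q (max_commutator b)"
      using delta_range
      by (intro bounded_max_commutator_if_lipschitz[OF cr R(2) R(3) inf1(2) R(1) Q(1) _ _ Q(4) _ _ _ _ r_q_delta])
        (auto intro: less_imp_le)
  next
    assume bdd: "bounded_between r q (max_commutator b)"
    obtain C where C: "0 < C" "\<And>a l x. \<lbrakk>0 < l; x \<in> cube a l; l \<le> 1 \<or> l / 2 \<le> norm x\<rbrakk> \<Longrightarrow>
      oscillation b (cube a l) \<le> ennreal (C * l powr \<delta> x * (l powr ?n)\<^sup>2)"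
      by (fact oscillation_bound[OF cr r1 inf1(2) cq q1 R(1) Q(1) r_q_delta b bdd])
    have low: "(INF x. \<delta> x) \<le> \<delta> x" for x
      using delta_range by (intro cINF_lower bdd_belowI[of _ 0]) (auto intro: less_imp_le)
    have dn: "dinf \<le> ?n"
    proof -
      have "1 / \<beta> - 1 / pinf \<le> 1" using beta(1) inf1(1) by (smt (verit) divide_le_eq_1 divide_nonneg_nonneg)
      then show ?thesis using n1 by (simp add: dinf_def mult_le_cancel_left1)
    qed
    \<comment> \<open>\<open>1 / \<beta> - 1 / t\<close> increases with \<open>t\<close>, so the
      bound for \<open>p\<close> passes to \<open>\<delta>\<close>.\<close>
    have "AE x in lebesgue. dinf \<le> \<delta> x"
      using p_inf
    proof eventually_elim
      case (elim x)
      then have "1 / p x \<le> 1 / pinf" using inf1(1) by (intro divide_left_mono) (auto simp: pinf_def)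
      then show ?case unfolding d_eq dinf_def by (intro mult_left_mono) auto
    qed
    \<comment> \<open>\<open>\<theta>\<close> is \<open>INF x. \<delta> x\<close>; as a lower bound
      for \<open>\<delta>\<close> it also bounds the limit \<open>dinf\<close> from below.\<close>
    then show "b \<in> var_Lipschitz \<delta>"
      using delta_range dn low
      by (intro lipschitz_if_oscillation_bound[OF cd delta_inf low log_hoelder_limit_ge[OF cd low] _ _ _ b C])
        (auto intro: less_imp_le)
  qed
qed

end
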